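(* Let $(A_N)_{N\ge2}$ be a sequence of coupling matrices such that $\max_{1\le i\le N}R_i\lesssim1$ and $\lim_{N\to\infty}\lambda_1(A_N)=1$. For each $N$ let $\mathcal E_N\subset\{-1,1\}^N$ be arbitrary, and let $\mathbb P$ be the Ising model with parameters $(A_N,\beta,B)$. (a) If $(\beta,B)\in\Theta_1$, then there are constants $c>0$ and $C<\infty$, free of $N$, such that for all $N$ $$\log\mathbb P(\mathcal E_N)\le c\log\mathbb Q(\mathcal E_N)+C\Big(\lVert A_N\rVert_F^2+t^2\sum_{i=1}^N(R_i-1)^2\Big).$$ (b) If $(\beta,B)\in\Theta_2$ and in addition $\limsup_{N\to\infty}\frac{\lambda_2(A_N)}{\lambda_1(A_N)}<1$, then there are constants $c>0$ and $C<\infty$, free of $N$, such that for all $N$ $$\log\mathbb P(\mathcal E_N)\le c\log\mathbb P^{CW}(\mathcal E_N)+C\Big(\lVert A_N\rVert_F^2+\sum_{i=1}^N(R_i-1)^2\Big).$$ (c) If $(\beta,B)\in\Theta_3$ and in addition $\limsup_{N\to\infty}\frac{\lambda_2(A_N)}{\lambda_1(A_N)}<1$, then there are constants $c>0$ and $C<\infty$, free of $N$, such that for all $N$ $$\log\mathbb P(\mathcal E_N)\le c\log\mathbb P^{CW}(\mathcal E_N)+C\Big(\lVert A_N\rVert_F^2+\frac1N\Big[\sum_{i=1}^N(R_i-1)^2\Big]^2+\frac1N\Big[\sum_{i=1}^N(R_i-1)\Big]^2+\log N\Big).$$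
   Context: A coupling matrix $A_N$ is a symmetric $N\times N$ matrix with non-negative entries and zeros on the diagonal. The Ising model with parameters $(A_N,\beta,B)$, $\beta>0$, $B\in\mathbb R$, is the probability mass function on $\boldsymbol\sigma\in\{-1,1\}^N$ given by $\mathbb P(\boldsymbol\sigma)=\frac1{Z_N(\beta,B)}\exp\big(\frac\beta2\boldsymbol\sigma^\top A_N\boldsymbol\sigma+B\sum_{i=1}^N\sigma_i\big)$. Put $\overline{\boldsymbol\sigma}=\frac1N\sum_{i=1}^N\sigma_i$, $R_i=\sum_{j=1}^NA_N(i,j)$, $\lambda_1(A_N)\ge\dots\ge\lambda_N(A_N)$ the eigenvalues, $\lVert\cdot\rVert_F$ the Frobenius norm. Convention: $\log0=-\infty$. Parameter regimes: $\Theta_{11}=\{(\beta,0):0<\beta<1\}$, $\Theta_{12}=\{(\beta,B):\beta>0,B\ne0\}$, $\Theta_1=\Theta_{11}\cup\Theta_{12}$, $\Theta_2=\{(\beta,0):\beta>1\}$, $\Theta_3=\{(1,0)\}$. For $(\beta,B)\in\Theta_{11}$, $t=0$; for $(\beta,B)\in\Theta_{12}$, $t$ is the unique solution of $x=\tanh(\beta x+B)$ with the same sign as $B$. $\mathbb Q$ is the i.i.d. measure on $\{-1,1\}^N$ given by $\mathbb Q(\sigma_1,\dots,\sigma_N)=\big(e^{-\beta t-B}+e^{\beta t+B}\big)^{-N}\exp\big((\beta t+B)\sum_{i=1}^N\sigma_i\big)$. $\mathbb P^{CW}$ is the Curie–Weiss model on $\{-1,1\}^N$ with the same $(\beta,B)$: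 $\mathbb P^{CW}(\boldsymbol\sigma)=\frac1{Z_N^{CW}(\beta,B)}\exp\big(\frac{N\beta}2\overline{\boldsymbol\sigma}^2+B\sum_{i=1}^N\sigma_i\big)$. $\max_iR_i\lesssim1$ means $\sup_N\max_{1\le i\le N}R_i<\infty$. The constants $c,C$ may depend on $\beta,B$ and on the sequences. *)

theory Defs
  imports
    "HOL-Probability.Probability"
    "Jordan_Normal_Form.Char_Poly"
begin

(* HOL-Analysis has its own type vec and its own $; below, vec and $ are those of
   Jordan_Normal_Form, whose dimensions are natural numbers rather than types. *)
unbundle no vec_syntax
hide_type (open) Finite_Cartesian_Product.vec
hide_const (open) Finite_Cartesian_Product.vec

definition coupling_matrix :: "nat \<Rightarrow> real mat \<Rightarrow> bool" where
  "coupling_matrix N A \<longleftrightarrow>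
     A \<in> carrier_mat N N \<and> transpose_mat A = A \<and>
     (\<forall>i<N. \<forall>j<N. A $$ (i, j) \<ge> 0) \<and> (\<forall>i<N. A $$ (i, i) = 0)"

definition row_total :: "real mat \<Rightarrow> nat \<Rightarrow> real" where
  "row_total A i = (\<Sum>j<dim_col A. A $$ (i, j))"

definition frobenius_norm :: "real mat \<Rightarrow> real" where
  "frobenius_norm A = sqrt (\<Sum>i<dim_row A. \<Sum>j<dim_col A. (A $$ (i, j))\<^sup>2)"

(* The k-th largest eigenvalue, k = 1, 2, ..., counted with multiplicity. It is meant for
   symmetric A, whose characteristic polynomial splits over the reals. *)
definition nth_eigenvalue :: "real mat \<Rightarrow> nat \<Rightarrow> real" where
  "nth_eigenvalue A k = rev (sorted_list_of_multiset (proots (char_poly A))) ! (k - 1)"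

definition spin_configs :: "nat \<Rightarrow> real vec set" where
  "spin_configs N = {\<sigma> \<in> carrier_vec N. \<forall>i<N. \<sigma> $ i \<in> {-1, 1}}"

definition spin_sum :: "real vec \<Rightarrow> real" where
  "spin_sum \<sigma> = (\<Sum>i<dim_vec \<sigma>. \<sigma> $ i)"

definition spin_mean :: "real vec \<Rightarrow> real" where
  "spin_mean \<sigma> = spin_sum \<sigma> / real (dim_vec \<sigma>)"

definition partition_function :: "nat \<Rightarrow> (real vec \<Rightarrow> real) \<Rightarrow> real" where
  "partition_function N H = (\<Sum>\<sigma>\<in>spin_configs N. exp (H \<sigma>))"

definition gibbs_pmf :: "nat \<Rightarrow> (real vec \<Rightarrow> real) \<Rightarrow> real vec pmf" where
  "gibbs_pmf N H =
     embed_pmf (\<lambda>\<sigma>. if \<sigma> \<in> spin_configs N then exp (H \<sigma>) / partition_function N H else 0)"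

definition ising_pmf :: "real mat \<Rightarrow> real \<Rightarrow> real \<Rightarrow> real vec pmf" where
  "ising_pmf A \<beta> B =
     gibbs_pmf (dim_row A) (\<lambda>\<sigma>. \<beta> / 2 * scalar_prod \<sigma> (A *\<^sub>v \<sigma>) + B * spin_sum \<sigma>)"

definition curie_weiss_pmf :: "nat \<Rightarrow> real \<Rightarrow> real \<Rightarrow> real vec pmf" where
  "curie_weiss_pmf N \<beta> B =
     gibbs_pmf N (\<lambda>\<sigma>. real N * \<beta> / 2 * (spin_mean \<sigma>)\<^sup>2 + B * spin_sum \<sigma>)"

definition Theta11 :: "(real \<times> real) set" where
  "Theta11 = {(\<beta>, B). 0 < \<beta> \<and> \<beta> < 1 \<and> B = 0}"

definition Theta12 :: "(real \<times> real) set" where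
  "Theta12 = {(\<beta>, B). \<beta> > 0 \<and> B \<noteq> 0}"

definition Theta1 :: "(real \<times> real) set" where
  "Theta1 = Theta11 \<union> Theta12"

definition Theta2 :: "(real \<times> real) set" where
  "Theta2 = {(\<beta>, B). \<beta> > 1 \<and> B = 0}"

definition Theta3 :: "(real \<times> real) set" where
  "Theta3 = {(1, 0)}"

(* Only used on Theta1, where B = 0 means Theta11. *)
definition mf_root :: "real \<Rightarrow> real \<Rightarrow> real" where
  "mf_root \<beta> B = (if B = 0 then 0 else (THE x. x = tanh (\<beta> * x + B) \<and> sgn x = sgn B))"

definition iid_pmf :: "nat \<Rightarrow> real \<Rightarrow> real \<Rightarrow> real vec pmf" where
  "iid_pmf N \<beta> B =
     (let t = mf_root \<beta> B in
      embed_pmf (\<lambda>\<sigma>. if \<sigma> \<in> spin_configs N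
        then exp ((\<beta> * t + B) * spin_sum \<sigma>) / (exp (- \<beta> * t - B) + exp (\<beta> * t + B)) ^ N
        else 0))"

definition log_ext :: "real \<Rightarrow> ereal" where
  "log_ext x = (if x = 0 then - \<infinity> else ereal (ln x))"

lemma spin_configs_0: "spin_configs 0 = {vNil}"
  by (auto simp: spin_configs_def)

lemma spin_configs_Suc:
  "spin_configs (Suc N) = (\<lambda>(a, \<sigma>). vCons a \<sigma>) ` ({-1, 1} \<times> spin_configs N)"
proof (rule Set.set_eqI, rule iffI)
  fix v assume "v \<in> spin_configs (Suc N)"
  then have v: "v \<in> carrier_vec (Suc N)" "\<forall>i<Suc N. v $ i \<in> {-1, 1}"
    by (auto simp: spin_configs_def)
  then obtain a \<sigma> where av: "v = vCons a \<sigma>" "\<sigma> \<in> carrier_vec N"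
    by (cases v) auto
  have "a \<in> {-1, 1}" using v(2) av by force
  moreover have "\<sigma> $ i \<in> {-1, 1}" if "i < N" for i
    using v(2)[rule_format, of "Suc i"] av that by auto
  ultimately show "v \<in> (\<lambda>(a, \<sigma>). vCons a \<sigma>) ` ({-1, 1} \<times> spin_configs N)"
    using av by (auto simp: spin_configs_def)
next
  fix v assume "v \<in> (\<lambda>(a, \<sigma>). vCons a \<sigma>) ` ({-1, 1} \<times> spin_configs N)"
  then obtain a \<sigma> where "v = vCons a \<sigma>" "a \<in> {-1, 1}" "\<sigma> \<in> spin_configs N"
    by auto
  then show "v \<in> spin_configs (Suc N)"
    by (auto simp: spin_configs_def vec_index_vCons)
qed

lemma finite_spin_configs: "finite (spin_configs N)"
  by (induction N) (simp_all add: spin_configs_0 spin_configs_Suc)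

lemma spin_configs_nonempty: "spin_configs N \<noteq> {}"
  by (induction N) (simp_all add: spin_configs_0 spin_configs_Suc)

lemma spin_sum_vCons: "spin_sum (vCons a \<sigma>) = a + spin_sum \<sigma>"
  by (simp add: spin_sum_def sum.lessThan_Suc_shift del: sum.lessThan_Suc)

lemma sum_exp_spin_sum:
  "(\<Sum>\<sigma>\<in>spin_configs N. exp (h * spin_sum \<sigma>)) = (exp (- h) + exp h) ^ N"
proof (induction N)
  case 0
  then show ?case by (simp add: spin_configs_0 spin_sum_def)
next
  case (Suc N)
  have inj: "inj_on (\<lambda>(a, \<sigma>). vCons a \<sigma>) ({-1, 1} \<times> spin_configs N)"
    by (auto simp: inj_on_def)
  have "(\<Sum>\<sigma>\<in>spin_configs (Suc N). exp (h * spin_sum \<sigma>))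
      = (\<Sum>(a, \<sigma>)\<in>{-1, 1} \<times> spin_configs N. exp (h * a) * exp (h * spin_sum \<sigma>))"
    unfolding spin_configs_Suc sum.reindex[OF inj]
    by (intro sum.cong) (auto simp: spin_sum_vCons algebra_simps exp_add[symmetric])
  also have "\<dots> = (\<Sum>a\<in>{-1, 1}. exp (h * a)) * (\<Sum>\<sigma>\<in>spin_configs N. exp (h * spin_sum \<sigma>))"
    by (simp add: sum.cartesian_product[symmetric] sum_distrib_left[symmetric] distrib_right)
  finally show ?case using Suc by simp
qed

lemma partition_function_pos: "partition_function N H > 0"
  unfolding partition_function_def
  by (rule sum_pos) (simp_all add: finite_spin_configs spin_configs_nonempty)

lemma pmf_embed_spin:
  assumes "\<And>\<sigma>. f \<sigma> \<ge> 0" "(\<Sum>\<sigma>\<in>spin_configs N. f \<sigma>) = 1"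
  shows "pmf (embed_pmf (\<lambda>\<sigma>. if \<sigma> \<in> spin_configs N then f \<sigma> else 0)) \<sigma>
    = (if \<sigma> \<in> spin_configs N then f \<sigma> else 0)"
proof (rule pmf_embed_pmf)
  have "(\<integral>\<^sup>+ \<sigma>. ennreal (if \<sigma> \<in> spin_configs N then f \<sigma> else 0) \<partial>count_space UNIV)
      = (\<Sum>\<sigma>\<in>spin_configs N. ennreal (f \<sigma>))"
    by (subst nn_integral_count_space'[OF finite_spin_configs[of N]])
       (auto intro!: sum.cong)
  also have "\<dots> = 1"
    using assms by (simp add: sum_ennreal)
  finally show "(\<integral>\<^sup>+ \<sigma>. ennreal (if \<sigma> \<in> spin_configs N then f \<sigma> else 0) \<partial>count_space UNIV) = 1" .
qed (use assms in auto)

lemma pmf_gibbs_pmf: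
  "pmf (gibbs_pmf N H) \<sigma>
    = (if \<sigma> \<in> spin_configs N then exp (H \<sigma>) / partition_function N H else 0)"
  unfolding gibbs_pmf_def using partition_function_pos[of N H]
  by (intro pmf_embed_spin)
     (simp_all add: sum_divide_distrib[symmetric] partition_function_def[symmetric])

lemma pmf_iid_pmf:
  "pmf (iid_pmf N \<beta> B) \<sigma>
    = (if \<sigma> \<in> spin_configs N
       then exp ((\<beta> * mf_root \<beta> B + B) * spin_sum \<sigma>)
         / (exp (- \<beta> * mf_root \<beta> B - B) + exp (\<beta> * mf_root \<beta> B + B)) ^ N
       else 0)"
proof -
  define h where "h = \<beta> * mf_root \<beta> B + B"
  have eq: "- \<beta> * mf_root \<beta> B - B = - h"
    by (simp add: h_def)
  have "exp (- h) + exp h \<noteq> 0"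
    using exp_gt_zero[of h] exp_gt_zero[of "- h"] by linarith
  then show ?thesis
    unfolding iid_pmf_def Let_def eq h_def[symmetric]
    by (intro pmf_embed_spin)
       (simp_all add: sum_divide_distrib[symmetric] sum_exp_spin_sum add_nonneg_nonneg)
qed

lemma mf_root_ex1_pos:
  fixes \<beta> B :: real
  assumes "\<beta> > 0" "B > 0"
  shows "\<exists>!x. x = tanh (\<beta> * x + B) \<and> x > 0"
proof -
  define h where "h = (\<lambda>x. tanh (\<beta> * x + B) - x)"
  have h': "(h has_real_derivative \<beta> * (1 - (tanh (\<beta> * x + B))\<^sup>2) - 1) (at x)" for x
    unfolding h_def
    by (auto intro!: derivative_eq_intros simp: cosh_real_nonzero)
  have cont: "continuous_on S h" for S
    using h' by (meson DERIV_continuous_on has_field_derivative_at_within)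
  have h0: "h 0 > 0" using assms by (simp add: h_def)
  have h1: "h 1 \<le> 0" using tanh_real_lt_1[of "\<beta> * 1 + B"] by (simp add: h_def)
  obtain x where x: "0 \<le> x" "x \<le> 1" "h x = 0"
    using IVT2'[of h 1 0 0] h0 h1 cont by (auto simp: less_imp_le)
  have uniq: False if u: "0 < u" "u < v" "h u = 0" "h v = 0" for u v
  proof -
    obtain r where r: "0 < r" "r < u"
      "h u - h 0 = (u - 0) * (\<beta> * (1 - (tanh (\<beta> * r + B))\<^sup>2) - 1)"
      using MVT2[OF u(1) h'] by blast
    obtain s where s: "u < s" "s < v"
      "h v - h u = (v - u) * (\<beta> * (1 - (tanh (\<beta> * s + B))\<^sup>2) - 1)"
      using MVT2[OF u(2) h'] by blast
    have "u * (\<beta> * (1 - (tanh (\<beta> * r + B))\<^sup>2) - 1) < 0"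
      using r(3) u h0 by simp
    then have 1: "\<beta> * (1 - (tanh (\<beta> * r + B))\<^sup>2) - 1 < 0"
      using u(1) by (simp add: mult_less_0_iff)
    have 2: "\<beta> * (1 - (tanh (\<beta> * s + B))\<^sup>2) - 1 = 0"
      using s(3) u by simp
    have "\<beta> * r \<le> \<beta> * s" using r s assms by (intro mult_left_mono) auto
    then have "tanh (\<beta> * r + B) \<le> tanh (\<beta> * s + B)" by simp
    moreover have "tanh (\<beta> * r + B) \<ge> 0" using r assms by simp
    ultimately have "(tanh (\<beta> * r + B))\<^sup>2 \<le> (tanh (\<beta> * s + B))\<^sup>2"
      by (intro power_mono)
    then have "\<beta> * (1 - (tanh (\<beta> * s + B))\<^sup>2) \<le> \<beta> * (1 - (tanh (\<beta> * r + B))\<^sup>2)"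
      using assms by (intro mult_left_mono) auto
    with 1 2 show False by linarith
  qed
  have "x > 0" using x h0 by (cases "x = 0") auto
  show ?thesis
  proof (rule ex1I[of _ x])
    show "x = tanh (\<beta> * x + B) \<and> x > 0"
      using x \<open>x > 0\<close> by (simp add: h_def)
    fix y assume "y = tanh (\<beta> * y + B) \<and> y > 0"
    then show "y = x"
      using uniq[of x y] uniq[of y x] x(3) \<open>x > 0\<close>
      by (cases x y rule: linorder_cases) (auto simp: h_def)
  qed
qed

lemma mf_root_ex1:
  fixes \<beta> B :: real
  assumes "\<beta> > 0" "B \<noteq> 0"
  shows "\<exists>!x. x = tanh (\<beta> * x + B) \<and> sgn x = sgn B"
proof (cases "B > 0")
  case True
  then show ?thesis
    using mf_root_ex1_pos[OF assms(1) True] by (simp add: sgn_1_pos)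
next
  case False
  with assms have B: "- B > 0" by simp
  have eq: "x = tanh (\<beta> * x + B) \<and> sgn x = sgn B \<longleftrightarrow> - x = tanh (\<beta> * (- x) + (- B)) \<and> - x > 0" for x
  proof -
    have "tanh (\<beta> * (- x) + (- B)) = - tanh (\<beta> * x + B)"
      using tanh_minus[of "\<beta> * x + B"] by simp
    then show ?thesis using B by (auto simp: sgn_1_neg)
  qed
  show ?thesis
    unfolding eq using mf_root_ex1_pos[OF assms(1) B] by (metis minus_minus)
qed

lemma mf_root_Theta12:
  assumes "(\<beta>, B) \<in> Theta12"
  shows "mf_root \<beta> B = tanh (\<beta> * mf_root \<beta> B + B)" "sgn (mf_root \<beta> B) = sgn B"
  using theI'[OF mf_root_ex1[of \<beta> B]] assms by (auto simp: mf_root_def Theta12_def)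

end

theory Submission
  imports Defs
begin

text \<open>By Hoelder's inequality it is enough to bound the \<open>p\<close>-th moment of the density of the Ising model
  with respect to the reference measure, for some \<open>p > 1\<close> close to 1. The partition function in the
  denominator is bounded below by Jensen's inequality for the product measure of mean \<open>t\<close>.

  For the numerator, \<open>ln (cosh (sqrt v))\<close> is concave in \<open>v\<close>, so a spin in a field \<open>h\<close> is sub-Gaussian with
  variance proxy \<open>tanh h / h\<close>. The diagonal of a coupling matrix vanishes, so the Hamiltonian is affine in
  each spin and the spins can be replaced by Gaussians one at a time. The resulting Gaussian integral with
  matrix \<open>M\<close> is finite if \<open>M \<le> 1 - \<delta>\<close>, and its logarithm is of order \<open>tr M\<close> (which is zero) plus the squared
  Frobenius norm. For \<open>B \<noteq> 0\<close> or \<open>\<beta> < 1\<close> one has \<open>\<beta> tanh h / h < 1\<close> at \<open>h = \<beta> t + B\<close>, which gives (a).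

  For (b) and (c) the Curie--Weiss part of the Hamiltonian is first linearized by a Gaussian field \<open>y\<close>. The
  spectral gap makes the remaining coupling subcritical for each \<open>y\<close>, unless the constant vector is far from
  being an eigenvector, in which case the error term exceeds a multiple of \<open>N\<close>. The integral over \<open>y\<close> is
  controlled by the quadratic (for \<open>\<beta> > 1\<close>) or quartic (for \<open>\<beta> = 1\<close>) growth of \<open>\<beta> y\<^sup>2 / 2 - ln (cosh (\<beta> y))\<close>
  at its minimizers.\<close>

section \<open>One spin in a field\<close>

text \<open>The terms of order N must cancel exactly, not merely to leading order. The upper bound
  expands the Hamiltonian about the mean \<mu> of the comparison Gaussian, the lower bound about the
  mean t; where the two agree, the entropy, the mean-field energy and the term linear in the sum of
  the R_i - 1 coincide, and only second-order errors survive. In the Curie--Weiss regimes \<mu>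
  varies with the field y, and (\<mu>^2 - t^2) times that sum has to be paid for by the potential: a
  quadratic well leaves its square divided by N, at most the sum of the (R_i - 1)^2, whereas a
  quartic well leaves the squares divided by N that appear in (c); the Gaussians dominating its
  field integral have width sqrt N, whence log N.

  The exponent is c = 1 - 1/p. The p-th moment multiplies by p the coupling that is not part of the
  reference measure, so p is dictated by the distance to criticality. The spectral hypotheses act
  only for large N. For the other N, and when the rows are far from constant, it is enough that the
  probability is at most 1, that a nonempty event has reference probability at least exp (-O(N)),
  and that the error term is large enough.\<close>

lemma tanh_mult_le:
  fixes x y :: real
  assumes "0 \<le> x" "x \<le> y"
  shows "x * tanh y \<le> y * tanh x"
proof (cases "y = 0")
  case False
  define l where "l = x / y"
  have l: "0 \<le> l" "l \<le> 1" "x = l * y" and y: "y > 0"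
    using assms False by (auto simp: l_def)
  \<comment> \<open>The claim is concavity of tanh on the half-line: tanh (l * y) is at least l *
    tanh y for l in [0, 1].\<close>
  define k where "k = (\<lambda>z. tanh (l * z) - l * tanh z)"
  have "k 0 \<le> k y"
  proof (rule DERIV_nonneg_imp_nondecreasing[of 0 y k])
    show "0 \<le> y" using y by simp
    fix z assume z: "0 \<le> z" "z \<le> y"
    have "(k has_real_derivative l * (1 - (tanh (l * z))\<^sup>2) - l * (1 - (tanh z)\<^sup>2)) (at z)"
      unfolding k_def by (auto intro!: derivative_eq_intros simp: cosh_real_nonzero)
    moreover have "(tanh (l * z))\<^sup>2 \<le> (tanh z)\<^sup>2"
      using l z by (intro power_mono) (auto intro: mult_left_le_one_le)
    then have "0 \<le> l * (1 - (tanh (l * z))\<^sup>2) - l * (1 - (tanh z)\<^sup>2)"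
      using l by (simp add: right_diff_distrib mult_left_mono)
    ultimately show "\<exists>y. (k has_real_derivative y) (at z) \<and> 0 \<le> y"
      by blast
  qed
  then have "l * tanh y \<le> tanh x" using l by (simp add: k_def)
  then have "y * (l * tanh y) \<le> y * tanh x" using y by (intro mult_left_mono) auto
  then show ?thesis using l by (simp add: algebra_simps)
qed (use assms in auto)

lemma tanh_le_self: "0 \<le> x \<Longrightarrow> tanh x \<le> (x::real)"
proof -
  assume "0 \<le> x"
  have "0 - tanh 0 \<le> x - tanh x"
  proof (rule DERIV_nonneg_imp_nondecreasing[OF \<open>0 \<le> x\<close>])
    fix z :: real
    have "((\<lambda>z. z - tanh z) has_real_derivative (tanh z)\<^sup>2) (at z)"
      by (auto intro!: derivative_eq_intros simp: cosh_real_nonzero)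
    then show "\<exists>y. ((\<lambda>z. z - tanh z) has_real_derivative y) (at z) \<and> 0 \<le> y" by force
  qed
  then show ?thesis by simp
qed

text \<open>Twice the slope of v -> ln (cosh (sqrt v)) at v = a^2, with the limit value 1 at a = 0.
  It becomes the coefficient of s^2 / 2 in the sub-Gaussian bounds.\<close>

definition spin_variance :: "real \<Rightarrow> real" where
  "spin_variance a = (if a = 0 then 1 else tanh a / a)"

lemma spin_variance_abs [simp]: "spin_variance \<bar>a\<bar> = spin_variance a"
  by (simp add: abs_if spin_variance_def)

lemma spin_variance_mult: "spin_variance a * a = tanh a"
  by (simp add: spin_variance_def)

lemma spin_variance_pos: "spin_variance a > 0"
  by (cases a "0::real" rule: linorder_cases) (auto simp: spin_variance_def divide_neg_neg)

lemma spin_variance_le_1: "spin_variance a \<le> 1"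
proof -
  have "spin_variance \<bar>a\<bar> \<le> 1"
    using tanh_le_self[of "\<bar>a\<bar>"] by (auto simp: spin_variance_def divide_le_eq)
  then show ?thesis by simp
qed

text \<open>This monotonicity is the concavity of v -> ln (cosh (sqrt v)), since
  \<open>spin_variance\<close> is twice its slope.\<close>

lemma spin_variance_antimono:
  assumes "0 \<le> a" "a \<le> b"
  shows "spin_variance b \<le> spin_variance a"
proof (cases "a = 0")
  case True
  then show ?thesis using spin_variance_le_1[of b] by (simp add: spin_variance_def)
next
  case False
  then show ?thesis
    using assms tanh_mult_le[OF assms] by (auto simp: spin_variance_def field_simps)
qed

text \<open>The function \<open>v \<mapsto> ln (cosh (sqrt v))\<close> is concave; this is its tangent line at \<open>a\<^sup>2\<close>.\<close>
lemma ln_cosh_le_tangent: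
  "ln (cosh u) \<le> ln (cosh a) + spin_variance a * (u\<^sup>2 - a\<^sup>2) / 2"
proof -
  define f where "f = (\<lambda>u. spin_variance a * u\<^sup>2 / 2 - ln (cosh u))"
  have f': "(f has_real_derivative spin_variance a * u - tanh u) (at u)" for u
    unfolding f_def
    by (auto intro!: derivative_eq_intros simp: cosh_real_pos tanh_def field_simps)
  have sv: "spin_variance a * u - tanh u = u * (spin_variance a - spin_variance u)" for u
    by (simp add: spin_variance_mult[symmetric] algebra_simps)
  \<comment> \<open>By \<open>sv\<close> the derivative of \<open>f\<close> is z times the
    difference of the two variances, so on the half-line \<open>f\<close> decreases up to
    \<bar>a\<bar> and increases afterwards; evenness of \<open>f\<close> handles the signs.\<close>
  have "f \<bar>a\<bar> \<le> f \<bar>u\<bar>"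
  proof (cases "\<bar>a\<bar> \<le> \<bar>u\<bar>")
    case True
    then show ?thesis
    proof (rule DERIV_nonneg_imp_nondecreasing)
      fix z assume "\<bar>a\<bar> \<le> z"
      then have "0 \<le> z * (spin_variance a - spin_variance z)"
        using spin_variance_antimono[of "\<bar>a\<bar>" z] by (intro mult_nonneg_nonneg) auto
      then show "\<exists>y. (f has_real_derivative y) (at z) \<and> 0 \<le> y"
        using f'[of z] unfolding sv by blast
    qed
  next
    case False
    then have "\<bar>u\<bar> \<le> \<bar>a\<bar>" by simp
    then show ?thesis
    proof (rule DERIV_nonpos_imp_nonincreasing)
      fix z assume "\<bar>u\<bar> \<le> z" "z \<le> \<bar>a\<bar>"
      then have "z * (spin_variance a - spin_variance z) \<le> 0"
        using spin_variance_antimono[of z "\<bar>a\<bar>"] by (intro mult_nonneg_nonpos) auto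
      then show "\<exists>y. (f has_real_derivative y) (at z) \<and> y \<le> 0"
        using f'[of z] unfolding sv by blast
    qed
  qed
  then have "f a \<le> f u" by (simp add: f_def)
  then show ?thesis by (simp add: f_def field_simps)
qed

text \<open>The left side is the unnormalized moment generating function of one spin in the field h.
  Its logarithm is bounded by a parabola with value c, slope \<mu> and curvature K at s = 0. These
  need not be the true log-partition function, mean and variance; that freedom is needed at low
  temperature.\<close>

definition spin_bound :: "real \<Rightarrow> real \<Rightarrow> real \<Rightarrow> real \<Rightarrow> bool" where
  "spin_bound h c \<mu> K \<longleftrightarrow>
     (\<forall>s. exp (h + s) + exp (- (h + s)) \<le> exp (c + \<mu> * s + K * s\<^sup>2 / 2))"

text \<open>The tangent line at a^2, read at v = (h + s)^2, is a parabola in s. Taking a with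
  \<bar>a\<bar> larger than \<bar>h\<bar> buys a smaller curvature at the price of a larger constant
  term.\<close>

lemma spin_bound_tangent:
  "spin_bound h (ln (2 * cosh a) + spin_variance a * (h\<^sup>2 - a\<^sup>2) / 2)
     (spin_variance a * h) (spin_variance a)"
  unfolding spin_bound_def
proof
  fix s
  have "exp (h + s) + exp (- (h + s)) = exp (ln 2 + ln (cosh (h + s)))"
    by (simp add: exp_add cosh_real_pos) (simp add: cosh_def exp_add)
  also have "\<dots> \<le> exp (ln 2 + (ln (cosh a) + spin_variance a * ((h + s)\<^sup>2 - a\<^sup>2) / 2))"
    using ln_cosh_le_tangent by simp
  also have "ln 2 + (ln (cosh a) + spin_variance a * ((h + s)\<^sup>2 - a\<^sup>2) / 2) =
      ln (2 * cosh a) + spin_variance a * (h\<^sup>2 - a\<^sup>2) / 2 + spin_variance a * h * s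
        + spin_variance a * s\<^sup>2 / 2"
    by (simp add: ln_mult cosh_real_pos power2_eq_square field_simps)
  finally show "exp (h + s) + exp (- (h + s)) \<le> exp \<dots>" .
qed

lemma spin_bound_exact: "spin_bound h (ln (2 * cosh h)) (tanh h) (spin_variance h)"
  using spin_bound_tangent[of h h] by (simp add: spin_variance_mult)

section \<open>Gaussian integrals and a spin with quadratic self-interaction\<close>

lemma gaussian_mgf:
  "has_bochner_integral lborel (\<lambda>g. std_normal_density g * exp (c * g)) (exp (c\<^sup>2 / 2))"
proof -
  have "has_bochner_integral lborel (\<lambda>g. exp (c\<^sup>2 / 2) * normal_density c 1 g) (exp (c\<^sup>2 / 2) * 1)"
    using integrable_normal_density[of 1 c] integral_normal_density[of 1 c]
    by (intro has_bochner_integral_mult_right) (auto simp: has_bochner_integral_iff)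
  moreover have "exp (c\<^sup>2 / 2) * normal_density c 1 g = std_normal_density g * exp (c * g)" for g
    by (simp add: normal_density_def exp_add[symmetric] power2_eq_square field_simps)
  ultimately show ?thesis by simp
qed

lemma gaussian_exp_square:
  assumes "0 < d" "\<beta>\<^sup>2 = 1 - d"
  shows "has_bochner_integral lborel (\<lambda>g. std_normal_density g * exp ((s + \<beta> * g)\<^sup>2 / 2))
    (exp (s\<^sup>2 / (2 * d)) / sqrt d)"
proof -
  let ?c = "exp (s\<^sup>2 / (2 * d)) / sqrt d"
  \<comment> \<open>Completing the square in g gives a normal density with mean s * \<beta> / d and
    variance 1 / d.\<close>
  have "has_bochner_integral lborel (\<lambda>g. ?c * normal_density (s * \<beta> / d) (1 / sqrt d) g) (?c * 1)"
    using integrable_normal_density[of "1 / sqrt d" "s * \<beta> / d"]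
      integral_normal_density[of "1 / sqrt d" "s * \<beta> / d"] assms
    by (intro has_bochner_integral_mult_right) (auto simp: has_bochner_integral_iff)
  moreover have "?c * normal_density (s * \<beta> / d) (1 / sqrt d) g
      = std_normal_density g * exp ((s + \<beta> * g)\<^sup>2 / 2)" for g
  proof -
    have "s\<^sup>2 / (2 * d) - d * (g - s * \<beta> / d)\<^sup>2 / 2 = (s + \<beta> * g)\<^sup>2 / 2 - g\<^sup>2 / 2"
    proof -
      have "d * (g - s * \<beta> / d)\<^sup>2 = d * g\<^sup>2 - 2 * s * \<beta> * g + s\<^sup>2 * \<beta>\<^sup>2 / d"
        using assms by (simp add: power2_eq_square field_simps)
      also have "s\<^sup>2 * \<beta>\<^sup>2 / d = s\<^sup>2 / d - s\<^sup>2"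
        unfolding assms(2) using assms(1) by (simp add: field_simps)
      finally have 1: "d * (g - s * \<beta> / d)\<^sup>2 = d * g\<^sup>2 - 2 * s * \<beta> * g + (s\<^sup>2 / d - s\<^sup>2)" .
      have 2: "(s + \<beta> * g)\<^sup>2 = s\<^sup>2 + 2 * s * \<beta> * g + (1 - d) * g\<^sup>2"
        unfolding assms(2)[symmetric] by (simp add: power2_eq_square algebra_simps)
      show ?thesis unfolding 1 2 using assms(1) by (simp add: field_simps)
    qed
    then have "exp (s\<^sup>2 / (2 * d)) * exp (- (d * (g - s * \<beta> / d)\<^sup>2 / 2))
        = exp (- (g\<^sup>2 / 2)) * exp ((s + \<beta> * g)\<^sup>2 / 2)"
      by (simp add: exp_add[symmetric])
    moreover have "sqrt (2 * pi * (1 / sqrt d)\<^sup>2) = sqrt (2 * pi) / sqrt d"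
      using assms by (simp add: power_divide real_sqrt_divide)
    moreover have "(g - s * \<beta> / d)\<^sup>2 / (2 * (1 / sqrt d)\<^sup>2) = d * (g - s * \<beta> / d)\<^sup>2 / 2"
      using assms by (simp add: power_divide)
    ultimately show ?thesis
      using assms by (simp add: normal_density_def field_simps)
  qed
  ultimately show ?thesis by simp
qed

lemma has_bochner_integral_real_mono:
  fixes f g :: "'a \<Rightarrow> real"
  assumes "has_bochner_integral M f x" "has_bochner_integral M g y" "\<And>z. f z \<le> g z"
  shows "x \<le> y"
  using assms integral_mono[of M f g] by (auto simp: has_bochner_integral_iff)

text \<open>The factor exp ((1 - d) / 2 * x^2) is a Gaussian average of exp (\<beta> * g * x) with
  \<beta>^2 = 1 - d. Under the average only linear exponents remain, where the spin bound applies,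
  and the integral left over is the one of a standard Gaussian in place of the standardized spin
  x.\<close>

lemma spin_bound_quadratic:
  assumes sb: "spin_bound h c \<mu> K" and K: "K > 0" and d: "0 < d" "d \<le> 1"
  shows "(\<Sum>a\<in>{-1, 1}. exp (h * a + (1 - d) / 2 * ((a - \<mu>) / sqrt K)\<^sup>2 + s * ((a - \<mu>) / sqrt K)))
    \<le> exp (c + 1 / 2 * (1 / d - 1) + s\<^sup>2 / (2 * d))"
proof -
  define \<beta> where "\<beta> = sqrt (1 - d)"
  have \<beta>: "\<beta>\<^sup>2 = 1 - d" using d by (simp add: \<beta>_def)
  define x where "x = (\<lambda>a. (a - \<mu>) / sqrt K)"
  have lin: "(\<Sum>a\<in>{-1, 1}. exp (h * a + r * x a)) \<le> exp (c + r\<^sup>2 / 2)" for r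
  proof -
    have "(\<Sum>a\<in>{-1, 1}. exp (h * a + r * x a)) =
        exp (- (r * \<mu> / sqrt K)) * (exp (h + r / sqrt K) + exp (- (h + r / sqrt K)))"
      unfolding x_def distrib_left exp_add[symmetric]
      by (simp add: diff_divide_distrib algebra_simps)
    also have "\<dots> \<le> exp (- (r * \<mu> / sqrt K)) * exp (c + \<mu> * (r / sqrt K) + K * (r / sqrt K)\<^sup>2 / 2)"
      using sb[unfolded spin_bound_def, rule_format, of "r / sqrt K"]
      by (intro mult_left_mono) auto
    also have "\<dots> = exp (c + r\<^sup>2 / 2)"
      using K by (simp add: exp_add[symmetric] power_divide)
    finally show ?thesis .
  qed
  have 1: "has_bochner_integral lborel
      (\<lambda>g. \<Sum>a\<in>{-1, 1}. exp (h * a + s * x a) * (std_normal_density g * exp ((\<beta> * x a) * g)))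
      (\<Sum>a\<in>{-1, 1}. exp (h * a + s * x a) * exp ((\<beta> * x a)\<^sup>2 / 2))"
    by (intro has_bochner_integral_sum has_bochner_integral_mult_right gaussian_mgf)
  have 2: "has_bochner_integral lborel
      (\<lambda>g. exp c * (std_normal_density g * exp ((s + \<beta> * g)\<^sup>2 / 2)))
      (exp c * (exp (s\<^sup>2 / (2 * d)) / sqrt d))"
    by (intro has_bochner_integral_mult_right gaussian_exp_square d \<beta>)
  have "(\<Sum>a\<in>{-1, 1}. exp (h * a + (1 - d) / 2 * (x a)\<^sup>2 + s * x a))
      = (\<Sum>a\<in>{-1, 1}. exp (h * a + s * x a) * exp ((\<beta> * x a)\<^sup>2 / 2))"
    by (simp only: power_mult_distrib \<beta> exp_add[symmetric] times_divide_eq_left add_ac)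
  also have "\<dots> \<le> exp c * (exp (s\<^sup>2 / (2 * d)) / sqrt d)"
  proof (rule has_bochner_integral_real_mono[OF 1 2])
    fix g
    have "(\<Sum>a\<in>{-1, 1}. exp (h * a + s * x a) * (std_normal_density g * exp ((\<beta> * x a) * g)))
        = std_normal_density g * (\<Sum>a\<in>{-1, 1}. exp (h * a + (s + \<beta> * g) * x a))"
      by (simp add: exp_add algebra_simps)
    also have "\<dots> \<le> std_normal_density g * exp (c + (s + \<beta> * g)\<^sup>2 / 2)"
      by (intro mult_left_mono lin) simp
    finally show "(\<Sum>a\<in>{-1, 1}. exp (h * a + s * x a) * (std_normal_density g * exp ((\<beta> * x a) * g)))
        \<le> exp c * (std_normal_density g * exp ((s + \<beta> * g)\<^sup>2 / 2))"
      by (simp add: exp_add mult_ac)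
  qed
  \<comment> \<open>The determinant factor 1 / sqrt d is weakened so that the pivots of successive
    eliminations can be summed and compared with the trace of the inverse matrix.\<close>
  also have "\<dots> \<le> exp c * (exp (s\<^sup>2 / (2 * d)) * exp (1 / 2 * (1 / d - 1)))"
  proof -
    have "ln (1 / sqrt d) = ln (1 / d) / 2" using d by (simp add: ln_div ln_sqrt)
    also have "\<dots> \<le> 1 / 2 * (1 / d - 1)" using ln_le_minus_one[of "1 / d"] d by simp
    finally have "1 / sqrt d \<le> exp (1 / 2 * (1 / d - 1))"
      using d by (metis exp_le_cancel_iff exp_ln real_sqrt_gt_0_iff zero_less_divide_1_iff)
    then show ?thesis
      using mult_left_mono[of "1 / sqrt d" "exp (1 / 2 * (1 / d - 1))" "exp c * exp (s\<^sup>2 / (2 * d))"]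
      by (simp add: mult.assoc)
  qed
  also have "\<dots> = exp (c + 1 / 2 * (1 / d - 1) + s\<^sup>2 / (2 * d))"
    by (simp add: exp_add)
  finally show ?thesis unfolding x_def .
qed

section \<open>Summing out spins one at a time\<close>

lemma sum_spin_configs_Suc:
  "(\<Sum>\<sigma>\<in>spin_configs (Suc N). f \<sigma>) = (\<Sum>\<tau>\<in>spin_configs N. \<Sum>a\<in>{-1, 1}. f (vCons a \<tau>))"
proof -
  have inj: "inj_on (\<lambda>(a, \<sigma>). vCons a \<sigma>) ({-1, 1} \<times> spin_configs N)"
    by (auto simp: inj_on_def)
  have "(\<Sum>\<sigma>\<in>spin_configs (Suc N). f \<sigma>) = (\<Sum>a\<in>{-1, 1}. \<Sum>\<tau>\<in>spin_configs N. f (vCons a \<tau>))"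
    unfolding spin_configs_Suc sum.reindex[OF inj] by (simp add: sum.cartesian_product' o_def split_def)
  then show ?thesis by (subst sum.swap)
qed

text \<open>Vectors and matrices are functions restricted to the indices below n. Deleting the first
  coordinate is then a shift by \<open>Suc\<close>, which matches the recursion of
  \<open>spin_configs\<close> through \<open>vCons\<close>.\<close>

definition sq_norm :: "nat \<Rightarrow> (nat \<Rightarrow> real) \<Rightarrow> real" where
  "sq_norm n x = (\<Sum>i<n. (x i)\<^sup>2)"

definition mat_app :: "nat \<Rightarrow> (nat \<Rightarrow> nat \<Rightarrow> real) \<Rightarrow> (nat \<Rightarrow> real) \<Rightarrow> nat \<Rightarrow> real" where
  "mat_app n M x i = (\<Sum>j<n. M i j * x j)"

definition quad_form :: "nat \<Rightarrow> (nat \<Rightarrow> nat \<Rightarrow> real) \<Rightarrow> (nat \<Rightarrow> real) \<Rightarrow> real" where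
  "quad_form n M x = (\<Sum>i<n. x i * mat_app n M x i)"

lemma mat_app_Suc:
  "mat_app (Suc n) M x i = M i 0 * x 0 + mat_app n (\<lambda>i j. M i (Suc j)) (\<lambda>j. x (Suc j)) i"
  by (simp add: mat_app_def sum.lessThan_Suc_shift del: sum.lessThan_Suc)

lemma sq_norm_Suc: "sq_norm (Suc n) x = (x 0)\<^sup>2 + sq_norm n (\<lambda>i. x (Suc i))"
  by (simp add: sq_norm_def sum.lessThan_Suc_shift del: sum.lessThan_Suc)

lemma quad_form_Suc:
  assumes "\<And>i. i < n \<Longrightarrow> M (Suc i) 0 = M 0 (Suc i)"
  shows "quad_form (Suc n) M x = M 0 0 * (x 0)\<^sup>2 + 2 * x 0 * (\<Sum>j<n. M 0 (Suc j) * x (Suc j))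
    + quad_form n (\<lambda>i j. M (Suc i) (Suc j)) (\<lambda>i. x (Suc i))"
proof -
  have "(\<Sum>i<n. x (Suc i) * (M (Suc i) 0 * x 0)) = x 0 * (\<Sum>j<n. M 0 (Suc j) * x (Suc j))"
    unfolding sum_distrib_left using assms by (intro sum.cong) auto
  moreover have "quad_form (Suc n) M x = x 0 * (M 0 0 * x 0 + (\<Sum>j<n. M 0 (Suc j) * x (Suc j)))
    + ((\<Sum>i<n. x (Suc i) * (M (Suc i) 0 * x 0)) + quad_form n (\<lambda>i j. M (Suc i) (Suc j)) (\<lambda>i. x (Suc i)))"
    unfolding quad_form_def
    by (simp add: sum.lessThan_Suc_shift mat_app_Suc distrib_left sum.distrib del: sum.lessThan_Suc)
       (simp add: mat_app_def)
  ultimately show ?thesis by (simp add: power2_eq_square algebra_simps)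
qed

lemma mat_app_rank_one:
  "mat_app n (\<lambda>i j. M i j - v i * v j / d) x i = mat_app n M x i - v i * (\<Sum>j<n. v j * x j) / d"
  by (simp add: mat_app_def algebra_simps sum_subtractf sum_distrib_left sum_divide_distrib)

lemma quad_form_rank_one:
  "quad_form n (\<lambda>i j. M i j - v i * v j / d) x = quad_form n M x - (\<Sum>j<n. v j * x j)\<^sup>2 / d"
proof -
  have "(\<Sum>i<n. x i * (v i * (\<Sum>j<n. v j * x j) / d)) = (\<Sum>i<n. (v i * x i)) * ((\<Sum>j<n. v j * x j) / d)"
    unfolding sum_distrib_right by (intro sum.cong) auto
  then show ?thesis
    by (simp add: quad_form_def mat_app_rank_one right_diff_distrib sum_subtractf power2_eq_square)
qed

text \<open>One spin is summed out at a time, with \<open>S\<close> replaced by its Schur complement; the inverse of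
  the Schur complement is the corresponding block of \<open>T = S\<^sup>-\<^sup>1\<close>.\<close>
lemma spin_elimination:
  fixes S T :: "nat \<Rightarrow> nat \<Rightarrow> real"
  assumes sb: "spin_bound h c \<mu> K" and K: "K > 0"
  defines "y \<equiv> \<lambda>\<sigma> i. (\<sigma> $ i - \<mu>) / sqrt K"
  assumes sym: "\<And>i j. i < N \<Longrightarrow> j < N \<Longrightarrow> S i j = S j i"
    and pd: "\<And>x i. i < N \<Longrightarrow> x i \<noteq> 0 \<Longrightarrow> quad_form N S x > 0"
    and diag: "\<And>i. i < N \<Longrightarrow> S i i \<le> 1"
    and inv: "\<And>i j. i < N \<Longrightarrow> j < N \<Longrightarrow> mat_app N S (\<lambda>k. T k j) i = (if i = j then 1 else 0)"
    and sol: "\<And>i. i < N \<Longrightarrow> mat_app N S w i = b i"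
  shows "(\<Sum>\<sigma>\<in>spin_configs N. exp (h * spin_sum \<sigma> + 1 / 2 * sq_norm N (y \<sigma>)
      - 1 / 2 * quad_form N S (y \<sigma>) + (\<Sum>i<N. b i * y \<sigma> i)))
    \<le> exp (real N * c + 1 / 2 * (\<Sum>i<N. T i i - 1) + 1 / 2 * (\<Sum>i<N. b i * w i))"
  using sym pd diag inv sol
proof (induction N arbitrary: S T w b)
  case 0
  then show ?case
    by (simp add: spin_configs_0 sq_norm_def quad_form_def spin_sum_def)
next
  case (Suc N)
  \<comment> \<open>Block elimination of index 0: d is the pivot, v the rest of the first row,
    \<open>S'\<close> the Schur complement, and \<open>b'\<close> the linear term left after the
    first equation has been used.\<close>
  define d where "d = S 0 0"
  define v where "v = (\<lambda>i. S 0 (Suc i))"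
  define S' where "S' = (\<lambda>i j. S (Suc i) (Suc j) - v i * v j / d)"
  define T' where "T' = (\<lambda>i j. T (Suc i) (Suc j))"
  define w' where "w' = (\<lambda>i. w (Suc i))"
  define b' where "b' = (\<lambda>i. b (Suc i) - v i * b 0 / d)"
  have sym0: "S (Suc i) 0 = S 0 (Suc i)" if "i < N" for i
    using Suc.prems(1) that by simp
  have q_Suc: "quad_form (Suc N) S x = d * (x 0)\<^sup>2 + 2 * x 0 * (\<Sum>j<N. v j * x (Suc j))
      + quad_form N (\<lambda>i j. S (Suc i) (Suc j)) (\<lambda>i. x (Suc i))" for x
    unfolding d_def v_def using sym0 by (rule quad_form_Suc)
  have q_S': "quad_form N S' x = quad_form N (\<lambda>i j. S (Suc i) (Suc j)) x - (\<Sum>j<N. v j * x j)\<^sup>2 / d" for x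
    unfolding S'_def by (rule quad_form_rank_one)
  have a_S': "mat_app N S' x i = mat_app N (\<lambda>i j. S (Suc i) (Suc j)) x i - v i * (\<Sum>j<N. v j * x j) / d" for x i
    unfolding S'_def by (rule mat_app_rank_one)
  have a0: "mat_app (Suc N) S x 0 = d * x 0 + (\<Sum>j<N. v j * x (Suc j))" for x
    by (simp add: mat_app_Suc d_def v_def) (simp add: mat_app_def)
  have aS: "mat_app (Suc N) S x (Suc i) = v i * x 0 + mat_app N (\<lambda>i j. S (Suc i) (Suc j)) (\<lambda>i. x (Suc i)) i"
    if "i < N" for x i
    using sym0[OF that] by (simp add: mat_app_Suc v_def) (simp add: mat_app_def)
  have d: "0 < d" "d \<le> 1"
    using Suc.prems(2)[of 0 "\<lambda>i. if i = 0 then 1 else 0"] Suc.prems(3)[of 0]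
    unfolding q_Suc by (simp_all add: d_def quad_form_def)
  have IH: "(\<Sum>\<sigma>\<in>spin_configs N. exp (h * spin_sum \<sigma> + 1 / 2 * sq_norm N (y \<sigma>)
      - 1 / 2 * quad_form N S' (y \<sigma>) + (\<Sum>i<N. b' i * y \<sigma> i)))
    \<le> exp (real N * c + 1 / 2 * (\<Sum>i<N. T' i i - 1) + 1 / 2 * (\<Sum>i<N. b' i * w' i))"
  proof (rule Suc.IH[where S = S' and T = T' and w = w' and b = b'])
    show "S' i j = S' j i" if "i < N" "j < N" for i j
      using that Suc.prems(1) by (simp add: S'_def)
    show "S' i i \<le> 1" if "i < N" for i
    proof -
      have "0 \<le> v i * v i / d" using d by simp
      then show ?thesis using Suc.prems(3)[of "Suc i"] that by (simp add: S'_def)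
    qed
    show "quad_form N S' x > 0" if "i < N" "x i \<noteq> 0" for x i
    proof -
      \<comment> \<open>This first coordinate minimizes the form of \<open>S\<close> with the others
        fixed; the minimum is the form of the Schur complement.\<close>
      define x0 where "x0 = - (\<Sum>j<N. v j * x j) / d"
      have "0 < quad_form (Suc N) S (case_nat x0 x)"
        using Suc.prems(2)[of "Suc i" "case_nat x0 x"] that by simp
      also have "\<dots> = quad_form N S' x"
        unfolding q_Suc q_S' using d by (simp add: x0_def power2_eq_square field_simps)
      finally show ?thesis .
    qed
    show "mat_app N S' w' i = b' i" if "i < N" for i
    proof -
      have "v i * (d * w 0 + (\<Sum>j<N. v j * w' j)) / d = v i * b 0 / d"
        using Suc.prems(5)[of 0] a0[of w] by (simp add: w'_def)
      then have "v i * w 0 + v i * (\<Sum>j<N. v j * w' j) / d = v i * b 0 / d"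
        using d by (simp add: field_simps)
      then show ?thesis
        using Suc.prems(5)[of "Suc i"] aS[of i w] that
        unfolding a_S' b'_def by (simp add: w'_def)
    qed
    show "mat_app N S' (\<lambda>k. T' k j) i = (if i = j then 1 else 0)" if "i < N" "j < N" for i j
    proof -
      have "v i * (d * T 0 (Suc j) + (\<Sum>k<N. v k * T' k j)) / d = 0"
        using Suc.prems(4)[of 0 "Suc j"] a0[of "\<lambda>k. T k (Suc j)"] that by (simp add: T'_def)
      then have "v i * T 0 (Suc j) + v i * (\<Sum>k<N. v k * T' k j) / d = 0"
        using d by (simp add: field_simps)
      then show ?thesis
        using Suc.prems(4)[of "Suc i" "Suc j"] aS[of i "\<lambda>k. T k (Suc j)"] that
        unfolding a_S' by (simp add: T'_def)
    qed
  qed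
  \<comment> \<open>A diagonal entry of the inverse is at least the inverse of the diagonal entry.
    With z the first column of \<open>T\<close>, the form of \<open>S\<close> at z minus 1/d times
    the first unit vector is exactly z 0 - 1/d, and it is nonnegative.\<close>
  have T00: "1 / d \<le> T 0 0"
  proof -
    define z where "z = (\<lambda>k. T k 0)"
    define x where "x = (\<lambda>k. z k - (if k = 0 then 1 / d else 0))"
    have z: "mat_app (Suc N) S z k = (if k = 0 then 1 else 0)" if "k < Suc N" for k
      using Suc.prems(4)[of k 0] that by (simp add: z_def)
    have "mat_app (Suc N) S x k = mat_app (Suc N) S z k - S k 0 / d" for k
      by (simp add: mat_app_Suc x_def field_simps)
    then have "quad_form (Suc N) S x = (\<Sum>k<Suc N. x k * ((if k = 0 then 1 else 0) - S k 0 / d))"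
      unfolding quad_form_def using z by (intro sum.cong) auto
    also have "\<dots> = x 0 * (1 - 1) - (\<Sum>k<N. x (Suc k) * (S (Suc k) 0 / d))"
      using d by (simp add: sum.lessThan_Suc_shift d_def sum_negf del: sum.lessThan_Suc)
    also have "(\<Sum>k<N. x (Suc k) * (S (Suc k) 0 / d)) = (\<Sum>k<N. v k * z (Suc k)) / d"
      unfolding sum_divide_distrib using sym0 by (intro sum.cong) (auto simp: x_def v_def)
    also have "(\<Sum>k<N. v k * z (Suc k)) = 1 - d * z 0"
      using z[of 0] a0[of z] by simp
    finally have q: "quad_form (Suc N) S x = z 0 - 1 / d"
      using d by (simp add: field_simps)
    have "quad_form (Suc N) S x \<ge> 0"
      using Suc.prems(2)[of _ x]
      by (cases "\<exists>i<Suc N. x i \<noteq> 0") (auto simp: quad_form_def less_imp_le intro: order.strict_implies_order)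
    then show ?thesis using q by (simp add: z_def)
  qed
  have inner: "(\<Sum>a\<in>{-1, 1}. exp (h * spin_sum (vCons a \<tau>) + 1 / 2 * sq_norm (Suc N) (y (vCons a \<tau>))
      - 1 / 2 * quad_form (Suc N) S (y (vCons a \<tau>)) + (\<Sum>i<Suc N. b i * y (vCons a \<tau>) i)))
    \<le> exp (c + 1 / 2 * (1 / d - 1) + (b 0)\<^sup>2 / (2 * d)) *
      exp (h * spin_sum \<tau> + 1 / 2 * sq_norm N (y \<tau>)
      - 1 / 2 * quad_form N S' (y \<tau>) + (\<Sum>i<N. b' i * y \<tau> i))" for \<tau>
  proof -
    \<comment> \<open>The first spin interacts with the others only through V and sees the linear
      field b 0 - V. Expanding (b 0 - V)^2 / (2 * d) produces the constant, the correction in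
      \<open>b'\<close> and the rank-one term of \<open>S'\<close>.\<close>
    define V where "V = (\<Sum>j<N. v j * y \<tau> j)"
    define r where "r = h * spin_sum \<tau> + 1 / 2 * sq_norm N (y \<tau>)
      - 1 / 2 * quad_form N (\<lambda>i j. S (Suc i) (Suc j)) (y \<tau>) + (\<Sum>i<N. b (Suc i) * y \<tau> i)"
    have yS: "y (vCons a \<tau>) (Suc i) = y \<tau> i" for a i by (simp add: y_def)
    have y0: "y (vCons a \<tau>) 0 = (a - \<mu>) / sqrt K" for a by (simp add: y_def)
    have b'V: "(\<Sum>i<N. b' i * y \<tau> i) = (\<Sum>i<N. b (Suc i) * y \<tau> i) - b 0 / d * V"
      by (simp add: b'_def V_def left_diff_distrib sum_subtractf sum_distrib_left algebra_simps)
    have "(\<Sum>a\<in>{-1, 1}. exp (h * spin_sum (vCons a \<tau>) + 1 / 2 * sq_norm (Suc N) (y (vCons a \<tau>))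
        - 1 / 2 * quad_form (Suc N) S (y (vCons a \<tau>)) + (\<Sum>i<Suc N. b i * y (vCons a \<tau>) i)))
      = (\<Sum>a\<in>{-1, 1}. exp (h * a + (1 - d) / 2 * ((a - \<mu>) / sqrt K)\<^sup>2 + (b 0 - V) * ((a - \<mu>) / sqrt K)) * exp r)"
      unfolding exp_add[symmetric] q_Suc sq_norm_Suc spin_sum_vCons yS y0 sum.lessThan_Suc_shift V_def[symmetric] r_def
      by (intro sum.cong refl arg_cong[where f = exp]) (simp add: algebra_simps diff_divide_distrib)
    also have "\<dots> \<le> exp (c + 1 / 2 * (1 / d - 1) + (b 0 - V)\<^sup>2 / (2 * d)) * exp r"
      unfolding sum_distrib_right[symmetric]
      by (intro mult_right_mono spin_bound_quadratic[OF sb K d]) simp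
    also have "\<dots> = exp (c + 1 / 2 * (1 / d - 1) + (b 0)\<^sup>2 / (2 * d)) *
      exp (h * spin_sum \<tau> + 1 / 2 * sq_norm N (y \<tau>)
      - 1 / 2 * quad_form N S' (y \<tau>) + (\<Sum>i<N. b' i * y \<tau> i))"
      unfolding exp_add[symmetric] q_S' b'V V_def[symmetric] r_def
      using d by (intro arg_cong[where f = exp]) (simp add: power2_eq_square field_simps)
    finally show ?thesis .
  qed
  have bw: "(\<Sum>i<N. b' i * w' i) + (b 0)\<^sup>2 / d = (\<Sum>i<Suc N. b i * w i)"
  proof -
    have "(\<Sum>i<N. b' i * w' i) = (\<Sum>i<N. b (Suc i) * w (Suc i)) - b 0 / d * (\<Sum>i<N. v i * w (Suc i))"
      by (simp add: b'_def w'_def left_diff_distrib sum_subtractf sum_distrib_left algebra_simps)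
    also have "(\<Sum>i<N. v i * w (Suc i)) = b 0 - d * w 0"
      using Suc.prems(5)[of 0] a0[of w] by simp
    finally show ?thesis
      using d by (simp add: sum.lessThan_Suc_shift power2_eq_square field_simps del: sum.lessThan_Suc)
  qed
  have TT: "(1 / d - 1) + (\<Sum>i<N. T' i i - 1) \<le> (\<Sum>i<Suc N. T i i - 1)"
    using T00 by (simp add: sum.lessThan_Suc_shift T'_def del: sum.lessThan_Suc)
  have "(\<Sum>\<sigma>\<in>spin_configs (Suc N). exp (h * spin_sum \<sigma> + 1 / 2 * sq_norm (Suc N) (y \<sigma>)
      - 1 / 2 * quad_form (Suc N) S (y \<sigma>) + (\<Sum>i<Suc N. b i * y \<sigma> i)))
    \<le> exp (c + 1 / 2 * (1 / d - 1) + (b 0)\<^sup>2 / (2 * d)) *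
      exp (real N * c + 1 / 2 * (\<Sum>i<N. T' i i - 1) + 1 / 2 * (\<Sum>i<N. b' i * w' i))"
    unfolding sum_spin_configs_Suc
    by (rule order_trans[OF sum_mono[OF inner]])
       (unfold sum_distrib_left[symmetric], intro mult_left_mono IH, simp)
  also have "\<dots> \<le> exp (real (Suc N) * c + 1 / 2 * (\<Sum>i<Suc N. T i i - 1) + 1 / 2 * (\<Sum>i<Suc N. b i * w i))"
    unfolding exp_add[symmetric] bw[symmetric] exp_le_cancel_iff
    using TT by (simp add: algebra_simps diff_divide_distrib del: sum.lessThan_Suc)
  finally show ?case .
qed

lemma sum_mult_delta:
  fixes f :: "nat \<Rightarrow> real"
  assumes "i < n"
  shows "(\<Sum>j<n. f j * (if j = i then 1 else 0)) = f i"
  using assms by (simp add: if_distrib[where f = "(*) _"] cong: if_cong)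

lemma quad_form_eq_0:
  assumes "\<And>i. i < n \<Longrightarrow> mat_app n M x i = 0"
  shows "quad_form n M x = 0"
  using assms by (simp add: quad_form_def)

lemma sq_norm_nonneg: "sq_norm n x \<ge> 0"
  by (simp add: sq_norm_def sum_nonneg)

lemma sq_norm_pos: "i < n \<Longrightarrow> x i \<noteq> 0 \<Longrightarrow> sq_norm n x > 0"
  unfolding sq_norm_def by (rule sum_pos2[of _ i]) auto

lemma mat_right_inverse_exists:
  assumes pd: "\<And>x i. i < n \<Longrightarrow> x i \<noteq> 0 \<Longrightarrow> quad_form n S x > 0"
  obtains T where "\<And>i j. i < n \<Longrightarrow> j < n \<Longrightarrow> mat_app n S (\<lambda>k. T k j) i = (if i = j then 1 else 0)"
proof -
  define A where "A = mat n n (\<lambda>(i, j). S i j)"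
  have A: "A \<in> carrier_mat n n" by (simp add: A_def)
  have "det A \<noteq> 0"
  proof
    assume "det A = 0"
    then obtain v where v: "v \<in> carrier_vec n" "v \<noteq> 0\<^sub>v n" "A *\<^sub>v v = 0\<^sub>v n"
      using det_0_iff_vec_prod_zero[OF A] by blast
    from v obtain i where i: "i < n" "v $ i \<noteq> 0"
      by (metis carrier_vecD eq_vecI index_zero_vec)
    have "mat_app n S (\<lambda>i. v $ i) j = 0" if "j < n" for j
    proof -
      have "(A *\<^sub>v v) $ j = 0" using v that by simp
      then show ?thesis
        using that v(1) by (simp add: A_def scalar_prod_def mat_app_def lessThan_atLeast0)
    qed
    then have "quad_form n S (\<lambda>i. v $ i) = 0" by (rule quad_form_eq_0)
    with pd[OF i(1), of "\<lambda>i. v $ i"] i show False by simp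
  qed
  from det_non_zero_imp_unit[OF A this, where b = undefined]
  obtain B where B: "B \<in> carrier_mat n n" "A * B = 1\<^sub>m n"
    unfolding Units_def by (auto simp: ring_mat_def)
  show ?thesis
  proof (rule that[of "\<lambda>i j. B $$ (i, j)"])
    fix i j assume ij: "i < n" "j < n"
    have "(A * B) $$ (i, j) = (if i = j then 1 else 0)" using B ij by simp
    then show "mat_app n S (\<lambda>k. B $$ (k, j)) i = (if i = j then 1 else 0)"
      using ij A B(1) by (simp add: A_def scalar_prod_def mat_app_def lessThan_atLeast0)
  qed
qed

text \<open>The inverse of a form bounded below by \<delta> is bounded above by 1 / \<delta>. With r
  the left side, r = w . S w is at least \<delta> times the squared norm of w, while Cauchy--Schwarz
  bounds r^2 by the product of the squared norms of z and w.\<close>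

lemma dot_solution_le:
  assumes lower: "quad_form n S w \<ge> \<delta> * sq_norm n w" and \<delta>: "\<delta> > 0"
    and sol: "\<And>i. i < n \<Longrightarrow> mat_app n S w i = z i"
  shows "(\<Sum>i<n. z i * w i) \<le> sq_norm n z / \<delta>"
proof -
  define r where "r = (\<Sum>i<n. z i * w i)"
  have "quad_form n S w = r"
    unfolding quad_form_def r_def using sol by (intro sum.cong) auto
  with lower have 1: "\<delta> * sq_norm n w \<le> r" by simp
  have "\<delta> * r\<^sup>2 \<le> \<delta> * (sq_norm n z * sq_norm n w)"
    unfolding r_def sq_norm_def using \<delta> by (intro mult_left_mono Cauchy_Schwarz_ineq_sum) auto
  also have "\<dots> \<le> sq_norm n z * r"
    using mult_left_mono[OF 1 sq_norm_nonneg[of n z]] by (simp add: mult_ac)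
  finally have 2: "r * (\<delta> * r) \<le> r * sq_norm n z" by (simp add: power2_eq_square mult_ac)
  have "r \<ge> 0" using 1 sq_norm_nonneg[of n w] \<delta> by (meson mult_nonneg_nonneg less_imp_le order_trans)
  with 2 have "\<delta> * r \<le> sq_norm n z"
    using sq_norm_nonneg[of n z] \<delta> by (cases "r = 0") auto
  then show ?thesis using \<delta> by (simp add: r_def field_simps)
qed

text \<open>The substitution \<sigma> i = \<mu> + sqrt K * y i splits the exponent into the
  mean-field energy, a linear field b and a form with matrix S = 1 - K * M, to which
  \<open>spin_elimination\<close> applies. Hypothesis \<open>upper\<close> bounds the inverse of S
  by 1 / \<delta>. The offset l separates the field at which the spin bound is taken from the linear
  term of the Hamiltonian, so that it can be chosen to cancel the mean part of \<mu> times the row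
  sums.\<close>

theorem gaussian_comparison:
  fixes M :: "nat \<Rightarrow> nat \<Rightarrow> real"
  assumes sb: "spin_bound h c \<mu> K" and K: "K > 0" and \<delta>: "\<delta> > 0"
    and sym: "\<And>i j. i < N \<Longrightarrow> j < N \<Longrightarrow> M i j = M j i"
    and diag: "\<And>i. i < N \<Longrightarrow> M i i = 0"
    and upper: "\<And>x. K * quad_form N M x \<le> (1 - \<delta>) * sq_norm N x"
  shows "(\<Sum>\<sigma>\<in>spin_configs N. exp ((h + l) * spin_sum \<sigma> + 1 / 2 * quad_form N M (($) \<sigma>)))
    \<le> exp (real N * c + \<mu>\<^sup>2 / 2 * (\<Sum>i<N. \<Sum>j<N. M i j) + l * \<mu> * real N
      + K\<^sup>2 / (2 * \<delta>) * (\<Sum>i<N. \<Sum>j<N. (M i j)\<^sup>2)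
      + K / (2 * \<delta>) * (\<Sum>i<N. (\<mu> * (\<Sum>j<N. M i j) + l)\<^sup>2))"
proof -
  define S where "S = (\<lambda>i j. (if i = j then 1 else 0) - K * M i j)"
  define y where "y = (\<lambda>\<sigma> i. (\<sigma> $ i - \<mu>) / sqrt K)"
  define b where "b = (\<lambda>i. sqrt K * (\<mu> * (\<Sum>j<N. M i j) + l))"
  have aS: "mat_app N S x i = x i - K * mat_app N M x i" if "i < N" for x i
  proof -
    have "(\<Sum>j<N. (if i = j then 1 else 0) * x j) = (\<Sum>j<N. if i = j then x j else 0)"
      by (intro sum.cong) auto
    then show ?thesis using that
      by (simp add: mat_app_def S_def left_diff_distrib sum_subtractf sum_distrib_left mult.assoc)
  qed
  have qS: "quad_form N S x = sq_norm N x - K * quad_form N M x" for x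
  proof -
    have "quad_form N S x = (\<Sum>i<N. x i * (x i - K * mat_app N M x i))"
      unfolding quad_form_def by (intro sum.cong) (auto simp: aS)
    then show ?thesis
      by (simp add: quad_form_def sq_norm_def right_diff_distrib sum_subtractf sum_distrib_left power2_eq_square mult_ac)
  qed
  have lower: "quad_form N S x \<ge> \<delta> * sq_norm N x" for x
    using upper[of x] by (simp add: qS algebra_simps)
  have pd: "quad_form N S x > 0" if "i < N" "x i \<noteq> 0" for x i
    using lower[of x] mult_pos_pos[OF \<delta> sq_norm_pos[of i N x]] that by simp
  obtain T where T: "mat_app N S (\<lambda>k. T k j) i = (if i = j then 1 else 0)" if "i < N" "j < N" for i j
    using mat_right_inverse_exists[of N S] pd by blast
  define w where "w = (\<lambda>i. \<Sum>j<N. T i j * b j)"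
  have w: "mat_app N S w i = b i" if "i < N" for i
  proof -
    have "mat_app N S w i = (\<Sum>j<N. mat_app N S (\<lambda>k. T k j) i * b j)"
      unfolding w_def mat_app_def sum_distrib_left sum_distrib_right
      by (subst sum.swap) (simp add: mult_ac)
    also have "\<dots> = (\<Sum>j<N. (if i = j then b j else 0))"
      using T that by (intro sum.cong) auto
    finally show ?thesis using that by simp
  qed
  have elim: "(\<Sum>\<sigma>\<in>spin_configs N. exp (h * spin_sum \<sigma> + 1 / 2 * sq_norm N (y \<sigma>)
      - 1 / 2 * quad_form N S (y \<sigma>) + (\<Sum>i<N. b i * y \<sigma> i)))
    \<le> exp (real N * c + 1 / 2 * (\<Sum>i<N. T i i - 1) + 1 / 2 * (\<Sum>i<N. b i * w i))"
    unfolding y_def using sym diag T w pd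
    by (intro spin_elimination[OF sb K]) (auto simp: S_def)
  have bw: "(\<Sum>i<N. b i * w i) \<le> K / \<delta> * (\<Sum>i<N. (\<mu> * (\<Sum>j<N. M i j) + l)\<^sup>2)"
  proof -
    have "(\<Sum>i<N. b i * w i) \<le> sq_norm N b / \<delta>"
      using lower \<delta> w by (rule dot_solution_le)
    also have "sq_norm N b = K * (\<Sum>i<N. (\<mu> * (\<Sum>j<N. M i j) + l)\<^sup>2)"
      using K by (simp add: sq_norm_def b_def power_mult_distrib sum_distrib_left)
    finally show ?thesis by simp
  qed
  \<comment> \<open>To first order the trace of the inverse minus the identity is K times the trace
    of M, which vanishes. Accordingly T i i - 1 equals z . u with z the i-th column of K * M and u
    the solution of S u = z, hence is quadratic in M.\<close>
  have trace: "(\<Sum>i<N. T i i - 1) \<le> K\<^sup>2 / \<delta> * (\<Sum>i<N. \<Sum>j<N. (M i j)\<^sup>2)"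
  proof -
    have "T i i - 1 \<le> K\<^sup>2 / \<delta> * (\<Sum>j<N. (M i j)\<^sup>2)" if i: "i < N" for i
    proof -
      define z where "z = (\<lambda>k. K * M k i)"
      define u where "u = (\<lambda>k. T k i - (if k = i then 1 else 0))"
      have "mat_app N S u k = z k" if k: "k < N" for k
      proof -
        have "mat_app N S u k = mat_app N S (\<lambda>k. T k i) k - S k i"
          unfolding mat_app_def u_def right_diff_distrib sum_subtractf sum_mult_delta[OF i] ..
        then show ?thesis using T[OF k i] i by (simp add: S_def z_def)
      qed
      then have "(\<Sum>k<N. z k * u k) \<le> sq_norm N z / \<delta>"
        by (intro dot_solution_le[OF lower \<delta>])
      moreover have "(\<Sum>k<N. z k * u k) = T i i - 1"
      proof -
        have "(\<Sum>k<N. z k * u k) = (\<Sum>k<N. K * (M i k * T k i)) - z i"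
          unfolding u_def right_diff_distrib sum_subtractf sum_mult_delta[OF i] using sym i
          by (auto intro!: sum.cong simp: z_def)
        also have "(\<Sum>k<N. K * (M i k * T k i)) = K * mat_app N M (\<lambda>k. T k i) i"
          by (simp add: mat_app_def sum_distrib_left)
        also have "\<dots> = T i i - 1"
          using T[OF i i] aS[OF i] by simp
        finally show ?thesis using i diag by (simp add: z_def)
      qed
      moreover have "sq_norm N z = K\<^sup>2 * (\<Sum>j<N. (M i j)\<^sup>2)"
        unfolding sq_norm_def z_def sum_distrib_left power_mult_distrib
        using sym i by (intro sum.cong) auto
      ultimately show ?thesis by simp
    qed
    then show ?thesis
      unfolding sum_distrib_left by (auto intro!: sum_mono simp: sum_distrib_left)
  qed
  have expand: "(h + l) * spin_sum \<sigma> + 1 / 2 * quad_form N M (($) \<sigma>) =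
      (h * spin_sum \<sigma> + 1 / 2 * sq_norm N (y \<sigma>)
      - 1 / 2 * quad_form N S (y \<sigma>) + (\<Sum>i<N. b i * y \<sigma> i))
      + (\<mu>\<^sup>2 / 2 * (\<Sum>i<N. \<Sum>j<N. M i j) + l * \<mu> * real N)"
    if \<sigma>: "\<sigma> \<in> spin_configs N" for \<sigma>
  proof -
    define R where "R = (\<lambda>i. \<Sum>j<N. M i j)"
    have s: "\<sigma> $ i = \<mu> + sqrt K * y \<sigma> i" for i
      using K by (simp add: y_def)
    have spin: "spin_sum \<sigma> = \<mu> * real N + sqrt K * (\<Sum>i<N. y \<sigma> i)"
    proof -
      have "spin_sum \<sigma> = (\<Sum>i<N. \<sigma> $ i)" using \<sigma> by (auto simp: spin_sum_def spin_configs_def)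
      then show ?thesis unfolding s by (simp add: sum.distrib sum_distrib_left)
    qed
    have app: "mat_app N M (($) \<sigma>) i = \<mu> * R i + sqrt K * mat_app N M (y \<sigma>) i" for i
      unfolding s by (simp add: mat_app_def R_def sum.distrib sum_distrib_left algebra_simps)
    have swap: "(\<Sum>i<N. mat_app N M (y \<sigma>) i) = (\<Sum>i<N. R i * y \<sigma> i)"
      unfolding mat_app_def R_def sum_distrib_right
      by (subst sum.swap) (auto intro!: sum.cong simp: sym)
    have "quad_form N M (($) \<sigma>)
        = (\<Sum>i<N. (\<mu> + sqrt K * y \<sigma> i) * (\<mu> * R i + sqrt K * mat_app N M (y \<sigma>) i))"
      unfolding quad_form_def app by (simp add: s)
    also have "\<dots> = (\<Sum>i<N. \<mu>\<^sup>2 * R i + \<mu> * sqrt K * (R i * y \<sigma> i)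
          + \<mu> * sqrt K * mat_app N M (y \<sigma>) i + K * (y \<sigma> i * mat_app N M (y \<sigma>) i))"
      using K by (intro sum.cong) (auto simp: power2_eq_square algebra_simps)
    also have "\<dots> = \<mu>\<^sup>2 * (\<Sum>i<N. R i) + 2 * \<mu> * sqrt K * (\<Sum>i<N. R i * y \<sigma> i) + K * quad_form N M (y \<sigma>)"
      by (simp add: sum.distrib swap quad_form_def flip: sum_distrib_left)
    finally have q: "quad_form N M (($) \<sigma>) = \<dots>" .
    have b: "(\<Sum>i<N. b i * y \<sigma> i) = \<mu> * sqrt K * (\<Sum>i<N. R i * y \<sigma> i) + l * sqrt K * (\<Sum>i<N. y \<sigma> i)"
    proof -
      have "b i = sqrt K * (\<mu> * R i + l)" for i by (simp add: b_def R_def)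
      then show ?thesis
        unfolding sum_distrib_left sum.distrib[symmetric]
        by (intro sum.cong) (auto simp: algebra_simps)
    qed
    show ?thesis
      unfolding q b qS R_def[symmetric] distrib_right by (simp add: spin algebra_simps)
  qed
  have "(\<Sum>\<sigma>\<in>spin_configs N. exp ((h + l) * spin_sum \<sigma> + 1 / 2 * quad_form N M (($) \<sigma>)))
    = (\<Sum>\<sigma>\<in>spin_configs N. exp (h * spin_sum \<sigma> + 1 / 2 * sq_norm N (y \<sigma>)
      - 1 / 2 * quad_form N S (y \<sigma>) + (\<Sum>i<N. b i * y \<sigma> i)))
      * exp (\<mu>\<^sup>2 / 2 * (\<Sum>i<N. \<Sum>j<N. M i j) + l * \<mu> * real N)"
    unfolding sum_distrib_right exp_add[symmetric] by (rule sum.cong[OF refl]) (simp only: expand)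
  also have "\<dots> \<le> exp (real N * c + 1 / 2 * (\<Sum>i<N. T i i - 1) + 1 / 2 * (\<Sum>i<N. b i * w i))
      * exp (\<mu>\<^sup>2 / 2 * (\<Sum>i<N. \<Sum>j<N. M i j) + l * \<mu> * real N)"
    by (intro mult_right_mono elim) simp
  also have "\<dots> \<le> exp (real N * c + \<mu>\<^sup>2 / 2 * (\<Sum>i<N. \<Sum>j<N. M i j) + l * \<mu> * real N
      + K\<^sup>2 / (2 * \<delta>) * (\<Sum>i<N. \<Sum>j<N. (M i j)\<^sup>2)
      + K / (2 * \<delta>) * (\<Sum>i<N. (\<mu> * (\<Sum>j<N. M i j) + l)\<^sup>2))"
  proof -
    have "1 / 2 * (\<Sum>i<N. T i i - 1) \<le> K\<^sup>2 / (2 * \<delta>) * (\<Sum>i<N. \<Sum>j<N. (M i j)\<^sup>2)"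
      using mult_left_mono[OF trace, of "1 / 2"] by simp
    moreover have "1 / 2 * (\<Sum>i<N. b i * w i) \<le> K / (2 * \<delta>) * (\<Sum>i<N. (\<mu> * (\<Sum>j<N. M i j) + l)\<^sup>2)"
      using mult_left_mono[OF bw, of "1 / 2"] by simp
    ultimately show ?thesis unfolding exp_add[symmetric] exp_le_cancel_iff by linarith
  qed
  finally show ?thesis .
qed

section \<open>Diagonalization of symmetric matrices\<close>

text \<open>The Hermitian form at an eigenvector equals z times a positive real, and it is its own
  conjugate because A is real and symmetric.\<close>

lemma symmetric_complex_eigenvalue_real:
  fixes A :: "real mat"
  assumes A: "A \<in> carrier_mat n n" and sym: "transpose_mat A = A"
    and ev: "eigenvalue (map_mat complex_of_real A) z"
  shows "z \<in> \<real>"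
proof -
  obtain x where x: "x \<in> carrier_vec n" "x \<noteq> 0\<^sub>v n" "map_mat complex_of_real A *\<^sub>v x = z \<cdot>\<^sub>v x"
    using ev A unfolding eigenvalue_def eigenvector_def by auto
  have symA: "A $$ (i, j) = A $$ (j, i)" if "i < n" "j < n" for i j
    using sym A that by (metis carrier_matD index_transpose_mat(1))
  have row: "(\<Sum>j<n. of_real (A $$ (i, j)) * x $ j) = z * x $ i" if "i < n" for i
  proof -
    have "(map_mat complex_of_real A *\<^sub>v x) $ i = (\<Sum>j<n. of_real (A $$ (i, j)) * x $ j)"
      using A x(1) that by (simp add: scalar_prod_def lessThan_atLeast0)
    then show ?thesis using x that by simp
  qed
  define q where "q = (\<Sum>i<n. \<Sum>j<n. of_real (A $$ (i, j)) * (cnj (x $ i) * x $ j))"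
  define r where "r = (\<Sum>i<n. (cmod (x $ i))\<^sup>2)"
  have "q = (\<Sum>i<n. cnj (x $ i) * (\<Sum>j<n. of_real (A $$ (i, j)) * x $ j))"
    unfolding q_def sum_distrib_left by (simp add: mult_ac)
  also have "\<dots> = (\<Sum>i<n. z * of_real ((cmod (x $ i))\<^sup>2))"
    by (intro sum.cong) (simp_all only: row lessThan_iff complex_norm_square, simp_all)
  finally have qz: "q = z * of_real r" by (simp add: r_def sum_distrib_left)
  have "cnj q = (\<Sum>i<n. \<Sum>j<n. of_real (A $$ (i, j)) * (x $ i * cnj (x $ j)))"
    by (simp add: q_def)
  also have "\<dots> = q"
    unfolding q_def by (subst sum.swap) (auto intro!: sum.cong simp: symA)
  finally have "q \<in> \<real>" by (simp add: Reals_cnj_iff)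
  obtain i where "i < n" "x $ i \<noteq> 0"
    using x by (metis carrier_vecD eq_vecI index_zero_vec)
  then have "r > 0" unfolding r_def by (intro sum_pos2[of _ i]) auto
  then have "z = q / of_real r" using qz by simp
  then show ?thesis using \<open>q \<in> \<real>\<close> by (simp add: Reals_divide)
qed

text \<open>The polynomial splits over the complex numbers with real roots only; injectivity of the
  coefficient embedding carries the factorization back to the reals.\<close>

lemma char_poly_symmetric_splits:
  fixes A :: "real mat"
  assumes A: "A \<in> carrier_mat n n" and sym: "transpose_mat A = A"
  obtains es where "char_poly A = (\<Prod>e\<leftarrow>es. [:- e, 1:])" "length es = n"
proof -
  let ?C = "map_mat complex_of_real A"
  have C: "?C \<in> carrier_mat n n" using A by simp
  obtain zs where zs: "char_poly ?C = (\<Prod>z\<leftarrow>zs. [:- z, 1:])" "length zs = n"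
    using char_poly_factorized[OF C] by blast
  have real: "z = of_real (Re z)" if "z \<in> set zs" for z
  proof -
    have "poly (char_poly ?C) z = 0"
      using that unfolding zs(1) by (auto simp: poly_prod_list prod_list_zero_iff image_iff)
    then have "eigenvalue ?C z" using eigenvalue_root_char_poly[OF C] by simp
    from symmetric_complex_eigenvalue_real[OF A sym this] show ?thesis by (simp add: of_real_Re)
  qed
  interpret c: map_poly_inj_comm_ring_hom complex_of_real ..
  have "map_poly of_real (char_poly A) = (\<Prod>z\<leftarrow>zs. [:- z, 1:])"
    using zs(1) of_real_hom.char_poly_hom[OF A, where 'a = complex] by simp
  also have "\<dots> = (\<Prod>z\<leftarrow>zs. map_poly complex_of_real [:- Re z, 1:])"
    using real by (intro arg_cong[where f = prod_list] map_cong) auto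
  also have "\<dots> = map_poly of_real (\<Prod>e\<leftarrow>map Re zs. [:- e, 1:])"
    by (simp only: c.hom_prod_list map_map o_def)
  finally have "char_poly A = (\<Prod>e\<leftarrow>map Re zs. [:- e, 1:])"
    by (simp only: c.eq_iff)
  then show ?thesis using that zs(2) by (metis length_map)
qed

text \<open>The reflection in the hyperplane orthogonal to v - e_0 exchanges e_0 and the unit vector
  v. Being symmetric and its own inverse, it serves as a change of basis without a separate inverse.
  For v = e_0 the reflection degenerates and the identity is used.\<close>

lemma householder:
  fixes v :: "real vec"
  assumes v: "v \<in> carrier_vec n" "v \<bullet> v = 1"
  obtains W where "W \<in> carrier_mat n n" "transpose_mat W = W" "W * W = 1\<^sub>m n" "col W 0 = v"
proof -
  have vv: "(\<Sum>i<n. v $ i * v $ i) = 1"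
    using v by (simp add: scalar_prod_def lessThan_atLeast0)
  have n: "n > 0"
  proof (rule ccontr)
    assume "\<not> n > 0"
    then have "n = 0" by simp
    with vv show False by simp
  qed
  show ?thesis
  proof (cases "v = unit_vec n 0")
    case True
    then show ?thesis using n by (intro that[of "1\<^sub>m n"]) auto
  next
    case False
    define u where "u = (\<lambda>i. v $ i - (if i = 0 then 1 else 0))"
    define s where "s = (\<Sum>i<n. u i * u i)"
    have "\<exists>i<n. u i \<noteq> 0"
    proof (rule ccontr)
      assume "\<not> (\<exists>i<n. u i \<noteq> 0)"
      then have "v $ i = unit_vec n 0 $ i" if "i < n" for i
        using that by (auto simp: u_def unit_vec_def)
      then show False using False v by (auto intro!: eq_vecI)
    qed
    then obtain i where "i < n" "u i \<noteq> 0" by blast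
    then have s: "s > 0" unfolding s_def
      by (intro sum_pos2[of _ i]) (auto simp flip: power2_eq_square)
    \<comment> \<open>Since v is a unit vector, the squared length of v - e_0 is -2 times its first
      entry; this makes the first column of W equal to v.\<close>
    have s2: "s = 2 - 2 * v $ 0"
    proof -
      have "s = (\<Sum>i<n. v $ i * v $ i - (2 * v $ i - 1) * (if i = 0 then 1 else 0))"
        unfolding s_def u_def by (intro sum.cong) (auto simp: algebra_simps)
      also have "\<dots> = 2 - 2 * v $ 0"
        by (simp only: sum_subtractf vv sum_mult_delta[OF n])
      finally show ?thesis .
    qed
    define W where "W = mat n n (\<lambda>(i, j). (if i = j then 1 else 0) - 2 / s * (u i * u j))"
    have W: "W \<in> carrier_mat n n" by (simp add: W_def)
    have sym: "transpose_mat W = W" by (rule eq_matI) (auto simp: W_def)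
    have "W * W = 1\<^sub>m n"
    proof (rule eq_matI)
      fix i j assume "i < dim_row (1\<^sub>m n :: real mat)" "j < dim_col (1\<^sub>m n :: real mat)"
      then have ij: "i < n" "j < n" by auto
      have "(W * W) $$ (i, j) = (\<Sum>k<n. W $$ (i, k) * W $$ (k, j))"
        using ij W by (simp add: scalar_prod_def lessThan_atLeast0)
      also have "\<dots> = (\<Sum>k<n. (if i = j then 1 else 0) * (if k = i then 1 else 0)
          - 2 / s * u i * u k * (if k = j then 1 else 0) - 2 / s * u j * u k * (if k = i then 1 else 0)
          + 4 / s\<^sup>2 * u i * u j * (u k * u k))"
        using ij s by (intro sum.cong) (auto simp: W_def power2_eq_square field_simps)
      also have "\<dots> = (if i = j then 1 else 0) - 2 / s * u i * u j - 2 / s * u j * u i + 4 / s\<^sup>2 * u i * u j * s"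
        unfolding sum.distrib sum_subtractf sum_mult_delta[OF ij(1)] sum_mult_delta[OF ij(2)] s_def
        by (simp only: sum_distrib_left)
      also have "\<dots> = 1\<^sub>m n $$ (i, j)" using ij s by (simp add: power2_eq_square field_simps)
      finally show "(W * W) $$ (i, j) = 1\<^sub>m n $$ (i, j)" .
    qed (use W in auto)
    moreover have "col W 0 = v"
    proof (rule eq_vecI)
      fix i assume "i < dim_vec v"
      then have i: "i < n" using v by simp
      have u0: "u 0 = - (s / 2)" unfolding s2 by (simp add: u_def diff_divide_distrib)
      have "2 / s * (u i * u 0) = - u i" unfolding u0 using s by simp
      then show "col W 0 $ i = v $ i" using i n by (auto simp: W_def u_def)
    qed (use W v in auto)
    ultimately show ?thesis using that W sym by blast
  qed
qed

text \<open>Deflation: conjugation by a reflection that sends e_0 to a unit eigenvector splits off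
  one eigenvalue, and the remaining block is diagonalized by induction. The list \<open>es\<close>
  is prescribed, so the eigenvectors come out in any desired order of the eigenvalues.\<close>

theorem symmetric_diagonalization:
  fixes A :: "real mat"
  assumes "A \<in> carrier_mat n n" "transpose_mat A = A" "char_poly A = (\<Prod>e\<leftarrow>es. [:- e, 1:])"
  shows "\<exists>U. U \<in> carrier_mat n n \<and> transpose_mat U * U = 1\<^sub>m n \<and> A * U = U * mat_diag n (\<lambda>i. es ! i)"
  using assms
proof (induction es arbitrary: n A)
  case Nil
  then have "n = 0" using degree_monic_char_poly[OF Nil(1)] by simp
  with Nil(1) show ?case by (intro exI[of _ "1\<^sub>m 0"]) (auto intro!: eq_matI simp: mat_diag_def)
next
  case (Cons e es)
  note A = Cons.prems(1) and sym = Cons.prems(2)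
  have cp: "char_poly A = [:- e, 1:] * (\<Prod>e\<leftarrow>es. [:- e, 1:])" using Cons.prems by simp
  then have "eigenvalue A e" unfolding eigenvalue_root_char_poly[OF A] by simp
  then obtain x where x: "x \<in> carrier_vec n" "x \<noteq> 0\<^sub>v n" "A *\<^sub>v x = e \<cdot>\<^sub>v x"
    using A unfolding eigenvalue_def eigenvector_def by auto
  obtain k where k: "k < n" "x $ k \<noteq> 0"
    using x by (metis carrier_vecD eq_vecI index_zero_vec)
  obtain m where n: "n = Suc m" using k by (cases n) auto
  have xx: "x \<bullet> x > 0"
    unfolding scalar_prod_def using x k by (intro sum_pos2[of _ k]) (auto simp flip: power2_eq_square)
  define v where "v = (1 / sqrt (x \<bullet> x)) \<cdot>\<^sub>v x"
  have v: "v \<in> carrier_vec n" using x by (simp add: v_def)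
  have v1: "v \<bullet> v = 1" using x xx by (simp add: v_def)
  have Av: "A *\<^sub>v v = e \<cdot>\<^sub>v v"
    using mult_mat_vec[OF A x(1)] x(3) by (simp add: v_def smult_smult_assoc mult.commute)
  obtain W where W: "W \<in> carrier_mat n n" "transpose_mat W = W" "W * W = 1\<^sub>m n" "col W 0 = v"
    using householder[OF v v1] by blast
  define A' where "A' = W * A * W"
  have A': "A' \<in> carrier_mat n n" using A W by (simp add: A'_def)
  have WA': "W * A' = A * W"
  proof -
    have "W * A' = W * W * (A * W)"
      unfolding A'_def using A W(1) by (simp add: assoc_mult_mat[of _ n n _ n _ n])
    then show ?thesis using A W by simp
  qed
  have symA': "transpose_mat A' = A'"
    unfolding A'_def using A W sym
    by (simp add: transpose_mult[of _ n n _ n] assoc_mult_mat[of _ n n _ n _ n])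
  \<comment> \<open>W exchanges e_0 and v, so e_0 is an eigenvector of W A W. By symmetry the first
    row vanishes off the diagonal as well, and \<open>A'\<close> is block diagonal.\<close>
  have col0: "col A' 0 = e \<cdot>\<^sub>v unit_vec n 0"
  proof -
    have "col A' 0 = col (W * (A * W)) 0"
      unfolding A'_def using A W(1) by (simp add: assoc_mult_mat[of _ n n _ n _ n])
    also have "\<dots> = W *\<^sub>v col (A * W) 0"
      by (rule col_mult2[of _ n n _ n]) (use A W n in auto)
    also have "col (A * W) 0 = A *\<^sub>v col W 0"
      by (rule col_mult2[of _ n n _ n]) (use A W n in auto)
    also have "W *\<^sub>v (A *\<^sub>v col W 0) = W *\<^sub>v (A *\<^sub>v v)" using W by simp
    also have "\<dots> = e \<cdot>\<^sub>v (W *\<^sub>v col W 0)"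
      using W v by (simp add: Av mult_mat_vec[of _ n n])
    also have "W *\<^sub>v col W 0 = col (W * W) 0"
      by (rule col_mult2[of _ n n _ n, symmetric]) (use W n in auto)
    also have "\<dots> = unit_vec n 0" using W(3) n by simp
    finally show ?thesis .
  qed
  have A'0: "A' $$ (i, 0) = (if i = 0 then e else 0)" if "i < n" for i
  proof -
    have "A' $$ (i, 0) = col A' 0 $ i" using A' that n by simp
    then show ?thesis unfolding col0 using that n by simp
  qed
  have A'0': "A' $$ (0, i) = (if i = 0 then e else 0)" if "i < n" for i
    using A'0[OF that] symA' A' that n by (metis carrier_matD index_transpose_mat(1) zero_less_Suc)
  define B where "B = mat m m (\<lambda>(i, j). A' $$ (Suc i, Suc j))"
  have B: "B \<in> carrier_mat m m" by (simp add: B_def)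
  define E where "E = mat 1 1 (\<lambda>_. e)"
  have E: "E \<in> carrier_mat 1 1" by (simp add: E_def)
  have A'B: "A' = four_block_mat E (0\<^sub>m 1 m) (0\<^sub>m m 1) B"
    by (rule eq_matI) (use A' n A'0 A'0' in \<open>auto simp: E_def B_def Let_def\<close>)
  have symB: "transpose_mat B = B"
  proof (rule eq_matI)
    fix i j assume "i < dim_row B" "j < dim_col B"
    then have ij: "i < m" "j < m" by (auto simp: B_def)
    have "transpose_mat A' $$ (Suc i, Suc j) = A' $$ (Suc j, Suc i)" using A' ij n by simp
    then show "transpose_mat B $$ (i, j) = B $$ (i, j)" using symA' ij by (simp add: B_def)
  qed (auto simp: B_def)
  have "similar_mat_wit A A' W W"
    by (rule similar_mat_witI[of _ _ n])
       (use A A' W WA' in \<open>auto simp: assoc_mult_mat[of _ n n _ n _ n]\<close>)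
  then have "char_poly A = char_poly A'"
    by (intro char_poly_similar) (auto simp: similar_mat_def)
  also have "\<dots> = char_poly E * char_poly B"
    unfolding A'B by (rule char_poly_four_block_zeros_col[OF E _ B]) simp
  also have "char_poly E = [:- e, 1:]"
    by (simp add: E_def char_poly_defs det_def sign_def)
  finally have "char_poly B = (\<Prod>e\<leftarrow>es. [:- e, 1:])"
    using cp by (metis mult_cancel_left pCons_eq_0_iff zero_neq_one)
  from Cons.IH[OF B symB this] obtain V where V: "V \<in> carrier_mat m m"
    "transpose_mat V * V = 1\<^sub>m m" "B * V = V * mat_diag m (\<lambda>i. es ! i)" by blast
  define P where "P = four_block_mat (1\<^sub>m 1) (0\<^sub>m 1 m) (0\<^sub>m m 1) V"
  have P: "P \<in> carrier_mat n n"
    using four_block_carrier_mat[of "1\<^sub>m 1" 1 1 V m m] V n by (simp add: P_def)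
  define D where "D = mat_diag n (\<lambda>i. (e # es) ! i)"
  have D: "D \<in> carrier_mat n n" by (simp add: D_def)
  have D4: "D = four_block_mat E (0\<^sub>m 1 m) (0\<^sub>m m 1) (mat_diag m (\<lambda>i. es ! i))"
    by (rule eq_matI) (use n in \<open>auto simp: D_def E_def mat_diag_def Let_def\<close>)
  have PP: "transpose_mat P * P = 1\<^sub>m n"
  proof -
    have tP: "transpose_mat P = four_block_mat (1\<^sub>m 1) (0\<^sub>m 1 m) (0\<^sub>m m 1) (transpose_mat V)"
      unfolding P_def using V(1) by (subst transpose_four_block_mat) auto
    show ?thesis
      unfolding tP unfolding P_def using V n
      by (subst mult_four_block_mat[of _ 1 1 _ m _ m]) (auto simp: V(2))
  qed
  have A'P: "A' * P = P * D"
    unfolding A'B P_def D4 using V E B left_mult_zero_mat[of "mat_diag m (\<lambda>i. es ! i)" m m 1]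
    by (subst (1 2) mult_four_block_mat[of _ 1 1 _ m _ m]) auto
  show ?case
  proof (intro exI[of _ "W * P"] conjI)
    show "W * P \<in> carrier_mat n n" using W P by simp
    have "transpose_mat (W * P) * (W * P) = transpose_mat P * ((W * W) * P)"
      using W(1,2) P by (simp add: transpose_mult[of _ n n _ n] assoc_mult_mat[of _ n n _ n _ n])
    then show "transpose_mat (W * P) * (W * P) = 1\<^sub>m n" using W(3) P PP by simp
    have "A * (W * P) = (A * W) * P" using A W(1) P by simp
    also have "\<dots> = W * (A' * P)" unfolding WA'[symmetric] using W(1) A' P by simp
    also have "\<dots> = W * P * D" unfolding A'P using W(1) P D by simp
    finally show "A * (W * P) = W * P * mat_diag n (\<lambda>i. (e # es) ! i)" by (simp add: D_def)
  qed
qed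

lemma proots_linear_factors: "proots (\<Prod>e\<leftarrow>es. [:- e, 1:]) = mset (es :: 'a :: idom list)"
proof (induction es)
  case (Cons e es)
  have "(\<Prod>e\<leftarrow>es. [:- e, 1:]) \<noteq> 0" by (auto simp: prod_list_zero_iff)
  with Cons show ?case by (simp add: proots_mult del: mult_pCons_left)
qed simp

text \<open>Interchange of sums for a spectral expansion; with e = 1 it yields Parseval's identity,
  with e the eigenvalues the diagonal form of the matrix.\<close>

lemma sum_eigen_squares:
  "(\<Sum>k<n. e k * (\<Sum>i<n. x i * U i k)\<^sup>2) =
    (\<Sum>i<n. x i * (\<Sum>j<n. (\<Sum>k<n. e k * U i k * U j k) * x j))"
  for x :: "nat \<Rightarrow> real"
proof -
  have "(\<Sum>k<n. e k * (\<Sum>i<n. x i * U i k)\<^sup>2)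
      = (\<Sum>k<n. \<Sum>i<n. \<Sum>j<n. x i * (e k * U i k * U j k * x j))"
    unfolding power2_eq_square sum_product unfolding sum_distrib_left
    by (intro sum.cong refl) (simp add: mult_ac)
  also have "\<dots> = (\<Sum>i<n. \<Sum>k<n. \<Sum>j<n. x i * (e k * U i k * U j k * x j))"
    by (rule sum.swap)
  also have "\<dots> = (\<Sum>i<n. \<Sum>j<n. \<Sum>k<n. x i * (e k * U i k * U j k * x j))"
    by (intro sum.cong refl sum.swap)
  finally show ?thesis by (simp add: sum_distrib_left sum_distrib_right)
qed

lemma symmetric_eigenbasis:
  fixes A :: "real mat"
  assumes A: "A \<in> carrier_mat n n" and sym: "transpose_mat A = A"
  defines "a \<equiv> \<lambda>i j. A $$ (i, j)" and "ev_k \<equiv> \<lambda>k. nth_eigenvalue A (Suc k)"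
  obtains u where
    "\<And>k l. k \<le> l \<Longrightarrow> l < n \<Longrightarrow> ev_k l \<le> ev_k k"
    "\<And>k. k < n \<Longrightarrow> sq_norm n (u k) = 1"
    "\<And>k i. k < n \<Longrightarrow> i < n \<Longrightarrow> mat_app n a (u k) i = ev_k k * u k i"
    "\<And>x. sq_norm n x = (\<Sum>k<n. (\<Sum>i<n. x i * u k i)\<^sup>2)"
    "\<And>x. quad_form n a x = (\<Sum>k<n. ev_k k * (\<Sum>i<n. x i * u k i)\<^sup>2)"
proof -
  obtain fs where fs: "char_poly A = (\<Prod>e\<leftarrow>fs. [:- e, 1:])" "length fs = n"
    using char_poly_symmetric_splits[OF A sym] by blast
  \<comment> \<open>The decreasing order is the one built into \<open>nth_eigenvalue\<close>, so
    that \<open>es ! k\<close> is the eigenvalue with index \<open>Suc k\<close>: lists count from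
    0, eigenvalues from 1.\<close>
  define es where "es = rev (sorted_list_of_multiset (mset fs))"
  have mset: "mset es = mset fs" by (simp add: es_def)
  have len: "length es = n" using mset fs(2) by (metis size_mset)
  have cp: "char_poly A = (\<Prod>e\<leftarrow>es. [:- e, 1:])"
    unfolding fs(1) by (metis mset mset_map prod_mset_prod_list)
  have ev_k: "ev_k k = es ! k" for k
    by (simp add: ev_k_def nth_eigenvalue_def fs(1) proots_linear_factors es_def)
  have mono: "ev_k l \<le> ev_k k" if "k \<le> l" "l < n" for k l
  proof -
    have "sorted (rev es)" by (simp add: es_def)
    then show ?thesis unfolding ev_k using that len by (intro sorted_rev_nth_mono) auto
  qed
  obtain U where U: "U \<in> carrier_mat n n" "transpose_mat U * U = 1\<^sub>m n"
      "A * U = U * mat_diag n (\<lambda>i. es ! i)"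
    using symmetric_diagonalization[OF A sym cp] by blast
  have UU: "U * transpose_mat U = 1\<^sub>m n"
    using U mat_mult_left_right_inverse[of "transpose_mat U" n U] by simp
  have orth: "(\<Sum>k<n. U $$ (i, k) * U $$ (j, k)) = (if i = j then 1 else 0)" if "i < n" "j < n" for i j
  proof -
    have "(U * transpose_mat U) $$ (i, j) = (if i = j then 1 else 0)" using UU that by simp
    then show ?thesis using U(1) that by (simp add: scalar_prod_def lessThan_atLeast0)
  qed
  have app: "(\<Sum>j<n. a i j * U $$ (j, k)) = es ! k * U $$ (i, k)" if "i < n" "k < n" for i k
  proof -
    have "(A * U) $$ (i, k) = es ! k * U $$ (i, k)"
      unfolding U(3) using U(1) that by (simp add: mat_diag_mult_right)
    then show ?thesis using A U(1) that by (simp add: a_def scalar_prod_def lessThan_atLeast0)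
  qed
  have spec: "(\<Sum>k<n. es ! k * U $$ (i, k) * U $$ (j, k)) = a i j" if ij: "i < n" "j < n" for i j
  proof -
    have "(\<Sum>k<n. es ! k * U $$ (i, k) * U $$ (j, k)) = (\<Sum>k<n. \<Sum>l<n. a i l * (U $$ (j, k) * U $$ (l, k)))"
      by (intro sum.cong refl) (simp add: app[OF ij(1), symmetric] sum_distrib_left sum_distrib_right mult_ac)
    also have "\<dots> = (\<Sum>l<n. a i l * (\<Sum>k<n. U $$ (j, k) * U $$ (l, k)))"
      by (subst sum.swap) (simp add: sum_distrib_left)
    also have "\<dots> = (\<Sum>l<n. a i l * (if l = j then 1 else 0))"
      using orth ij by (intro sum.cong refl) auto
    finally show ?thesis by (simp add: sum_mult_delta[OF ij(2)])
  qed
  show ?thesis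
  proof (rule that[of "\<lambda>k i. U $$ (i, k)"])
    show "ev_k l \<le> ev_k k" if "k \<le> l" "l < n" for k l by (rule mono[OF that])
    show "sq_norm n (\<lambda>i. U $$ (i, k)) = 1" if "k < n" for k
    proof -
      have "(transpose_mat U * U) $$ (k, k) = 1" using U(2) that by simp
      then show ?thesis
        using U(1) that by (simp add: sq_norm_def scalar_prod_def lessThan_atLeast0 power2_eq_square)
    qed
    show "mat_app n a (\<lambda>i. U $$ (i, k)) i = ev_k k * U $$ (i, k)" if "k < n" "i < n" for k i
      using app[OF that(2,1)] by (simp add: mat_app_def ev_k)
    show "sq_norm n x = (\<Sum>k<n. (\<Sum>i<n. x i * U $$ (i, k))\<^sup>2)" for x
    proof -
      have "(\<Sum>k<n. 1 * (\<Sum>i<n. x i * U $$ (i, k))\<^sup>2)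
          = (\<Sum>i<n. x i * (\<Sum>j<n. x j * (if j = i then 1 else 0)))"
        unfolding sum_eigen_squares
        by (auto intro!: sum.cong simp: orth)
      also have "\<dots> = (\<Sum>i<n. x i * x i)" by (intro sum.cong refl) (simp only: sum_mult_delta lessThan_iff)
      finally show ?thesis by (simp add: sq_norm_def power2_eq_square)
    qed
    show "quad_form n a x = (\<Sum>k<n. ev_k k * (\<Sum>i<n. x i * U $$ (i, k))\<^sup>2)" for x
      unfolding sum_eigen_squares quad_form_def mat_app_def ev_k
      by (auto intro!: sum.cong simp: spec)
  qed
qed

section \<open>Quadratic forms and the two largest eigenvalues\<close>

lemma quad_form_le_top_eigenvalue:
  fixes A :: "real mat"
  assumes A: "A \<in> carrier_mat n n" "transpose_mat A = A"
  shows "quad_form n (\<lambda>i j. A $$ (i, j)) x \<le> nth_eigenvalue A 1 * sq_norm n x"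
proof -
  obtain u where u:
    "\<And>k l. k \<le> l \<Longrightarrow> l < n \<Longrightarrow> nth_eigenvalue A (Suc l) \<le> nth_eigenvalue A (Suc k)"
    "\<And>x. sq_norm n x = (\<Sum>k<n. (\<Sum>i<n. x i * u k i)\<^sup>2)"
    "\<And>x. quad_form n (\<lambda>i j. A $$ (i, j)) x = (\<Sum>k<n. nth_eigenvalue A (Suc k) * (\<Sum>i<n. x i * u k i)\<^sup>2)"
    by (rule symmetric_eigenbasis[OF A]) blast
  show ?thesis
    unfolding u(2,3) sum_distrib_left using u(1)[of 0] by (intro sum_mono mult_right_mono) auto
qed

text \<open>In the eigenbasis every square except the one along v carries an eigenvalue at most
  l2.\<close>

lemma quad_form_le_second_eigenvalue:
  fixes A :: "real mat"
  assumes A: "A \<in> carrier_mat n n" "transpose_mat A = A" and n: "n \<ge> 2"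
  defines "a \<equiv> \<lambda>i j. A $$ (i, j)" and "l1 \<equiv> nth_eigenvalue A 1" and "l2 \<equiv> nth_eigenvalue A 2"
  obtains v where "sq_norm n v = 1" "\<And>i. i < n \<Longrightarrow> mat_app n a v i = l1 * v i"
    "\<And>x. quad_form n a x \<le> l2 * sq_norm n x + (l1 - l2) * (\<Sum>i<n. x i * v i)\<^sup>2"
proof -
  obtain u where u:
    "\<And>k l. k \<le> l \<Longrightarrow> l < n \<Longrightarrow> nth_eigenvalue A (Suc l) \<le> nth_eigenvalue A (Suc k)"
    "\<And>k. k < n \<Longrightarrow> sq_norm n (u k) = 1"
    "\<And>k i. k < n \<Longrightarrow> i < n \<Longrightarrow> mat_app n a (u k) i = nth_eigenvalue A (Suc k) * u k i"
    "\<And>x. sq_norm n x = (\<Sum>k<n. (\<Sum>i<n. x i * u k i)\<^sup>2)"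
    "\<And>x. quad_form n a x = (\<Sum>k<n. nth_eigenvalue A (Suc k) * (\<Sum>i<n. x i * u k i)\<^sup>2)"
    unfolding a_def by (rule symmetric_eigenbasis[OF A]) blast
  obtain m where m: "n = Suc m" "m > 0" using n by (cases n) auto
  show ?thesis
  proof (rule that[of "u 0"])
    show "sq_norm n (u 0) = 1" "\<And>i. i < n \<Longrightarrow> mat_app n a (u 0) i = l1 * u 0 i"
      using u(2)[of 0] u(3)[of 0] n by (auto simp: l1_def)
    fix x
    define g where "g = (\<lambda>k. (\<Sum>i<n. x i * u k i)\<^sup>2)"
    have "sq_norm n x = (\<Sum>k<n. g k)" by (simp add: u(4) g_def)
    then have sq: "sq_norm n x = g 0 + (\<Sum>k<m. g (Suc k))"
      by (simp add: m(1) sum.lessThan_Suc_shift del: sum.lessThan_Suc)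
    have "quad_form n a x = (\<Sum>k<n. nth_eigenvalue A (Suc k) * g k)" by (simp add: u(5) g_def)
    then have qf: "quad_form n a x = l1 * g 0 + (\<Sum>k<m. nth_eigenvalue A (Suc (Suc k)) * g (Suc k))"
      by (simp add: m(1) l1_def sum.lessThan_Suc_shift del: sum.lessThan_Suc)
    have "nth_eigenvalue A (Suc (Suc k)) \<le> l2" if "k < m" for k
      using u(1)[of 1 "Suc k"] that m by (simp add: l2_def numeral_2_eq_2)
    then have "(\<Sum>k<m. nth_eigenvalue A (Suc (Suc k)) * g (Suc k)) \<le> l2 * (\<Sum>k<m. g (Suc k))"
      unfolding sum_distrib_left by (intro sum_mono mult_right_mono) (auto simp: g_def)
    then have "quad_form n a x \<le> l2 * sq_norm n x + (l1 - l2) * g 0"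
      unfolding qf sq by (simp add: algebra_simps)
    then show "quad_form n a x \<le> l2 * sq_norm n x + (l1 - l2) * (\<Sum>i<n. x i * u 0 i)\<^sup>2"
      by (simp add: g_def)
  qed
qed

text \<open>The weights are chosen for a later factor of at most 1 / 2: then the first becomes 3 /
  4, which leaves room below the coefficient 1 of the subtracted mean-field square.\<close>

lemma square_add_le: "(a + b)\<^sup>2 \<le> 3 / 2 * a\<^sup>2 + 3 * (b :: real)\<^sup>2"
proof -
  have "0 \<le> (a - 2 * b)\<^sup>2" by simp
  then show ?thesis by (simp add: power2_eq_square algebra_simps)
qed

text \<open>If the constant vector is almost an eigenvector for the eigenvalue 1, it is close to the top
  eigenvector, so that subtracting the Curie--Weiss coupling removes the top eigenvalue.\<close>
lemma quad_form_minus_mean_field: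
  fixes a :: "nat \<Rightarrow> nat \<Rightarrow> real"
  assumes n: "n > 0" and sym: "\<And>i j. i < n \<Longrightarrow> j < n \<Longrightarrow> a i j = a j i"
    and v: "sq_norm n v = 1" and eig: "\<And>i. i < n \<Longrightarrow> mat_app n a v i = l * v i"
    and gap: "\<And>x. quad_form n a x \<le> q * sq_norm n x + (l - q) * (\<Sum>i<n. x i * v i)\<^sup>2"
    and q: "q < 1" "q \<le> l" "l - q \<le> 1 / 2"
    and close: "(\<Sum>i<n. ((\<Sum>j<n. a i j) - 1)\<^sup>2) \<le> \<epsilon> * real n"
  shows "quad_form n a x - (\<Sum>i<n. x i)\<^sup>2 / real n \<le> (q + 3 / 2 * (\<epsilon> / (1 - q)\<^sup>2)) * sq_norm n x"
proof -
  define dot where "dot = (\<lambda>x y :: nat \<Rightarrow> real. \<Sum>i<n. x i * y i)"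
  have dot_lin: "dot x (\<lambda>i. c * y i + d * z i) = c * dot x y + d * dot x z"
    and dot_comm: "dot x y = dot y x" for x y z c d
    by (simp_all add: dot_def algebra_simps sum.distrib sum_distrib_left)
  have sq_dot: "sq_norm n x = dot x x" for x by (simp add: sq_norm_def dot_def power2_eq_square)
  have CS: "(dot x y)\<^sup>2 \<le> sq_norm n x * sq_norm n y" for x y
    unfolding dot_def sq_norm_def by (rule Cauchy_Schwarz_ineq_sum)
  \<comment> \<open>u is the normalized constant vector and c the cosine of its angle with the top
    eigenvector v. The remainders w = u - c v, orthogonal to v, and w' = v - c u, orthogonal to u,
    both have squared norm 1 - c^2.\<close>
  define u :: "nat \<Rightarrow> real" where "u = (\<lambda>i. 1 / sqrt n)"
  define c where "c = dot u v"
  define w where "w = (\<lambda>i. 1 * u i + (- c) * v i)"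
  define w' where "w' = (\<lambda>i. 1 * v i + (- c) * u i)"
  have uu: "dot u u = 1" using n by (simp add: dot_def u_def)
  have vv: "dot v v = 1" using v by (simp add: sq_dot)
  have dw: "dot x w = dot x u - c * dot x v" and dw': "dot x w' = dot x v - c * dot x u" for x
    using dot_lin[of x 1 u "- c" v] dot_lin[of x 1 v "- c" u] by (simp_all add: w_def w'_def)
  have wv: "dot w v = 0" by (simp add: dot_comm[of w] dw vv c_def dot_comm[of v u])
  have ww: "sq_norm n w = 1 - c\<^sup>2"
    by (simp add: sq_dot dw wv) (simp add: dot_comm[of w] dw uu c_def power2_eq_square)
  have w'w': "sq_norm n w' = 1 - c\<^sup>2"
    unfolding sq_dot dw' dot_comm[of w' v] dot_comm[of w' u] dw'
    by (simp add: uu vv dot_comm[of v u] power2_eq_square flip: c_def)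
  \<comment> \<open>The residual z = (a - 1) u has squared norm at most \<epsilon>. Paired with w,
    its component along v drops out, and the gap gives (1 - q) times the squared norm of w at most -
    w . z; Cauchy--Schwarz finishes.\<close>
  have small: "1 - c\<^sup>2 \<le> \<epsilon> / (1 - q)\<^sup>2"
  proof -
    define z where "z = (\<lambda>i. mat_app n a u i - u i)"
    have z: "sq_norm n z \<le> \<epsilon>"
    proof -
      have "z i = ((\<Sum>j<n. a i j) - 1) / sqrt n" for i
        by (simp add: z_def mat_app_def u_def diff_divide_distrib sum_divide_distrib)
      then have "sq_norm n z = (\<Sum>i<n. ((\<Sum>j<n. a i j) - 1)\<^sup>2) / n"
        by (simp add: sq_norm_def power_divide sum_divide_distrib)
      also have "\<dots> \<le> \<epsilon> * n / n" by (intro divide_right_mono close) simp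
      finally show ?thesis using n by simp
    qed
    have zi: "z i = c * (l - 1) * v i + 1 * (mat_app n a w i - w i)" if "i < n" for i
    proof -
      have "mat_app n a w i = mat_app n a u i - c * mat_app n a v i"
        by (simp add: mat_app_def w_def algebra_simps sum_subtractf sum_distrib_left)
      then show ?thesis unfolding eig[OF that] by (simp add: z_def w_def algebra_simps)
    qed
    have "dot w z = dot w (\<lambda>i. c * (l - 1) * v i + 1 * (mat_app n a w i - w i))"
      unfolding dot_def using zi by (intro sum.cong) auto
    also have "\<dots> = c * (l - 1) * dot w v + 1 * dot w (\<lambda>i. mat_app n a w i - w i)" by (rule dot_lin)
    also have "dot w (\<lambda>i. mat_app n a w i - w i) = quad_form n a w - sq_norm n w"
      by (simp add: dot_def quad_form_def sq_norm_def right_diff_distrib sum_subtractf power2_eq_square)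
    finally have "dot w z = quad_form n a w - sq_norm n w" by (simp add: wv)
    moreover have "quad_form n a w \<le> q * sq_norm n w"
      using gap[of w] wv by (simp add: dot_def)
    ultimately have "(1 - q) * sq_norm n w \<le> - dot w z" by (simp add: algebra_simps)
    moreover have "0 \<le> (1 - q) * sq_norm n w" using q sq_norm_nonneg[of n w] by simp
    ultimately have "((1 - q) * sq_norm n w)\<^sup>2 \<le> (- dot w z)\<^sup>2" by (rule power_mono)
    also have "\<dots> \<le> sq_norm n w * sq_norm n z" using CS[of w z] by simp
    also have "\<dots> \<le> sq_norm n w * \<epsilon>" using z sq_norm_nonneg[of n w] by (rule mult_left_mono)
    finally have "sq_norm n w * ((1 - q)\<^sup>2 * sq_norm n w) \<le> sq_norm n w * \<epsilon>"
      by (simp add: power2_eq_square mult_ac)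
    then have "(1 - q)\<^sup>2 * sq_norm n w \<le> \<epsilon>"
      using sq_norm_nonneg[of n w] sq_norm_nonneg[of n z] z by (cases "sq_norm n w = 0") auto
    then show ?thesis using q by (simp add: ww field_simps)
  qed
  have xv: "(dot x v)\<^sup>2 \<le> 3 / 2 * (dot x u)\<^sup>2 + 3 * (\<epsilon> / (1 - q)\<^sup>2 * sq_norm n x)"
  proof -
    have "dot x v = dot x (\<lambda>i. c * u i + 1 * w' i)" by (simp add: w'_def)
    then have "dot x v = c * dot x u + dot x w'" unfolding dot_lin by simp
    then have "(dot x v)\<^sup>2 \<le> 3 / 2 * (c * dot x u)\<^sup>2 + 3 * (dot x w')\<^sup>2"
      using square_add_le by simp
    moreover have "(c * dot x u)\<^sup>2 \<le> (dot x u)\<^sup>2"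
      using ww sq_norm_nonneg[of n w] unfolding power_mult_distrib by (intro mult_left_le_one_le) auto
    moreover have "(dot x w')\<^sup>2 \<le> \<epsilon> / (1 - q)\<^sup>2 * sq_norm n x"
      using order_trans[OF CS[of x w']] mult_left_mono[OF small sq_norm_nonneg[of n x]]
      by (simp add: w'w' mult.commute)
    ultimately show ?thesis by linarith
  qed
  have xu: "(dot x u)\<^sup>2 = (\<Sum>i<n. x i)\<^sup>2 / n"
    by (simp add: dot_def u_def power_divide flip: sum_divide_distrib)
  define X where "X = \<epsilon> / (1 - q)\<^sup>2 * sq_norm n x"
  have \<epsilon>: "0 \<le> X" unfolding X_def
    using small ww sq_norm_nonneg[of n w] sq_norm_nonneg[of n x] by (intro mult_nonneg_nonneg) auto
  have "(l - q) * (dot x v)\<^sup>2 \<le> 1 / 2 * (3 / 2 * (dot x u)\<^sup>2 + 3 * X)"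
    using xv[folded X_def] q \<epsilon> by (intro mult_mono) auto
  also have "\<dots> = 3 / 4 * (dot x u)\<^sup>2 + 3 / 2 * X" by simp
  also have "\<dots> \<le> (dot x u)\<^sup>2 + 3 / 2 * X" by simp
  finally have "quad_form n a x \<le> q * sq_norm n x + ((dot x u)\<^sup>2 + 3 / 2 * X)"
    using gap[of x] by (simp add: dot_def)
  then show ?thesis unfolding xu X_def by (simp add: algebra_simps)
qed

section \<open>Change of measure and the mean-field lower bound\<close>

lemma ln_le_if_le_exp: "0 < x \<Longrightarrow> x \<le> exp u \<Longrightarrow> ln x \<le> (u :: real)"
  by (metis exp_gt_zero ln_exp ln_le_cancel_iff)

lemma gibbs_pmf_prob:
  assumes "E \<subseteq> spin_configs N"
  shows "measure_pmf.prob (gibbs_pmf N H) E = (\<Sum>\<sigma>\<in>E. exp (H \<sigma>)) / partition_function N H"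
proof -
  have "finite E" using assms finite_spin_configs finite_subset by blast
  then have "measure_pmf.prob (gibbs_pmf N H) E = (\<Sum>\<sigma>\<in>E. pmf (gibbs_pmf N H) \<sigma>)"
    by (rule measure_measure_pmf_finite)
  also have "\<dots> = (\<Sum>\<sigma>\<in>E. exp (H \<sigma>) / partition_function N H)"
    using assms by (intro sum.cong) (auto simp: pmf_gibbs_pmf)
  finally show ?thesis by (simp add: sum_divide_distrib)
qed

text \<open>exp f is the product of (exp g) to the power 1 - 1/p and exp (p * f + (1 - p) * g) to
  the power 1/p. After both families are normalized to total mass 1, Young's inequality holds
  termwise and sums to 1.\<close>

lemma holder_exp_sum:
  fixes f g :: "'a \<Rightarrow> real"
  assumes E: "finite E" "E \<noteq> {}" and p: "p > 1"
  shows "ln (\<Sum>x\<in>E. exp (f x)) \<le> (1 - 1 / p) * ln (\<Sum>x\<in>E. exp (g x))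
    + 1 / p * ln (\<Sum>x\<in>E. exp (p * f x + (1 - p) * g x))"
proof -
  define X where "X = (\<Sum>x\<in>E. exp (g x))"
  define Y where "Y = (\<Sum>x\<in>E. exp (p * f x + (1 - p) * g x))"
  define C where "C = (1 - 1 / p) * ln X + 1 / p * ln Y"
  have XY: "X > 0" "Y > 0" using E by (auto simp: X_def Y_def intro!: sum_pos)
  have "exp (f x) / exp C \<le> (1 - 1 / p) * (exp (g x) / X) + 1 / p * (exp (p * f x + (1 - p) * g x) / Y)" for x
  proof -
    have "(exp (g x) / X) powr (1 - 1 / p) * (exp (p * f x + (1 - p) * g x) / Y) powr (1 / p)
      \<le> (1 - 1 / p) * (exp (g x) / X) + 1 / p * (exp (p * f x + (1 - p) * g x) / Y)"
      using p XY by (intro Youngs_inequality_0) auto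
    moreover have "(exp (g x) / X) powr (1 - 1 / p) * (exp (p * f x + (1 - p) * g x) / Y) powr (1 / p)
      = exp (f x) / exp C"
    proof -
      have "(exp (g x) / X) powr (1 - 1 / p) * (exp (p * f x + (1 - p) * g x) / Y) powr (1 / p)
        = exp ((1 - 1 / p) * (g x - ln X) + 1 / p * (p * f x + (1 - p) * g x - ln Y))"
        using XY by (simp add: powr_def ln_div flip: exp_add)
      also have "(1 - 1 / p) * (g x - ln X) + 1 / p * (p * f x + (1 - p) * g x - ln Y) = f x - C"
        using p by (simp add: C_def field_simps)
      finally show ?thesis by (simp add: exp_diff)
    qed
    ultimately show ?thesis by simp
  qed
  then have "(\<Sum>x\<in>E. exp (f x) / exp C)
      \<le> (\<Sum>x\<in>E. (1 - 1 / p) * (exp (g x) / X) + 1 / p * (exp (p * f x + (1 - p) * g x) / Y))"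
    by (rule sum_mono)
  also have "\<dots> = (1 - 1 / p) * (X / X) + 1 / p * (Y / Y)"
    unfolding sum.distrib sum_distrib_left[symmetric] sum_divide_distrib[symmetric]
    by (simp add: X_def Y_def)
  also have "\<dots> = 1" using XY by simp
  finally have "(\<Sum>x\<in>E. exp (f x)) \<le> exp C"
    by (simp add: sum_divide_distrib[symmetric] divide_le_eq)
  then have "ln (\<Sum>x\<in>E. exp (f x)) \<le> C"
    using E by (intro ln_le_if_le_exp sum_pos) auto
  then show ?thesis by (simp add: C_def X_def Y_def)
qed

text \<open>exp (p * H1 + (1 - p) * H0) is exp H0 times the p-th power of exp (H1 - H0), so
  \<open>U\<close> bounds the unnormalized p-th moment of the density. Only this moment is enlarged
  from the event to all configurations; the sum of exp H0 stays on the event.\<close>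

lemma gibbs_change_of_measure:
  assumes E: "E \<subseteq> spin_configs N" and p: "p > 1"
    and U: "(\<Sum>\<sigma>\<in>spin_configs N. exp (p * H1 \<sigma> + (1 - p) * H0 \<sigma>)) \<le> exp U"
    and L: "exp L \<le> partition_function N H1" and V: "partition_function N H0 \<le> exp V"
    and D: "U / p - L + (1 - 1 / p) * V \<le> D"
  shows "log_ext (measure_pmf.prob (gibbs_pmf N H1) E)
    \<le> ereal (1 - 1 / p) * log_ext (measure_pmf.prob (gibbs_pmf N H0) E) + ereal D"
proof (cases "E = {}")
  \<comment> \<open>Both probabilities vanish, and since 1 - 1/p is positive both sides are minus
    infinity.\<close>
  case True
  then show ?thesis using p by (simp add: log_ext_def)
next
  case False
  define S1 S0 where "S1 = (\<Sum>\<sigma>\<in>E. exp (H1 \<sigma>))" and "S0 = (\<Sum>\<sigma>\<in>E. exp (H0 \<sigma>))"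
  define Z1 Z0 where "Z1 = partition_function N H1" and "Z0 = partition_function N H0"
  have fin: "finite E" using E finite_spin_configs finite_subset by blast
  have pos: "S1 > 0" "S0 > 0" "Z1 > 0" "Z0 > 0"
    using False fin by (auto simp: S1_def S0_def Z1_def Z0_def partition_function_pos intro!: sum_pos)
  have "(\<Sum>\<sigma>\<in>E. exp (p * H1 \<sigma> + (1 - p) * H0 \<sigma>)) \<le> exp U"
    by (rule order_trans[OF sum_mono2[OF finite_spin_configs E] U]) simp
  then have "ln (\<Sum>\<sigma>\<in>E. exp (p * H1 \<sigma> + (1 - p) * H0 \<sigma>)) \<le> U"
    using False fin by (intro ln_le_if_le_exp sum_pos) auto
  then have "1 / p * ln (\<Sum>\<sigma>\<in>E. exp (p * H1 \<sigma> + (1 - p) * H0 \<sigma>)) \<le> 1 / p * U"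
    using p by (intro mult_left_mono) auto
  with holder_exp_sum[OF fin False p, of H1 H0]
  have 1: "ln S1 \<le> (1 - 1 / p) * ln S0 + U / p" by (simp add: S1_def S0_def)
  have 2: "L \<le> ln Z1" using L pos by (simp add: Z1_def ln_ge_iff)
  have "ln Z0 \<le> V" using V pos by (simp add: Z0_def ln_le_if_le_exp)
  then have 3: "(1 - 1 / p) * ln Z0 \<le> (1 - 1 / p) * V" using p by (intro mult_left_mono) auto
  have "ln (S1 / Z1) \<le> (1 - 1 / p) * ln (S0 / Z0) + D"
    using 1 2 3 D pos by (simp add: ln_div right_diff_distrib)
  then show ?thesis
    using pos unfolding gibbs_pmf_prob[OF E] S1_def[symmetric] S0_def[symmetric] Z1_def[symmetric] Z0_def[symmetric]
    by (simp add: log_ext_def)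
qed

text \<open>A nonempty event has reference probability at least exp (a - V), while the other
  probability is at most 1. This covers the cases where the error term already dominates a multiple
  of N.\<close>

lemma gibbs_trivial_bound:
  assumes E: "E \<subseteq> spin_configs N" and c: "c > 0"
    and H0: "\<And>\<sigma>. \<sigma> \<in> spin_configs N \<Longrightarrow> a \<le> H0 \<sigma>" and V: "partition_function N H0 \<le> exp V"
    and D: "c * (V - a) \<le> D"
  shows "log_ext (measure_pmf.prob (gibbs_pmf N H1) E)
    \<le> ereal c * log_ext (measure_pmf.prob (gibbs_pmf N H0) E) + ereal D"
proof (cases "E = {}")
  case True
  then show ?thesis using c by (simp add: log_ext_def)
next
  case False
  define S0 where "S0 = (\<Sum>\<sigma>\<in>E. exp (H0 \<sigma>))"
  define Z0 where "Z0 = partition_function N H0"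
  have fin: "finite E" using E finite_spin_configs finite_subset by blast
  have pos: "S0 > 0" "Z0 > 0"
    using False fin by (auto simp: S0_def Z0_def partition_function_pos intro!: sum_pos)
  obtain \<sigma> where \<sigma>: "\<sigma> \<in> E" using False by blast
  have "exp a \<le> exp (H0 \<sigma>)" using H0 \<sigma> E by auto
  also have "\<dots> \<le> S0" unfolding S0_def using \<sigma> fin by (intro member_le_sum) auto
  finally have "a \<le> ln S0" using pos by (simp add: ln_ge_iff)
  moreover have "ln Z0 \<le> V" using V pos by (simp add: Z0_def ln_le_if_le_exp)
  ultimately have "a - V \<le> ln (S0 / Z0)" using pos by (simp add: ln_div)
  then have "c * (a - V) \<le> c * ln (S0 / Z0)" using c by (intro mult_left_mono) auto
  then have *: "0 \<le> c * ln (S0 / Z0) + D" using D by (simp add: algebra_simps)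
  have "log_ext (measure_pmf.prob (gibbs_pmf N H1) E) \<le> ereal 0"
    using ln_le_zero_iff[of "measure_pmf.prob (gibbs_pmf N H1) E"] measure_nonneg[of "gibbs_pmf N H1" E]
    by (auto simp: log_ext_def measure_pmf.prob_le_1 less_le)
  also have "\<dots> \<le> ereal (c * ln (S0 / Z0) + D)" using * by simp
  finally show ?thesis
    using pos unfolding gibbs_pmf_prob[OF E] S0_def[symmetric] Z0_def[symmetric]
    by (simp add: log_ext_def)
qed

lemma iid_pmf_eq_gibbs:
  "iid_pmf N \<beta> B = gibbs_pmf N (\<lambda>\<sigma>. (\<beta> * mf_root \<beta> B + B) * spin_sum \<sigma>)"
proof (rule pmf_eqI)
  have "- \<beta> * mf_root \<beta> B - B = - (\<beta> * mf_root \<beta> B + B)" by simp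
  then show "pmf (iid_pmf N \<beta> B) \<sigma> = pmf (gibbs_pmf N (\<lambda>\<sigma>. (\<beta> * mf_root \<beta> B + B) * spin_sum \<sigma>)) \<sigma>" for \<sigma>
    unfolding pmf_iid_pmf pmf_gibbs_pmf partition_function_def sum_exp_spin_sum by simp
qed

text \<open>The weight is that of independent spins with mean tanh h. Splitting off the first spin
  contributes a factor tanh h or 1, according to whether that spin occurs in the monomial.\<close>

lemma sum_spin_configs_prod_weight:
  fixes h :: real
  defines "w \<equiv> \<lambda>N \<sigma>. exp (h * spin_sum \<sigma>) / (2 * cosh h) ^ N"
  shows "(\<Sum>\<sigma>\<in>spin_configs N. w N \<sigma>) = 1"
    and "i < N \<Longrightarrow> (\<Sum>\<sigma>\<in>spin_configs N. w N \<sigma> * \<sigma> $ i) = tanh h"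
    and "i < N \<Longrightarrow> j < N \<Longrightarrow> i \<noteq> j \<Longrightarrow> (\<Sum>\<sigma>\<in>spin_configs N. w N \<sigma> * (\<sigma> $ i * \<sigma> $ j)) = (tanh h)\<^sup>2"
proof -
  define c where "c = 2 * cosh h"
  have c: "c = exp (- h) + exp h" by (simp add: c_def cosh_field_def)
  then have c0: "c > 0" by (simp add: add_pos_pos)
  note w_def = w_def[folded c_def]
  have w: "w (Suc N) (vCons a \<tau>) = w N \<tau> * (exp (h * a) / c)" for N a \<tau>
    by (simp add: w_def spin_sum_vCons distrib_left exp_add mult_ac)
  have 1: "(\<Sum>\<sigma>\<in>spin_configs N. w N \<sigma>) = 1" for N
    using c0 sum_exp_spin_sum[of h N] by (simp add: w_def c flip: sum_divide_distrib)
  have e: "exp (- h) / c + exp h / c = 1"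
    using c0 by (simp add: c flip: add_divide_distrib)
  have t: "exp h / c - exp (- h) / c = tanh h"
    by (simp add: c_def tanh_def sinh_field_def flip: diff_divide_distrib)
  have 2: "i < N \<Longrightarrow> (\<Sum>\<sigma>\<in>spin_configs N. w N \<sigma> * \<sigma> $ i) = tanh h" for i N
  proof (induction N arbitrary: i)
    case (Suc N)
    show ?case
    proof (cases i)
      case 0
      have "(\<Sum>\<sigma>\<in>spin_configs (Suc N). w (Suc N) \<sigma> * \<sigma> $ i)
          = (\<Sum>\<tau>\<in>spin_configs N. w N \<tau> * (exp h / c - exp (- h) / c))"
        unfolding sum_spin_configs_Suc w 0 by (intro sum.cong) (simp_all add: algebra_simps)
      then show ?thesis unfolding t by (simp add: 1 flip: sum_distrib_right)
    next
      case (Suc k)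
      have "(\<Sum>\<sigma>\<in>spin_configs (Suc N). w (Suc N) \<sigma> * \<sigma> $ i)
          = (\<Sum>\<tau>\<in>spin_configs N. (w N \<tau> * \<tau> $ k) * (exp (- h) / c + exp h / c))"
        unfolding sum_spin_configs_Suc w Suc by (intro sum.cong) (simp_all add: algebra_simps)
      then show ?thesis unfolding e using Suc.IH[of k] Suc.prems \<open>i = Suc k\<close> by simp
    qed
  qed simp
  have 3: "i < N \<Longrightarrow> j < N \<Longrightarrow> i < j \<Longrightarrow> (\<Sum>\<sigma>\<in>spin_configs N. w N \<sigma> * (\<sigma> $ i * \<sigma> $ j)) = (tanh h)\<^sup>2" for i j N
  proof (induction N arbitrary: i j)
    case (Suc N)
    obtain l where j: "j = Suc l" "l < N" using Suc.prems by (cases j) auto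
    show ?case
    proof (cases i)
      case 0
      have "(\<Sum>\<sigma>\<in>spin_configs (Suc N). w (Suc N) \<sigma> * (\<sigma> $ i * \<sigma> $ j))
          = (\<Sum>\<tau>\<in>spin_configs N. w N \<tau> * \<tau> $ l * (exp h / c - exp (- h) / c))"
        unfolding sum_spin_configs_Suc w 0 j by (intro sum.cong) (simp_all add: algebra_simps)
      then show ?thesis unfolding t by (simp add: 2[OF j(2)] power2_eq_square flip: sum_distrib_right)
    next
      case (Suc k)
      have "(\<Sum>\<sigma>\<in>spin_configs (Suc N). w (Suc N) \<sigma> * (\<sigma> $ i * \<sigma> $ j))
          = (\<Sum>\<tau>\<in>spin_configs N. (w N \<tau> * (\<tau> $ k * \<tau> $ l)) * (exp (- h) / c + exp h / c))"
        unfolding sum_spin_configs_Suc w Suc j by (intro sum.cong) (simp_all add: algebra_simps)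
      then show ?thesis unfolding e using Suc.IH[of k l] Suc.prems \<open>i = Suc k\<close> j by simp
    qed
  qed simp
  show "(\<Sum>\<sigma>\<in>spin_configs N. w N \<sigma>) = 1" by (rule 1)
  show "i < N \<Longrightarrow> (\<Sum>\<sigma>\<in>spin_configs N. w N \<sigma> * \<sigma> $ i) = tanh h" by (rule 2)
  show "i < N \<Longrightarrow> j < N \<Longrightarrow> i \<noteq> j \<Longrightarrow> (\<Sum>\<sigma>\<in>spin_configs N. w N \<sigma> * (\<sigma> $ i * \<sigma> $ j)) = (tanh h)\<^sup>2"
    using 3[of i N j] 3[of j N i] by (cases i j rule: linorder_cases) (auto simp: mult.commute)
qed

text \<open>Averaged over weights under which x has mean m, this is Jensen's inequality for
  exp.\<close>

lemma exp_ge_tangent: "exp m * (1 + (x - m)) \<le> exp (x :: real)"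
proof -
  have "exp m * (1 + (x - m)) \<le> exp m * exp (x - m)"
    by (intro mult_left_mono exp_ge_add_one_self) simp
  then show ?thesis by (simp flip: exp_add)
qed

text \<open>Jensen's inequality for the product measure with field \<open>h\<close>.\<close>
lemma partition_function_ge_mean_field:
  assumes diag: "\<And>i. i < N \<Longrightarrow> M i i = 0"
  shows "exp (real N * ln (2 * cosh h) + (tanh h)\<^sup>2 / 2 * (\<Sum>i<N. \<Sum>j<N. M i j) + (B - h) * tanh h * real N)
    \<le> partition_function N (\<lambda>\<sigma>. 1 / 2 * quad_form N M (($) \<sigma>) + B * spin_sum \<sigma>)"
proof -
  define w where "w = (\<lambda>\<sigma>. exp (h * spin_sum \<sigma>) / (2 * cosh h) ^ N)"
  define X where "X = (\<lambda>\<sigma>. 1 / 2 * quad_form N M (($) \<sigma>) + (B - h) * (\<Sum>i<N. \<sigma> $ i))"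
  define m where "m = (tanh h)\<^sup>2 / 2 * (\<Sum>i<N. \<Sum>j<N. M i j) + (B - h) * tanh h * real N"
  have W1: "(\<Sum>\<sigma>\<in>spin_configs N. w \<sigma>) = 1"
    and W2: "i < N \<Longrightarrow> (\<Sum>\<sigma>\<in>spin_configs N. w \<sigma> * \<sigma> $ i) = tanh h"
    and W3: "i < N \<Longrightarrow> j < N \<Longrightarrow> i \<noteq> j \<Longrightarrow> (\<Sum>\<sigma>\<in>spin_configs N. w \<sigma> * (\<sigma> $ i * \<sigma> $ j)) = (tanh h)\<^sup>2"
    for i j
    unfolding w_def by (rule sum_spin_configs_prod_weight; assumption)+
  have cpos: "(2 * cosh h) ^ N > 0" by (simp add: cosh_real_pos)
  have "(\<Sum>\<sigma>\<in>spin_configs N. w \<sigma> * quad_form N M (($) \<sigma>))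
      = (\<Sum>\<sigma>\<in>spin_configs N. \<Sum>i<N. \<Sum>j<N. M i j * (w \<sigma> * (\<sigma> $ i * \<sigma> $ j)))"
    by (simp add: quad_form_def mat_app_def sum_distrib_left mult_ac)
  also have "\<dots> = (\<Sum>i<N. \<Sum>\<sigma>\<in>spin_configs N. \<Sum>j<N. M i j * (w \<sigma> * (\<sigma> $ i * \<sigma> $ j)))"
    by (rule sum.swap)
  also have "\<dots> = (\<Sum>i<N. \<Sum>j<N. \<Sum>\<sigma>\<in>spin_configs N. M i j * (w \<sigma> * (\<sigma> $ i * \<sigma> $ j)))"
    by (intro sum.cong refl sum.swap)
  \<comment> \<open>A diagonal term would have expectation M i i instead of M i i * (tanh h)^2; the
    zero diagonal removes the discrepancy.\<close>
  also have "\<dots> = (\<Sum>i<N. \<Sum>j<N. M i j * (tanh h)\<^sup>2)"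
  proof (intro sum.cong refl)
    fix i j assume "i \<in> {..<N}" "j \<in> {..<N}"
    then show "(\<Sum>\<sigma>\<in>spin_configs N. M i j * (w \<sigma> * (\<sigma> $ i * \<sigma> $ j))) = M i j * (tanh h)\<^sup>2"
      using W3[of i j] diag by (cases "i = j") (auto simp flip: sum_distrib_left)
  qed
  finally have q: "(\<Sum>\<sigma>\<in>spin_configs N. w \<sigma> * quad_form N M (($) \<sigma>)) = (tanh h)\<^sup>2 * (\<Sum>i<N. \<Sum>j<N. M i j)"
    by (simp only: sum_distrib_left mult.commute[of "M _ _"])
  have s: "(\<Sum>\<sigma>\<in>spin_configs N. w \<sigma> * (\<Sum>i<N. \<sigma> $ i)) = tanh h * real N"
    unfolding sum_distrib_left by (subst sum.swap) (simp add: W2 mult.commute)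
  have mean: "(\<Sum>\<sigma>\<in>spin_configs N. w \<sigma> * X \<sigma>) = m"
  proof -
    have "(\<Sum>\<sigma>\<in>spin_configs N. w \<sigma> * X \<sigma>) = 1 / 2 * (\<Sum>\<sigma>\<in>spin_configs N. w \<sigma> * quad_form N M (($) \<sigma>))
      + (B - h) * (\<Sum>\<sigma>\<in>spin_configs N. w \<sigma> * (\<Sum>i<N. \<sigma> $ i))"
      unfolding X_def distrib_left sum.distrib mult.left_commute[of "w _"]
      by (simp only: sum_distrib_left[symmetric])
    then show ?thesis unfolding q s m_def by simp
  qed
  have "exp m = exp m * (\<Sum>\<sigma>\<in>spin_configs N. w \<sigma> * (1 + (X \<sigma> - m)))"
    unfolding distrib_left right_diff_distrib sum.distrib sum_subtractf mean
    by (simp add: W1 flip: sum_distrib_right)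
  also have "\<dots> \<le> (\<Sum>\<sigma>\<in>spin_configs N. w \<sigma> * exp (X \<sigma>))"
    unfolding sum_distrib_left
  proof (intro sum_mono)
    fix \<sigma>
    have "w \<sigma> \<ge> 0" using cpos by (simp add: w_def)
    from mult_left_mono[OF exp_ge_tangent this, of m "X \<sigma>"]
    show "exp m * (w \<sigma> * (1 + (X \<sigma> - m))) \<le> w \<sigma> * exp (X \<sigma>)" by (simp add: mult_ac)
  qed
  also have "\<dots> = partition_function N (\<lambda>\<sigma>. 1 / 2 * quad_form N M (($) \<sigma>) + B * spin_sum \<sigma>) / (2 * cosh h) ^ N"
    unfolding partition_function_def sum_divide_distrib
  proof (intro sum.cong refl)
    fix \<sigma> assume "\<sigma> \<in> spin_configs N"
    then have "(\<Sum>i<N. \<sigma> $ i) = spin_sum \<sigma>" by (auto simp: spin_configs_def spin_sum_def)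
    then show "w \<sigma> * exp (X \<sigma>) = exp (1 / 2 * quad_form N M (($) \<sigma>) + B * spin_sum \<sigma>) / (2 * cosh h) ^ N"
      by (simp add: w_def X_def algebra_simps flip: exp_add)
  qed
  finally have "exp m * (2 * cosh h) ^ N \<le> partition_function N (\<lambda>\<sigma>. 1 / 2 * quad_form N M (($) \<sigma>) + B * spin_sum \<sigma>)"
    using cpos by (simp add: field_simps)
  moreover have "(2 * cosh h) ^ N = exp (real N * ln (2 * cosh h))"
    by (simp add: exp_of_nat_mult cosh_real_pos)
  ultimately show ?thesis
    by (simp only: m_def add.assoc exp_add[of "real N * ln (2 * cosh h)"]) (simp only: mult.commute)
qed

section \<open>Comparison with the i.i.d. measure\<close>

definition entries :: "real mat \<Rightarrow> nat \<Rightarrow> nat \<Rightarrow> real" where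
  "entries A i j = A $$ (i, j)"

lemma coupling_matrixD:
  assumes "coupling_matrix N A"
  shows "A \<in> carrier_mat N N" "transpose_mat A = A"
    and "i < N \<Longrightarrow> j < N \<Longrightarrow> entries A i j = entries A j i"
    and "i < N \<Longrightarrow> entries A i i = 0"
    and "row_total A i = (\<Sum>j<N. entries A i j)"
    and "(frobenius_norm A)\<^sup>2 = (\<Sum>i<N. \<Sum>j<N. (entries A i j)\<^sup>2)"
proof -
  show A: "A \<in> carrier_mat N N" "transpose_mat A = A"
    using assms by (auto simp: coupling_matrix_def)
  show "entries A i j = entries A j i" if "i < N" "j < N"
    using A that unfolding entries_def by (metis carrier_matD index_transpose_mat(1))
  show "i < N \<Longrightarrow> entries A i i = 0" using assms by (simp add: coupling_matrix_def entries_def)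
  show "row_total A i = (\<Sum>j<N. entries A i j)" using A by (simp add: row_total_def entries_def)
  show "(frobenius_norm A)\<^sup>2 = (\<Sum>i<N. \<Sum>j<N. (entries A i j)\<^sup>2)"
    using A by (simp add: frobenius_norm_def entries_def sum_nonneg)
qed

lemma gibbs_pmf_cong:
  assumes "\<And>\<sigma>. \<sigma> \<in> spin_configs N \<Longrightarrow> H \<sigma> = H' \<sigma>"
  shows "gibbs_pmf N H = gibbs_pmf N H'"
proof (rule pmf_eqI)
  have "partition_function N H = partition_function N H'"
    unfolding partition_function_def using assms by (intro sum.cong) auto
  then show "pmf (gibbs_pmf N H) \<sigma> = pmf (gibbs_pmf N H') \<sigma>" for \<sigma>
    using assms by (simp add: pmf_gibbs_pmf)
qed

lemma quad_form_scale: "quad_form n (\<lambda>i j. k * M i j) x = k * quad_form n M x"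
  by (simp add: quad_form_def mat_app_def sum_distrib_left mult_ac)

lemma ising_pmf_eq_gibbs:
  assumes "coupling_matrix N A"
  shows "ising_pmf A \<beta> B = gibbs_pmf N
    (\<lambda>\<sigma>. 1 / 2 * quad_form N (\<lambda>i j. \<beta> * entries A i j) (($) \<sigma>) + B * spin_sum \<sigma>)"
proof -
  have A: "A \<in> carrier_mat N N" using coupling_matrixD[OF assms] by simp
  have "scalar_prod \<sigma> (A *\<^sub>v \<sigma>) = quad_form N (entries A) (($) \<sigma>)" if "\<sigma> \<in> spin_configs N" for \<sigma>
    using that A
    by (auto simp: spin_configs_def scalar_prod_def quad_form_def mat_app_def entries_def lessThan_atLeast0
        intro!: sum.cong)
  then show ?thesis
    unfolding ising_pmf_def using A by (auto simp: quad_form_scale intro!: gibbs_pmf_cong)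
qed

lemma mat_app_sq_le:
  "(\<Sum>i<n. (mat_app n M x i)\<^sup>2) \<le> (\<Sum>i<n. \<Sum>j<n. (M i j)\<^sup>2) * sq_norm n x"
proof -
  have "(mat_app n M x i)\<^sup>2 \<le> (\<Sum>j<n. (M i j)\<^sup>2) * sq_norm n x" for i
    unfolding mat_app_def sq_norm_def by (rule Cauchy_Schwarz_ineq_sum)
  then show ?thesis unfolding sum_distrib_right[of "\<lambda>i. \<Sum>j<n. (M i j)\<^sup>2"] by (intro sum_mono)
qed

text \<open>The Frobenius norm dominates the operator norm. Hence a form exceeding the squared
  length somewhere forces the Frobenius norm to be at least 1.\<close>

lemma quad_form_le_frobenius:
  "quad_form n M x \<le> sqrt (\<Sum>i<n. \<Sum>j<n. (M i j)\<^sup>2) * sq_norm n x"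
proof -
  define F where "F = (\<Sum>i<n. \<Sum>j<n. (M i j)\<^sup>2)"
  have "(quad_form n M x)\<^sup>2 \<le> sq_norm n x * (\<Sum>i<n. (mat_app n M x i)\<^sup>2)"
    unfolding quad_form_def sq_norm_def by (rule Cauchy_Schwarz_ineq_sum)
  also have "\<dots> \<le> sq_norm n x * (F * sq_norm n x)"
    unfolding F_def by (intro mult_left_mono mat_app_sq_le sq_norm_nonneg)
  also have "\<dots> = (sqrt F * sq_norm n x)\<^sup>2"
    by (simp add: power_mult_distrib F_def sum_nonneg) (simp add: power2_eq_square)
  finally show ?thesis
    unfolding F_def by (rule power2_le_imp_le) (simp add: sum_nonneg sq_norm_nonneg)
qed

lemma partition_function_iid: "partition_function N (\<lambda>\<sigma>. h * spin_sum \<sigma>) = exp (real N * ln (2 * cosh h))"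
proof -
  have "partition_function N (\<lambda>\<sigma>. h * spin_sum \<sigma>) = (exp (- h) + exp h) ^ N"
    by (simp only: partition_function_def sum_exp_spin_sum)
  also have "exp (- h) + exp h = 2 * cosh h" by (simp add: cosh_field_def)
  also have "(2 * cosh h) ^ N = exp (real N * ln (2 * cosh h))"
    by (simp add: exp_of_nat_mult cosh_real_pos)
  finally show ?thesis .
qed

lemma abs_spin_sum_le:
  assumes "\<sigma> \<in> spin_configs N"
  shows "\<bar>spin_sum \<sigma>\<bar> \<le> real N"
proof -
  have "\<bar>spin_sum \<sigma>\<bar> \<le> (\<Sum>i<N. \<bar>\<sigma> $ i\<bar>)"
    using assms sum_abs[of "\<lambda>i. \<sigma> $ i" "{..<N}"] by (auto simp: spin_sum_def spin_configs_def)
  also have "\<dots> \<le> (\<Sum>i<N. 1)"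
    using assms by (intro sum_mono) (auto simp: spin_configs_def)
  finally show ?thesis by simp
qed

text \<open>At h = \<beta> * t + B with tanh h = t one has \<beta> * tanh h / h = \<beta> * t /
  (\<beta> * t + B), which is below 1 because t and B have the same sign. For B = 0 the value is
  \<beta> itself.\<close>

lemma mf_root_Theta1:
  assumes "(\<beta>, B) \<in> Theta1"
  defines "t \<equiv> mf_root \<beta> B"
  shows "\<beta> > 0" "tanh (\<beta> * t + B) = t" "\<beta> * spin_variance (\<beta> * t + B) < 1"
proof -
  consider "0 < \<beta>" "\<beta> < 1" "B = 0" | "(\<beta>, B) \<in> Theta12"
    using assms by (auto simp: Theta1_def Theta11_def)
  then have "\<beta> > 0 \<and> tanh (\<beta> * t + B) = t \<and> \<beta> * spin_variance (\<beta> * t + B) < 1"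
  proof cases
    case 1
    then show ?thesis by (simp add: t_def mf_root_def spin_variance_def)
  next
    case 2
    then have \<beta>: "\<beta> > 0" "B \<noteq> 0" by (auto simp: Theta12_def)
    note t = mf_root_Theta12[OF 2, folded t_def]
    have "\<beta> * t / (\<beta> * t + B) < 1"
    proof (cases "B > 0")
      case True
      then have "t > 0" using t(2) by (simp add: sgn_1_pos)
      then have "\<beta> * t + B > 0" using \<beta> True by (simp add: add_pos_pos)
      then show ?thesis using True by (simp add: divide_less_eq)
    next
      case False
      then have "B < 0" using \<beta> by simp
      then have "t < 0" using t(2) by (simp add: sgn_1_neg)
      then have "\<beta> * t + B < 0" using \<beta> \<open>B < 0\<close> by (simp add: add_neg_neg mult_pos_neg)
      then show ?thesis using \<open>B < 0\<close> by (simp add: divide_less_eq)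
    qed
    moreover have "\<beta> * spin_variance (\<beta> * t + B) \<le> \<beta> * t / (\<beta> * t + B) \<or> \<beta> * t + B = 0"
      using t(1) by (auto simp: spin_variance_def)
    moreover have "\<beta> * t + B \<noteq> 0" using t \<beta> by (metis sgn_zero_iff tanh_0)
    ultimately show ?thesis using \<beta> t(1) by auto
  qed
  then show "\<beta> > 0" "tanh (\<beta> * t + B) = t" "\<beta> * spin_variance (\<beta> * t + B) < 1" by auto
qed

theorem ising_le_iid:
  fixes A :: "nat \<Rightarrow> real mat"
  assumes coupling: "\<And>N. N \<ge> 2 \<Longrightarrow> coupling_matrix N (A N)"
    and top: "(\<lambda>N. nth_eigenvalue (A N) 1) \<longlonglongrightarrow> 1"
    and events: "\<And>N. N \<ge> 2 \<Longrightarrow> E N \<subseteq> spin_configs N"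
    and \<theta>: "(\<beta>, B) \<in> Theta1"
  shows "\<exists>c>0. \<exists>C. \<forall>N\<ge>2.
    log_ext (measure_pmf.prob (ising_pmf (A N) \<beta> B) (E N))
      \<le> ereal c * log_ext (measure_pmf.prob (iid_pmf N \<beta> B) (E N))
        + ereal (C * ((frobenius_norm (A N))\<^sup>2
            + (mf_root \<beta> B)\<^sup>2 * (\<Sum>i<N. (row_total (A N) i - 1)\<^sup>2)))"
proof -
  define t where "t = mf_root \<beta> B"
  define h where "h = \<beta> * t + B"
  define K where "K = spin_variance h"
  note mf = mf_root_Theta1[OF \<theta>, folded t_def, folded h_def, folded K_def]
  \<comment> \<open>A quarter of the distance to criticality pays for two factors 1 + \<eta>, one
    from p and one from the top eigenvalue, and still leaves the margin \<eta>.\<close>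
  define \<eta> where "\<eta> = (1 - \<beta> * K) / 4"
  define p where "p = 1 + \<eta>"
  have K: "K > 0" "K \<le> 1" by (simp_all add: K_def spin_variance_pos spin_variance_le_1)
  have \<eta>: "0 < \<eta>" "\<eta> < 1" using mf(3) mult_pos_pos[OF mf(1) K(1)] by (auto simp: \<eta>_def)
  have p: "p > 1" using \<eta> by (simp add: p_def)
  have sub: "K * (p * \<beta>) * (1 + \<eta>) \<le> 1 - \<eta>"
  proof -
    have "\<eta>\<^sup>2 \<le> \<eta>" using \<eta> by (simp add: power2_eq_square mult_left_le_one_le)
    then have "(\<beta> * K) * (1 + \<eta>)\<^sup>2 \<le> (\<beta> * K) * (1 + 3 * \<eta>)"
      using mf K by (intro mult_left_mono) (auto simp: power2_sum)
    also have "\<dots> \<le> \<beta> * K + 3 * \<eta>"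
      using mf(3) \<eta> mult_right_mono[of "\<beta> * K" 1 "3 * \<eta>"] by (simp add: algebra_simps)
    also have "\<dots> = 1 - \<eta>" by (simp add: \<eta>_def field_simps)
    finally show ?thesis by (simp add: p_def power2_eq_square mult_ac)
  qed
  have "\<forall>\<^sub>F N in sequentially. nth_eigenvalue (A N) 1 < 1 + \<eta>"
    using top \<eta> by (intro order_tendstoD) auto
  then obtain N0 where N0: "\<And>N. N \<ge> N0 \<Longrightarrow> nth_eigenvalue (A N) 1 < 1 + \<eta>"
    by (auto simp: eventually_sequentially)
  have c0: "ln (2 * cosh h) \<ge> 0"
    using cosh_real_ge_1[of h] by (intro ln_ge_zero) linarith
  \<comment> \<open>\<open>C1\<close> comes from the Gaussian comparison; \<open>C2\<close> covers
    the finitely many N below \<open>N0\<close>, where the top eigenvalue may still be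
    large.\<close>
  define C1 where "C1 = p * \<beta>\<^sup>2 / (2 * \<eta>)"
  define C2 where "C2 = real N0 * (ln (2 * cosh h) + \<bar>h\<bar>)"
  have C: "C1 \<ge> 0" "C2 \<ge> 0" using p \<eta> c0 by (auto simp: C1_def C2_def)
  show ?thesis
  proof (rule exI[of _ "1 - 1 / p"], intro conjI exI[of _ "C1 + C2"] allI impI)
    show "1 - 1 / p > 0" using p by simp
    fix N :: nat assume N: "2 \<le> N"
    define a where "a = entries (A N)"
    note coup = coupling_matrixD[OF coupling[OF N], folded a_def]
    define F where "F = (frobenius_norm (A N))\<^sup>2"
    define r2 where "r2 = (\<Sum>i<N. (row_total (A N) i - 1)\<^sup>2)"
    have nonneg: "F \<ge> 0" "r2 \<ge> 0" by (auto simp: F_def r2_def sum_nonneg)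
    define H1 where "H1 = (\<lambda>\<sigma>. 1 / 2 * quad_form N (\<lambda>i j. \<beta> * a i j) (($) \<sigma>) + B * spin_sum \<sigma>)"
    define H0 where "H0 = (\<lambda>\<sigma>. h * spin_sum \<sigma>)"
    have V: "partition_function N H0 \<le> exp (real N * ln (2 * cosh h))"
      unfolding H0_def partition_function_iid ..
    have "log_ext (measure_pmf.prob (gibbs_pmf N H1) (E N))
      \<le> ereal (1 - 1 / p) * log_ext (measure_pmf.prob (gibbs_pmf N H0) (E N)) + ereal ((C1 + C2) * (F + t\<^sup>2 * r2))"
    proof (cases "\<forall>x. quad_form N a x \<le> (1 + \<eta>) * sq_norm N x")
      case True
      define c where "c = ln (2 * cosh h)"
      define R where "R = (\<Sum>i<N. \<Sum>j<N. a i j)"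
      have row: "p * \<beta> * (\<Sum>j<N. a i j) = (\<Sum>j<N. p * \<beta> * a i j)" for i by (simp add: sum_distrib_left)
      have up: "K * quad_form N (\<lambda>i j. p * \<beta> * a i j) x \<le> (1 - \<eta>) * sq_norm N x" for x
      proof -
        have "K * quad_form N (\<lambda>i j. p * \<beta> * a i j) x = K * (p * \<beta>) * quad_form N a x"
          by (simp add: quad_form_scale)
        also have "\<dots> \<le> K * (p * \<beta>) * ((1 + \<eta>) * sq_norm N x)"
          using True K p mf by (intro mult_left_mono) auto
        also have "\<dots> = (K * (p * \<beta>) * (1 + \<eta>)) * sq_norm N x" by simp
        also have "\<dots> \<le> (1 - \<eta>) * sq_norm N x" by (intro mult_right_mono sub sq_norm_nonneg)
        finally show ?thesis .
      qed
      \<comment> \<open>The linear coefficient p * B + (1 - p) * h equals h - p * \<beta> * t, which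
        fixes the offset in the comparison.\<close>
      have "(\<Sum>\<sigma>\<in>spin_configs N. exp (p * H1 \<sigma> + (1 - p) * H0 \<sigma>)) =
        (\<Sum>\<sigma>\<in>spin_configs N. exp ((h + (- (p * \<beta> * t))) * spin_sum \<sigma>
          + 1 / 2 * quad_form N (\<lambda>i j. p * \<beta> * a i j) (($) \<sigma>)))"
        by (intro sum.cong refl arg_cong[where f = exp])
           (simp add: H1_def H0_def quad_form_scale h_def algebra_simps)
      also have "\<dots> \<le> exp (real N * c + t\<^sup>2 / 2 * (\<Sum>i<N. \<Sum>j<N. p * \<beta> * a i j) + (- (p * \<beta> * t)) * t * real N
          + K\<^sup>2 / (2 * \<eta>) * (\<Sum>i<N. \<Sum>j<N. (p * \<beta> * a i j)\<^sup>2)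
          + K / (2 * \<eta>) * (\<Sum>i<N. (t * (\<Sum>j<N. p * \<beta> * a i j) + (- (p * \<beta> * t)))\<^sup>2))"
      proof (rule gaussian_comparison[OF _ K(1) \<eta>(1) _ _ up])
        show "spin_bound h c t K" using spin_bound_exact[of h] by (simp add: c_def K_def mf(2))
      qed (use coup(3,4) in auto)
      also have "(\<Sum>i<N. \<Sum>j<N. p * \<beta> * a i j) = p * \<beta> * R"
        by (simp add: R_def sum_distrib_left)
      also have "(\<Sum>i<N. \<Sum>j<N. (p * \<beta> * a i j)\<^sup>2) = (p * \<beta>)\<^sup>2 * F"
        unfolding F_def coup(6) power_mult_distrib by (simp add: sum_distrib_left)
      \<comment> \<open>The offset cancels the mean field of a row of total 1, so each row
        contributes t * (R_i - 1); this is the source of the factor t^2 in the error.\<close>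
      also have "(\<Sum>i<N. (t * (\<Sum>j<N. p * \<beta> * a i j) + (- (p * \<beta> * t)))\<^sup>2) = (p * \<beta>)\<^sup>2 * (t\<^sup>2 * r2)"
        unfolding r2_def coup(5) row[symmetric]
        unfolding sum_distrib_left[of "(p * \<beta>)\<^sup>2"] sum_distrib_left[of "t\<^sup>2"]
        by (intro sum.cong refl) (simp add: power2_eq_square algebra_simps)
      finally have U: "(\<Sum>\<sigma>\<in>spin_configs N. exp (p * H1 \<sigma> + (1 - p) * H0 \<sigma>)) \<le>
        exp (real N * c + t\<^sup>2 / 2 * (p * \<beta> * R) + (- (p * \<beta> * t)) * t * real N
          + K\<^sup>2 / (2 * \<eta>) * ((p * \<beta>)\<^sup>2 * F) + K / (2 * \<eta>) * ((p * \<beta>)\<^sup>2 * (t\<^sup>2 * r2)))" .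
      have L: "exp (real N * c + t\<^sup>2 / 2 * (\<beta> * R) + (B - h) * t * real N) \<le> partition_function N H1"
        using partition_function_ge_mean_field[of N "\<lambda>i j. \<beta> * a i j" h B] coup(4)
        by (simp add: mf(2) c_def H1_def R_def sum_distrib_left)
      show ?thesis
      proof (rule gibbs_change_of_measure[OF events[OF N] p U L V, folded c_def])
        let ?l = "(real N * c + t\<^sup>2 / 2 * (p * \<beta> * R) + - (p * \<beta> * t) * t * real N
            + K\<^sup>2 / (2 * \<eta>) * ((p * \<beta>)\<^sup>2 * F) + K / (2 * \<eta>) * ((p * \<beta>)\<^sup>2 * (t\<^sup>2 * r2))) / p
            - (real N * c + t\<^sup>2 / 2 * (\<beta> * R) + (B - h) * t * real N) + (1 - 1 / p) * (real N * c)"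
        \<comment> \<open>Apart from its last summand, p * Q is p times the mean-field energy, so
          division by p reproduces the exponent of the lower bound and these terms cancel.\<close>
        define Q where "Q = t\<^sup>2 / 2 * (\<beta> * R) - \<beta> * t * t * real N + C1 * (K\<^sup>2 * F + K * (t\<^sup>2 * r2))"
        have "real N * c + t\<^sup>2 / 2 * (p * \<beta> * R) + - (p * \<beta> * t) * t * real N
            + K\<^sup>2 / (2 * \<eta>) * ((p * \<beta>)\<^sup>2 * F) + K / (2 * \<eta>) * ((p * \<beta>)\<^sup>2 * (t\<^sup>2 * r2)) = real N * c + p * Q"
          by (simp add: Q_def C1_def power2_eq_square algebra_simps)
        moreover have "(real N * c + p * Q) / p = real N * c / p + Q" using p by (simp add: add_divide_distrib)
        ultimately have "?l = C1 * (K\<^sup>2 * F + K * (t\<^sup>2 * r2))"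
          by (simp add: Q_def h_def algebra_simps power2_eq_square)
        also have "\<dots> \<le> C1 * (1 * F + 1 * (t\<^sup>2 * r2))"
          using K C nonneg by (intro mult_left_mono add_mono mult_right_mono) (auto simp: power_le_one)
        also have "\<dots> \<le> (C1 + C2) * (F + t\<^sup>2 * r2)"
          using C nonneg by (simp add: mult_right_mono)
        finally show "?l \<le> (C1 + C2) * (F + t\<^sup>2 * r2)" .
      qed
    next
      case False
      obtain x where x: "(1 + \<eta>) * sq_norm N x < quad_form N a x" using False by (auto simp: not_le)
      also have "\<dots> \<le> nth_eigenvalue (A N) 1 * sq_norm N x"
        using quad_form_le_top_eigenvalue[OF coup(1,2), of x] by (simp add: a_def entries_def[abs_def])
      finally have "1 + \<eta> < nth_eigenvalue (A N) 1"
        using sq_norm_nonneg[of N x] by (rule mult_right_less_imp_less)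
      then have NN0: "N < N0" using N0[of N] by (cases "N < N0") auto
      \<comment> \<open>The vector x on which the form exceeds 1 + \<eta> is incompatible with a
        small Frobenius norm, so the error term cannot be small for this N.\<close>
      have "F \<ge> 1"
      proof (rule ccontr)
        assume "\<not> F \<ge> 1"
        then have "sqrt F \<le> 1 + \<eta>" using \<eta> real_sqrt_le_1_iff[of F] by linarith
        from mult_right_mono[OF this sq_norm_nonneg[of N x]] show False
          using quad_form_le_frobenius[of N a x] x unfolding F_def coup(6) by linarith
      qed
      show ?thesis
      proof (rule gibbs_trivial_bound[OF events[OF N] _ _ V])
        show "1 - 1 / p > 0" using p by simp
        show "- \<bar>h\<bar> * real N \<le> H0 \<sigma>" if "\<sigma> \<in> spin_configs N" for \<sigma>
        proof -
          have "\<bar>h * spin_sum \<sigma>\<bar> \<le> \<bar>h\<bar> * real N"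
            unfolding abs_mult using abs_spin_sum_le[OF that] by (intro mult_left_mono) auto
          then show ?thesis by (simp add: H0_def)
        qed
        have "(1 - 1 / p) * (real N * ln (2 * cosh h) - - \<bar>h\<bar> * real N) \<le> 1 * (real N * (ln (2 * cosh h) + \<bar>h\<bar>))"
          using p c0 by (intro mult_mono) (auto simp: algebra_simps)
        also have "\<dots> \<le> C2" unfolding C2_def using NN0 c0 by (simp add: mult_right_mono)
        also have "\<dots> \<le> (C1 + C2) * 1" using C by simp
        also have "\<dots> \<le> (C1 + C2) * (F + t\<^sup>2 * r2)"
          using C nonneg \<open>F \<ge> 1\<close> by (intro mult_left_mono) (auto simp: add_increasing2)
        finally show "(1 - 1 / p) * (real N * ln (2 * cosh h) - - \<bar>h\<bar> * real N) \<le> (C1 + C2) * (F + t\<^sup>2 * r2)" .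
      qed
    qed
    then show "log_ext (measure_pmf.prob (ising_pmf (A N) \<beta> B) (E N))
      \<le> ereal (1 - 1 / p) * log_ext (measure_pmf.prob (iid_pmf N \<beta> B) (E N))
        + ereal ((C1 + C2) * ((frobenius_norm (A N))\<^sup>2
            + (mf_root \<beta> B)\<^sup>2 * (\<Sum>i<N. (row_total (A N) i - 1)\<^sup>2)))"
      unfolding ising_pmf_eq_gibbs[OF coupling[OF N]] iid_pmf_eq_gibbs
      by (simp add: H1_def H0_def a_def h_def t_def F_def r2_def)
  qed
qed

section \<open>The Curie--Weiss potential\<close>

lemma DERIV_tanh_comp:
  assumes "(f has_real_derivative f') (at x)"
  shows "((\<lambda>x. tanh (f x)) has_real_derivative (1 - (tanh (f x))\<^sup>2) * f') (at x)"
  using assms by (auto intro!: derivative_eq_intros simp: cosh_real_nonzero)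

text \<open>On the half-line the derivative x - tanh x of the gap is at least (tanh x)^3 / 3, which
  exceeds the derivative of (tanh x)^4 / 12. The quartic is in tanh y because the errors to be
  absorbed at field y are powers of the mean tanh y.\<close>

lemma ln_cosh_upper_quartic:
  fixes y :: real
  shows
  "ln (cosh y) \<le> y\<^sup>2 / 2 - (tanh y) ^ 4 / 12"
proof -
  have cubic: "tanh x + (tanh x) ^ 3 / 3 \<le> x" if "x \<ge> 0" for x :: real
  proof -
    define g where "g = (\<lambda>x :: real. x - tanh x - (tanh x) ^ 3 / 3)"
    have "g 0 \<le> g x"
    proof (rule DERIV_nonneg_imp_nondecreasing[OF that])
      fix z :: real
      have "(g has_real_derivative 1 - (1 - (tanh z)\<^sup>2) * 1 - (3 * (1 - (tanh z)\<^sup>2) * 1 * (tanh z)\<^sup>2) / 3) (at z)"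
        unfolding g_def by (auto intro!: derivative_eq_intros DERIV_tanh_comp)
      moreover have "1 - (1 - (tanh z)\<^sup>2) * 1 - (3 * (1 - (tanh z)\<^sup>2) * 1 * (tanh z)\<^sup>2) / 3 = ((tanh z)\<^sup>2)\<^sup>2"
        by (simp add: power2_eq_square field_simps)
      then have "0 \<le> 1 - (1 - (tanh z)\<^sup>2) * 1 - (3 * (1 - (tanh z)\<^sup>2) * 1 * (tanh z)\<^sup>2) / 3"
        by (simp only: zero_le_power2)
      ultimately show "\<exists>y. (g has_real_derivative y) (at z) \<and> 0 \<le> y" by blast
    qed
    then show ?thesis by (simp add: g_def)
  qed
  define f where "f = (\<lambda>y :: real. y\<^sup>2 / 2 - ln (cosh y) - (tanh y) ^ 4 / 12)"
  have "f 0 \<le> f \<bar>y\<bar>"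
  proof (rule DERIV_nonneg_imp_nondecreasing[of 0 "\<bar>y\<bar>" f])
    fix z :: real assume z: "0 \<le> z"
    have "(1 - (tanh z)\<^sup>2) * (tanh z) ^ 3 \<le> 1 * (tanh z) ^ 3"
      using z by (intro mult_right_mono) auto
    moreover have "4 * (1 - (tanh z)\<^sup>2) * 1 * (tanh z) ^ 3 / 12 = (1 - (tanh z)\<^sup>2) * (tanh z) ^ 3 / 3"
      by simp
    ultimately have "0 \<le> z - tanh z - (4 * (1 - (tanh z)\<^sup>2) * 1 * (tanh z) ^ 3) / 12"
      using cubic[OF z] by linarith
    moreover have "(f has_real_derivative z - tanh z - (4 * (1 - (tanh z)\<^sup>2) * 1 * (tanh z) ^ 3) / 12) (at z)"
      unfolding f_def
      by (auto intro!: derivative_eq_intros DERIV_tanh_comp simp: cosh_real_pos) (simp add: tanh_def)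
    ultimately show "\<exists>y. (f has_real_derivative y) (at z) \<and> 0 \<le> y" by blast
  qed simp
  then have "0 \<le> f y" by (cases "y \<ge> 0") (simp_all add: f_def)
  then show ?thesis by (simp add: f_def)
qed

lemma abs_tanh_less_1: "\<bar>tanh (x :: real)\<bar> < 1"
  using tanh_real_lt_1[of x] tanh_real_gt_neg1[of x] by (simp add: abs_less_iff)

lemma tanh_lipschitz: "\<bar>tanh a - tanh b\<bar> \<le> \<bar>a - (b :: real)\<bar>"
proof -
  have *: "tanh b - tanh a \<le> b - a" if "a \<le> b" for a b :: real
  proof -
    have "a - tanh a \<le> b - tanh b"
    proof (rule DERIV_nonneg_imp_nondecreasing[OF that, of "\<lambda>x. x - tanh x"])
      fix z :: real
      have "((\<lambda>x. x - tanh x) has_real_derivative (tanh z)\<^sup>2) (at z)"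
        by (auto intro!: derivative_eq_intros simp: cosh_real_nonzero)
      then show "\<exists>y. ((\<lambda>x. x - tanh x) has_real_derivative y) (at z) \<and> 0 \<le> y" by force
    qed
    then show ?thesis by simp
  qed
  show ?thesis
    using *[of a b] *[of b a] by (cases "a \<le> b") (auto simp: abs_if)
qed

lemma tanh_sq_diff_le: "\<bar>(tanh a)\<^sup>2 - (tanh b)\<^sup>2\<bar> \<le> 2 * \<bar>\<bar>a\<bar> - \<bar>b :: real\<bar>\<bar>"
proof -
  have sq: "(tanh x)\<^sup>2 = (tanh \<bar>x\<bar>)\<^sup>2" for x :: real by (simp add: abs_if)
  have "\<bar>(tanh a)\<^sup>2 - (tanh b)\<^sup>2\<bar> = \<bar>tanh \<bar>a\<bar> + tanh \<bar>b\<bar>\<bar> * \<bar>tanh \<bar>a\<bar> - tanh \<bar>b\<bar>\<bar>"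
    unfolding sq[of a] sq[of b] abs_mult[symmetric] by (simp only: power2_eq_square square_diff_square_factored)
  also have "\<dots> \<le> 2 * \<bar>\<bar>a\<bar> - \<bar>b\<bar>\<bar>"
  proof (intro mult_mono tanh_lipschitz)
    show "\<bar>tanh \<bar>a\<bar> + tanh \<bar>b\<bar>\<bar> \<le> 2"
      using tanh_real_lt_1[of "\<bar>a\<bar>"] tanh_real_lt_1[of "\<bar>b\<bar>"] by simp
  qed auto
  finally show ?thesis .
qed

text \<open>tanh (\<beta> * x) starts with slope \<beta> > 1 and stays below 1, so it crosses the
  diagonal. The last inequality says that the crossing is transversal, that is, that the well of the
  potential is nondegenerate.\<close>

lemma curie_weiss_root:
  fixes \<beta> :: real
  assumes "\<beta> > 1"
  obtains t where "0 < t" "t < 1" "tanh (\<beta> * t) = t" "\<beta> * (1 - t\<^sup>2) < 1"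
proof -
  define f where "f = (\<lambda>x. tanh (\<beta> * x) - x)"
  have f': "(f has_real_derivative (1 - (tanh (\<beta> * x))\<^sup>2) * \<beta> - 1) (at x)" for x
    unfolding f_def by (auto intro!: derivative_eq_intros DERIV_tanh_comp)
  have cont: "continuous_on S f" for S
    by (rule DERIV_continuous_on[OF has_field_derivative_at_within[OF f']])
  have "\<exists>d>0. \<forall>h>0. h < d \<longrightarrow> f 0 < f (0 + h)"
    using assms f'[of 0] by (intro DERIV_pos_inc_right[of f "\<beta> - 1" 0]) auto
  then obtain d where d: "d > 0" "\<And>h. 0 < h \<Longrightarrow> h < d \<Longrightarrow> 0 < f h"
    by (auto simp: f_def)
  define x0 where "x0 = min (d / 2) (1 / 2)"
  have x0: "0 < x0" "x0 \<le> 1" "0 < f x0" using d by (auto simp: x0_def)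
  have "f 1 \<le> 0" using tanh_real_lt_1[of "\<beta> * 1"] by (simp add: f_def)
  then have "\<exists>t\<ge>x0. t \<le> 1 \<and> f t = 0"
    using x0 cont by (intro IVT2') auto
  then obtain t where t: "x0 \<le> t" "t \<le> 1" "f t = 0" by blast
  have tt: "tanh (\<beta> * t) = t" using t by (simp add: f_def)
  have t0: "0 < t" using x0 t by simp
  have t1: "t < 1" using tanh_real_lt_1[of "\<beta> * t"] tt by simp
  \<comment> \<open>Positivity of g is x * (1 - (tanh x)^2) < tanh x for x > 0; at x = \<beta> * t
    it reads \<beta> * (1 - t^2) < 1.\<close>
  define g where "g = (\<lambda>x :: real. tanh x - x * (1 - (tanh x)\<^sup>2))"
  have g': "(g has_real_derivative 2 * x * tanh x * (1 - (tanh x)\<^sup>2)) (at x)" for x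
  proof -
    have T: "(tanh has_real_derivative 1 - (tanh x)\<^sup>2) (at x)"
      using DERIV_tanh_comp[OF DERIV_ident] by simp
    show ?thesis
      using DERIV_diff[OF T DERIV_mult[OF DERIV_ident DERIV_diff[OF DERIV_const[of 1] DERIV_power[OF T, of 2]]]]
      unfolding g_def by (rule DERIV_cong) (simp add: algebra_simps)
  qed
  have "g 0 < g (\<beta> * t)"
  proof (rule DERIV_pos_imp_increasing_open[of 0 "\<beta> * t" g])
    show "0 < \<beta> * t" using t0 assms by simp
    fix x :: real assume "0 < x"
    moreover have "(tanh x)\<^sup>2 < 1" using abs_tanh_less_1[of x] by (simp add: abs_square_less_1)
    ultimately have "0 < 2 * x * tanh x * (1 - (tanh x)\<^sup>2)" by simp
    then show "\<exists>y. (g has_real_derivative y) (at x) \<and> 0 < y" using g' by blast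
  next
    show "continuous_on {0..\<beta> * t} g"
      by (rule DERIV_continuous_on[OF has_field_derivative_at_within[OF g']])
  qed
  then have "\<beta> * t * (1 - t\<^sup>2) < t" by (simp add: g_def tt)
  then have "t * (\<beta> * (1 - t\<^sup>2)) < t * 1" by (simp add: mult_ac)
  then have "\<beta> * (1 - t\<^sup>2) < 1" using t0 by (simp only: mult_less_cancel_left_pos)
  with t0 t1 tt show ?thesis by (rule that)
qed

text \<open>The second derivative \<beta> * (1 - \<beta> * (1 - (tanh (\<beta> * y))^2)) increases
  on the half-line, so from t' on it is at least \<beta> * k; and t is a critical point.\<close>

lemma curie_weiss_potential:
  fixes \<beta> t t' k :: real
  assumes \<beta>: "\<beta> > 0" and t: "0 < t'" "t' \<le> t" "tanh (\<beta> * t) = t"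
    and k: "k = 1 - \<beta> * (1 - (tanh (\<beta> * t'))\<^sup>2)" and y: "t' \<le> y"
  defines "\<psi> \<equiv> \<lambda>y. \<beta> * y\<^sup>2 / 2 - ln (cosh (\<beta> * y))"
  shows "\<psi> t + \<beta> * k / 2 * (y - t)\<^sup>2 \<le> \<psi> y"
proof -
  \<comment> \<open>\<beta> * D is the derivative of \<psi> minus the comparison parabola. It is
    nondecreasing from t' on and vanishes at t, so the difference is minimal at t.\<close>
  define D where "D = (\<lambda>y. y - tanh (\<beta> * y) - k * (y - t))"
  have D': "(D has_real_derivative \<beta> * ((tanh (\<beta> * y))\<^sup>2 - (tanh (\<beta> * t'))\<^sup>2)) (at y)" for y
    unfolding D_def by (auto intro!: derivative_eq_intros DERIV_tanh_comp simp: k algebra_simps)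
  have Dmono: "D x \<le> D z" if "t' \<le> x" "x \<le> z" for x z
  proof (rule DERIV_nonneg_imp_nondecreasing[OF that(2)])
    fix w assume w: "x \<le> w"
    have "(tanh (\<beta> * t'))\<^sup>2 \<le> (tanh (\<beta> * w))\<^sup>2"
      using w that t(1) \<beta> by (intro power_mono) auto
    then have "0 \<le> \<beta> * ((tanh (\<beta> * w))\<^sup>2 - (tanh (\<beta> * t'))\<^sup>2)" using \<beta> by simp
    then show "\<exists>y. (D has_real_derivative y) (at w) \<and> 0 \<le> y" using D' by blast
  qed
  have Dt: "D t = 0" by (simp add: D_def t)
  define G where "G = (\<lambda>y. \<psi> y - \<beta> * k / 2 * (y - t)\<^sup>2)"
  have G': "(G has_real_derivative \<beta> * D y) (at y)" for y
  proof -
    have "((\<lambda>y. ln (cosh (\<beta> * y))) has_real_derivative tanh (\<beta> * y) * \<beta>) (at y)"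
      by (auto intro!: derivative_eq_intros simp: cosh_real_pos tanh_def)
    note 1 = DERIV_diff[OF DERIV_cdivide[OF DERIV_cmult[OF DERIV_power[OF DERIV_ident]]] this]
    have 2: "((\<lambda>y. \<beta> * k / 2 * (y - t)\<^sup>2) has_real_derivative \<beta> * k * (y - t)) (at y)"
      by (auto intro!: derivative_eq_intros)
    show ?thesis
      using DERIV_diff[OF 1[of \<beta> 2 2] 2] unfolding G_def \<psi>_def D_def
      by (rule DERIV_cong) (simp add: algebra_simps)
  qed
  have "G t \<le> G y"
  proof (cases "t \<le> y")
    case True
    show ?thesis
    proof (rule DERIV_nonneg_imp_nondecreasing[OF True])
      fix w assume "t \<le> w"
      then have "0 \<le> \<beta> * D w" using Dmono[of t w] Dt t(2) \<beta> by simp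
      then show "\<exists>y. (G has_real_derivative y) (at w) \<and> 0 \<le> y" using G' by blast
    qed
  next
    case False
    then have "y \<le> t" by simp
    then show ?thesis
    proof (rule DERIV_nonpos_imp_nonincreasing)
      fix w assume "y \<le> w" "w \<le> t"
      then have "\<beta> * D w \<le> 0" using Dmono[of w t] Dt y \<beta> by (simp add: mult_nonneg_nonpos)
      then show "\<exists>y. (G has_real_derivative y) (at w) \<and> y \<le> 0" using G' by blast
    qed
  qed
  then show ?thesis by (simp add: G_def)
qed

text \<open>The tangent parabola is taken at \<open>\<beta> y\<close> itself, except for small \<open>\<bar>y\<bar>\<close>, where \<open>\<beta>\<close> times its curvature would
  exceed \<open>1 + \<eta>\<close>; there the parabola tangent at \<open>\<beta> t'\<close> is used, for a \<open>t'\<close> just below \<open>t\<close>.\<close>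
lemma low_temperature_spin_bounds:
  fixes \<beta> \<eta> :: real
  assumes \<beta>: "\<beta> > 1" and \<eta>: "\<eta> > 0"
  obtains t \<kappa> L where "0 < t" "tanh (\<beta> * t) = t" "\<kappa> > 0" "L \<ge> 0"
    "\<And>y. \<exists>c \<mu> K. spin_bound (\<beta> * y) c \<mu> K \<and> 0 < K \<and> K \<le> 1 \<and> \<bar>\<mu>\<bar> \<le> 1 \<and> \<beta> * K \<le> 1 + \<eta> \<and>
      c - \<beta> * y\<^sup>2 / 2 \<le> ln (2 * cosh (\<beta> * t)) - \<beta> * t\<^sup>2 / 2 - \<kappa> * (\<bar>y\<bar> - t)\<^sup>2 \<and>
      \<bar>\<mu>\<^sup>2 - t\<^sup>2\<bar> \<le> L * \<bar>\<bar>y\<bar> - t\<bar>"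
proof -
  obtain t where t: "0 < t" "t < 1" "tanh (\<beta> * t) = t" "\<beta> * (1 - t\<^sup>2) < 1"
    using curie_weiss_root[OF \<beta>] by blast
  have sv: "\<beta> * spin_variance (\<beta> * x) = tanh (\<beta> * x) / x" if "x > 0" for x
    using that \<beta> by (simp add: spin_variance_def)
  \<comment> \<open>At x = t the first quantity equals 1 and \<beta> * (1 - (tanh (\<beta> * x))^2)
    is below 1. By continuity a point t' slightly below t keeps the first under 1 + \<eta> and the
    second under 1.\<close>
  have "((\<lambda>x. tanh (\<beta> * x) / x) \<longlongrightarrow> tanh (\<beta> * t) / t) (at_left t)"
    using t by (intro tendsto_intros) (auto simp: cosh_real_nonzero)
  then have e1: "\<forall>\<^sub>F x in at_left t. tanh (\<beta> * x) / x < 1 + \<eta>"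
    using t \<eta> by (intro order_tendstoD) auto
  have lim2: "((\<lambda>x. \<beta> * (1 - (tanh (\<beta> * x))\<^sup>2)) \<longlongrightarrow> \<beta> * (1 - (tanh (\<beta> * t))\<^sup>2)) (at_left t)"
    by (intro tendsto_intros) (auto simp: cosh_real_nonzero)
  have e2: "\<forall>\<^sub>F x in at_left t. \<beta> * (1 - (tanh (\<beta> * x))\<^sup>2) < 1"
    by (rule order_tendstoD(2)[OF lim2]) (simp add: t)
  have e3: "\<forall>\<^sub>F x in at_left t. 0 < x \<and> x < t"
    using t by (intro eventually_at_leftI[of 0]) auto
  obtain t' where t': "tanh (\<beta> * t') / t' < 1 + \<eta>" "\<beta> * (1 - (tanh (\<beta> * t'))\<^sup>2) < 1" "0 < t'" "t' < t"
    using eventually_happens'[OF trivial_limit_at_left_real eventually_conj[OF e1 eventually_conj[OF e2 e3]]]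
    by blast
  define \<psi> where "\<psi> = (\<lambda>y. \<beta> * y\<^sup>2 / 2 - ln (cosh (\<beta> * y)))"
  define k where "k = 1 - \<beta> * (1 - (tanh (\<beta> * t'))\<^sup>2)"
  \<comment> \<open>Scaled so that \<kappa> * t^2 is the depth gained between t' and t: for
    \<bar>y\<bar> below t' the distance to t is at most t, and this depth suffices.\<close>
  define \<kappa> where "\<kappa> = \<beta> * k / 2 * (t' - t)\<^sup>2 / t\<^sup>2"
  \<comment> \<open>2 * \<beta> is the Lipschitz bound for (tanh (\<beta> * y))^2; the other summand
    serves \<bar>y\<bar> below t', where the distance to t is at least t - t' and the left side at
    most 1.\<close>
  define L where "L = 2 * \<beta> + 1 / (t - t')"
  define \<Phi> where "\<Phi> = ln (2 * cosh (\<beta> * t)) - \<beta> * t\<^sup>2 / 2"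
  have k: "k > 0" using t' by (simp add: k_def)
  have \<kappa>: "\<kappa> > 0" using k \<beta> t' t by (simp add: \<kappa>_def)
  have \<kappa>_le: "\<kappa> \<le> \<beta> * k / 2"
  proof -
    have "(t' - t)\<^sup>2 \<le> t\<^sup>2" using t' by (intro power2_le_iff_abs_le[THEN iffD2]) auto
    then have "(t' - t)\<^sup>2 / t\<^sup>2 \<le> 1" using t by simp
    then have "\<beta> * k / 2 * ((t' - t)\<^sup>2 / t\<^sup>2) \<le> \<beta> * k / 2 * 1" using \<beta> k by (intro mult_left_mono) auto
    then show ?thesis by (simp add: \<kappa>_def)
  qed
  have L: "L \<ge> 0" using \<beta> t' by (simp add: L_def)
  have \<Phi>: "\<Phi> = ln 2 - \<psi> t" by (simp add: \<Phi>_def \<psi>_def ln_mult cosh_real_pos)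
  have pot: "\<psi> t + \<beta> * k / 2 * (y - t)\<^sup>2 \<le> \<psi> y" if "t' \<le> y" for y
    unfolding \<psi>_def using \<beta> t t' that by (intro curie_weiss_potential[OF _ _ _ _ k_def]) auto
  have main: "\<exists>c \<mu> K. spin_bound (\<beta> * y) c \<mu> K \<and> 0 < K \<and> K \<le> 1 \<and> \<bar>\<mu>\<bar> \<le> 1 \<and> \<beta> * K \<le> 1 + \<eta> \<and>
      c - \<beta> * y\<^sup>2 / 2 \<le> \<Phi> - \<kappa> * (\<bar>y\<bar> - t)\<^sup>2 \<and> \<bar>\<mu>\<^sup>2 - t\<^sup>2\<bar> \<le> L * \<bar>\<bar>y\<bar> - t\<bar>" for y
  proof (cases "t' \<le> \<bar>y\<bar>")
    case True
    have "c - \<beta> * y\<^sup>2 / 2 \<le> \<Phi> - \<kappa> * (\<bar>y\<bar> - t)\<^sup>2" if "c = ln (2 * cosh (\<beta> * y))" for c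
    proof -
      have "cosh (\<beta> * \<bar>y\<bar>) = cosh (\<beta> * y)" by (cases "y \<ge> 0") auto
      then have "c - \<beta> * y\<^sup>2 / 2 = ln 2 - \<psi> \<bar>y\<bar>"
        by (simp add: that \<psi>_def ln_mult cosh_real_pos)
      moreover have "\<kappa> * (\<bar>y\<bar> - t)\<^sup>2 \<le> \<beta> * k / 2 * (\<bar>y\<bar> - t)\<^sup>2"
        using \<kappa>_le by (intro mult_right_mono) auto
      ultimately show ?thesis using pot[OF True] \<Phi> by linarith
    qed
    moreover have "\<beta> * spin_variance (\<beta> * y) \<le> 1 + \<eta>"
    proof -
      have "spin_variance (\<beta> * y) = spin_variance \<bar>\<beta> * y\<bar>" by simp
      also have "\<dots> \<le> spin_variance (\<beta> * t')"
        using \<beta> True t' by (intro spin_variance_antimono) (auto simp: abs_mult)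
      finally show ?thesis using sv[OF t'(3)] t'(1) \<beta> mult_left_mono[of _ _ \<beta>] by fastforce
    qed
    moreover have "\<bar>(tanh (\<beta> * y))\<^sup>2 - t\<^sup>2\<bar> \<le> L * \<bar>\<bar>y\<bar> - t\<bar>"
    proof -
      have "\<bar>(tanh (\<beta> * y))\<^sup>2 - (tanh (\<beta> * t))\<^sup>2\<bar> \<le> 2 * \<bar>\<bar>\<beta> * y\<bar> - \<bar>\<beta> * t\<bar>\<bar>" by (rule tanh_sq_diff_le)
      also have "\<bar>\<beta> * y\<bar> - \<bar>\<beta> * t\<bar> = \<beta> * (\<bar>y\<bar> - t)" using \<beta> t by (simp add: abs_mult right_diff_distrib)
      also have "2 * \<bar>\<beta> * (\<bar>y\<bar> - t)\<bar> \<le> L * \<bar>\<bar>y\<bar> - t\<bar>"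
        using \<beta> t' by (simp add: abs_mult L_def distrib_right)
      finally show ?thesis by (simp add: t)
    qed
    moreover have "\<bar>tanh (\<beta> * y)\<bar> \<le> 1" using abs_tanh_less_1[of "\<beta> * y"] by simp
    ultimately show ?thesis
      by (intro exI[of _ "ln (2 * cosh (\<beta> * y))"] exI[of _ "tanh (\<beta> * y)"]
          exI[of _ "spin_variance (\<beta> * y)"] conjI spin_bound_exact spin_variance_pos spin_variance_le_1) auto
  next
    case False
    define K where "K = spin_variance (\<beta> * t')"
    define c where "c = ln (2 * cosh (\<beta> * t')) + K * ((\<beta> * y)\<^sup>2 - (\<beta> * t')\<^sup>2) / 2"
    define \<mu> where "\<mu> = K * (\<beta> * y)"
    have sb: "spin_bound (\<beta> * y) c \<mu> K"
      unfolding c_def \<mu>_def K_def by (rule spin_bound_tangent)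
    have K: "0 < K" "K \<le> 1" by (simp_all add: K_def spin_variance_pos spin_variance_le_1)
    have \<beta>K: "\<beta> * K \<le> 1 + \<eta>" using sv[OF t'(3)] t'(1) by (simp add: K_def)
    \<comment> \<open>This is the mean-field equation at t combined with monotonicity of the
      variance. It makes c - \<beta> * y^2 / 2 nondecreasing in y^2, so for \<bar>y\<bar> below t'
      the worst case is \<bar>y\<bar> = t'.\<close>
    have \<beta>K1: "1 \<le> \<beta> * K"
    proof -
      have "\<beta> * spin_variance (\<beta> * t) \<le> \<beta> * K"
        unfolding K_def using \<beta> t t' by (intro mult_left_mono spin_variance_antimono) auto
      then show ?thesis using sv[OF t(1)] t by simp
    qed
    have \<mu>: "\<bar>\<mu>\<bar> \<le> 1"
    proof -
      have "\<bar>\<mu>\<bar> \<le> K * (\<beta> * t')"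
        unfolding \<mu>_def abs_mult using K \<beta> False by (intro mult_mono) auto
      also have "\<dots> = tanh (\<beta> * t')" by (simp add: K_def spin_variance_mult)
      finally show ?thesis using tanh_real_lt_1[of "\<beta> * t'"] by simp
    qed
    have "c - \<beta> * y\<^sup>2 / 2 = ln 2 - \<psi> t' + \<beta> / 2 * ((\<beta> * K - 1) * (y\<^sup>2 - t'\<^sup>2))"
      by (simp add: c_def \<psi>_def ln_mult cosh_real_pos power_mult_distrib power2_eq_square field_simps)
    moreover have "\<beta> / 2 * ((\<beta> * K - 1) * (y\<^sup>2 - t'\<^sup>2)) \<le> 0"
    proof -
      have "y\<^sup>2 \<le> t'\<^sup>2" using False t' by (intro power2_le_iff_abs_le[THEN iffD2]) auto
      then show ?thesis using \<beta> \<beta>K1 by (intro mult_nonneg_nonpos) auto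
    qed
    moreover have "\<kappa> * (\<bar>y\<bar> - t)\<^sup>2 \<le> \<beta> * k / 2 * (t' - t)\<^sup>2"
    proof -
      have "(\<bar>y\<bar> - t)\<^sup>2 \<le> t\<^sup>2" using False t' t by (intro power2_le_iff_abs_le[THEN iffD2]) auto
      then have "\<kappa> * (\<bar>y\<bar> - t)\<^sup>2 \<le> \<kappa> * t\<^sup>2" using \<kappa> by (intro mult_left_mono) auto
      then show ?thesis using t by (simp add: \<kappa>_def)
    qed
    ultimately have "c - \<beta> * y\<^sup>2 / 2 \<le> \<Phi> - \<kappa> * (\<bar>y\<bar> - t)\<^sup>2"
      using pot[of t'] \<Phi> by linarith
    moreover have "\<bar>\<mu>\<^sup>2 - t\<^sup>2\<bar> \<le> L * \<bar>\<bar>y\<bar> - t\<bar>"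
    proof -
      have "\<mu>\<^sup>2 \<le> 1" "t\<^sup>2 \<le> 1" using \<mu> t by (auto simp: abs_square_le_1)
      then have "\<bar>\<mu>\<^sup>2 - t\<^sup>2\<bar> \<le> 1" using zero_le_power2[of \<mu>] zero_le_power2[of t] by linarith
      also have "\<dots> = 1 / (t - t') * (t - t')" using t' by simp
      also have "\<dots> \<le> L * \<bar>\<bar>y\<bar> - t\<bar>"
        using False t' \<beta> L by (intro mult_mono) (auto simp: L_def)
      finally show ?thesis .
    qed
    ultimately show ?thesis
      by (intro exI[of _ c] exI[of _ \<mu>] exI[of _ K] conjI sb K \<beta>K \<mu>)
  qed
  show ?thesis
    by (rule that[OF t(1,3) \<kappa> L]) (rule main[unfolded \<Phi>_def])
qed

section \<open>Comparison with the Curie--Weiss model\<close>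

text \<open>The Curie--Weiss coupling is subtracted off the diagonal only. The diagonal of a
  coupling matrix thus stays zero, as the Gaussian comparison requires, and on spin configurations
  the form changes only by the constant 1.\<close>

definition centered :: "nat \<Rightarrow> (nat \<Rightarrow> nat \<Rightarrow> real) \<Rightarrow> nat \<Rightarrow> nat \<Rightarrow> real" where
  "centered N a i j = a i j - (if i = j then 0 else 1 / real N)"

lemma mat_app_centered:
  assumes "i < N"
  shows "mat_app N (centered N a) x i = mat_app N a x i - (\<Sum>j<N. x j) / real N + x i / real N"
proof -
  have "mat_app N (centered N a) x i
      = (\<Sum>j<N. a i j * x j - x j / real N + x j / real N * (if j = i then 1 else 0))"
    unfolding mat_app_def by (intro sum.cong refl) (simp add: centered_def algebra_simps)
  also have "\<dots> = mat_app N a x i - (\<Sum>j<N. x j) / real N + x i / real N"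
    unfolding sum.distrib sum_subtractf sum_mult_delta[OF assms] by (simp add: mat_app_def sum_divide_distrib)
  finally show ?thesis .
qed

lemma quad_form_centered:
  "quad_form N (centered N a) x = quad_form N a x - (\<Sum>i<N. x i)\<^sup>2 / real N + sq_norm N x / real N"
proof -
  have "quad_form N (centered N a) x
      = (\<Sum>i<N. x i * mat_app N a x i - x i * ((\<Sum>j<N. x j) / real N) + (x i)\<^sup>2 / real N)"
    unfolding quad_form_def
    by (intro sum.cong refl) (simp add: mat_app_centered algebra_simps power2_eq_square)
  also have "\<dots> = quad_form N a x - (\<Sum>i<N. x i) * ((\<Sum>j<N. x j) / real N) + sq_norm N x / real N"
    unfolding sum.distrib sum_subtractf
    by (simp only: quad_form_def sq_norm_def sum_divide_distrib[symmetric] sum_distrib_right)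
  finally show ?thesis by (simp add: power2_eq_square)
qed

lemma row_sum_centered:
  assumes "i < N"
  shows "(\<Sum>j<N. centered N a i j) = ((\<Sum>j<N. a i j) - 1) + 1 / real N"
  using mat_app_centered[OF assms, of a "\<lambda>_. 1"] assms by (simp add: mat_app_def)

lemma square_diff_le: "(a - b)\<^sup>2 \<le> 2 * a\<^sup>2 + 2 * (b :: real)\<^sup>2"
proof -
  have "0 \<le> (a + b)\<^sup>2" by simp
  then show ?thesis by (simp add: power2_eq_square algebra_simps)
qed

lemma square_sum_le: "(a + b)\<^sup>2 \<le> 2 * a\<^sup>2 + 2 * (b :: real)\<^sup>2"
  using square_diff_le[of a "- b"] by simp

lemma frobenius_centered_le:
  assumes "N > 0"
  shows "(\<Sum>i<N. \<Sum>j<N. (centered N a i j)\<^sup>2) \<le> 2 * (\<Sum>i<N. \<Sum>j<N. (a i j)\<^sup>2) + 2"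
proof -
  have "(centered N a i j)\<^sup>2 \<le> 2 * (a i j)\<^sup>2 + 2 * (1 / real N)\<^sup>2" for i j
    using square_diff_le[of "a i j" "1 / real N"] by (auto simp: centered_def)
  then have "(\<Sum>i<N. \<Sum>j<N. (centered N a i j)\<^sup>2) \<le> (\<Sum>i<N. \<Sum>j<N. 2 * (a i j)\<^sup>2 + 2 * (1 / real N)\<^sup>2)"
    by (intro sum_mono)
  also have "\<dots> = 2 * (\<Sum>i<N. \<Sum>j<N. (a i j)\<^sup>2) + 2"
    using assms by (simp add: sum.distrib sum_distrib_left power2_eq_square)
  finally show ?thesis .
qed

text \<open>The Gaussian comparison for the residual coupling in a fixed field h. The term linear in
  the row deviations is kept exactly, since it has to cancel against the lower bound, and \<mu>^2 is
  kept in front of \<open>r2\<close>, since at criticality its smallness is what controls that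
  term.\<close>

lemma field_bound:
  fixes a :: "nat \<Rightarrow> nat \<Rightarrow> real"
  defines "F \<equiv> \<lambda>N. \<Sum>i<N. \<Sum>j<N. (a i j)\<^sup>2"
    and "\<rho> \<equiv> \<lambda>N. \<Sum>i<N. (\<Sum>j<N. a i j) - 1"
    and "r2 \<equiv> \<lambda>N. \<Sum>i<N. ((\<Sum>j<N. a i j) - 1)\<^sup>2"
  assumes N: "N > 0" and sym: "\<And>i j. i < N \<Longrightarrow> j < N \<Longrightarrow> a i j = a j i"
    and diag: "\<And>i. i < N \<Longrightarrow> a i i = 0"
    and sb: "spin_bound h c \<mu> K" and K: "0 < K" "K \<le> 1" and \<mu>: "\<bar>\<mu>\<bar> \<le> 1"
    and \<delta>: "\<delta> > 0" and b: "b \<ge> 0"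
    and upper: "\<And>x. K * b * quad_form N (centered N a) x \<le> (1 - \<delta>) * sq_norm N x"
  shows "(\<Sum>\<sigma>\<in>spin_configs N. exp (h * spin_sum \<sigma> + b / 2 * quad_form N (centered N a) (($) \<sigma>)))
    \<le> exp (real N * c + b / 2 * (\<mu>\<^sup>2 * \<rho> N) + (b / 2 + 2 * b\<^sup>2 / \<delta>) * (1 + F N + \<mu>\<^sup>2 * r2 N))"
proof -
  define W where "W = centered N a"
  have \<mu>2: "\<mu>\<^sup>2 \<le> 1" using \<mu> by (simp add: abs_square_le_1)
  have nonneg: "F N \<ge> 0" "r2 N \<ge> 0" by (auto simp: F_def r2_def sum_nonneg)
  have up: "K * quad_form N (\<lambda>i j. b * W i j) x \<le> (1 - \<delta>) * sq_norm N x" for x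
    using upper[of x] by (simp add: quad_form_scale W_def mult.assoc)
  have symW: "b * W i j = b * W j i" if "i < N" "j < N" for i j
    using sym[OF that] by (simp add: W_def centered_def)
  have diagW: "b * W i i = 0" if "i < N" for i
    using diag[OF that] by (simp add: W_def centered_def)
  have "(\<Sum>\<sigma>\<in>spin_configs N. exp (h * spin_sum \<sigma> + b / 2 * quad_form N W (($) \<sigma>)))
    = (\<Sum>\<sigma>\<in>spin_configs N. exp ((h + 0) * spin_sum \<sigma> + 1 / 2 * quad_form N (\<lambda>i j. b * W i j) (($) \<sigma>)))"
    by (simp add: quad_form_scale)
  also have "\<dots> \<le> exp (real N * c + \<mu>\<^sup>2 / 2 * (\<Sum>i<N. \<Sum>j<N. b * W i j) + 0 * \<mu> * real N
      + K\<^sup>2 / (2 * \<delta>) * (\<Sum>i<N. \<Sum>j<N. (b * W i j)\<^sup>2)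
      + K / (2 * \<delta>) * (\<Sum>i<N. (\<mu> * (\<Sum>j<N. b * W i j) + 0)\<^sup>2))"
    by (rule gaussian_comparison[OF sb K(1) \<delta> symW diagW up])
  also have "(\<Sum>i<N. \<Sum>j<N. b * W i j) = b * (\<rho> N + 1)"
  proof -
    have "(\<Sum>i<N. \<Sum>j<N. b * W i j) = b * (\<Sum>i<N. \<Sum>j<N. W i j)" by (simp add: sum_distrib_left)
    also have "(\<Sum>i<N. \<Sum>j<N. W i j) = (\<Sum>i<N. ((\<Sum>j<N. a i j) - 1) + 1 / real N)"
      unfolding W_def by (intro sum.cong refl) (simp add: row_sum_centered)
    also have "\<dots> = \<rho> N + 1" using N by (simp only: sum.distrib \<rho>_def) simp
    finally show ?thesis .
  qed
  also have "(\<Sum>i<N. \<Sum>j<N. (b * W i j)\<^sup>2) = b\<^sup>2 * (\<Sum>i<N. \<Sum>j<N. (W i j)\<^sup>2)"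
    unfolding power_mult_distrib by (simp add: sum_distrib_left)
  also have "(\<Sum>i<N. (\<mu> * (\<Sum>j<N. b * W i j) + 0)\<^sup>2) = b\<^sup>2 * (\<mu>\<^sup>2 * (\<Sum>i<N. (\<Sum>j<N. W i j)\<^sup>2))"
  proof -
    have "(\<mu> * (\<Sum>j<N. b * W i j) + 0)\<^sup>2 = b\<^sup>2 * (\<mu>\<^sup>2 * (\<Sum>j<N. W i j)\<^sup>2)" for i
      by (simp add: power_mult_distrib flip: sum_distrib_left)
    then show ?thesis by (simp only: sum_distrib_left)
  qed
  finally have 1: "(\<Sum>\<sigma>\<in>spin_configs N. exp (h * spin_sum \<sigma> + b / 2 * quad_form N W (($) \<sigma>)))
    \<le> exp (real N * c + \<mu>\<^sup>2 / 2 * (b * (\<rho> N + 1)) + 0 * \<mu> * real N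
      + K\<^sup>2 / (2 * \<delta>) * (b\<^sup>2 * (\<Sum>i<N. \<Sum>j<N. (W i j)\<^sup>2))
      + K / (2 * \<delta>) * (b\<^sup>2 * (\<mu>\<^sup>2 * (\<Sum>i<N. (\<Sum>j<N. W i j)\<^sup>2))))" .
  have rows: "(\<Sum>i<N. (\<Sum>j<N. W i j)\<^sup>2) \<le> 2 * r2 N + 2"
  proof -
    have "(\<Sum>i<N. (\<Sum>j<N. W i j)\<^sup>2) = (\<Sum>i<N. (((\<Sum>j<N. a i j) - 1) + 1 / real N)\<^sup>2)"
      unfolding W_def by (intro sum.cong refl) (simp add: row_sum_centered)
    also have "\<dots> \<le> (\<Sum>i<N. 2 * ((\<Sum>j<N. a i j) - 1)\<^sup>2 + 2 * (1 / real N)\<^sup>2)"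
      by (intro sum_mono square_sum_le)
    also have "\<dots> = 2 * r2 N + 2 * (1 / real N)"
      using N by (simp add: sum.distrib r2_def sum_distrib_left power2_eq_square)
    also have "\<dots> \<le> 2 * r2 N + 2" using N by (simp add: divide_le_eq)
    finally show ?thesis .
  qed
  have t1: "\<mu>\<^sup>2 / 2 * (b * (\<rho> N + 1)) \<le> b / 2 * (\<mu>\<^sup>2 * \<rho> N) + b / 2 * 1"
    using mult_left_mono[OF \<mu>2, of "b / 2"] b by (simp add: algebra_simps)
  have t2: "K\<^sup>2 / (2 * \<delta>) * (b\<^sup>2 * (\<Sum>i<N. \<Sum>j<N. (W i j)\<^sup>2)) \<le> b\<^sup>2 / \<delta> * (F N + 1)"
  proof -
    have "K\<^sup>2 / (2 * \<delta>) * (b\<^sup>2 * (\<Sum>i<N. \<Sum>j<N. (W i j)\<^sup>2)) \<le> 1 / (2 * \<delta>) * (b\<^sup>2 * (2 * F N + 2))"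
      unfolding W_def F_def using K \<delta> N
      by (intro mult_mono frobenius_centered_le divide_right_mono power_le_one)
         (auto simp: sum_nonneg)
    then show ?thesis by (simp add: algebra_simps add_divide_distrib)
  qed
  have t3: "K / (2 * \<delta>) * (b\<^sup>2 * (\<mu>\<^sup>2 * (\<Sum>i<N. (\<Sum>j<N. W i j)\<^sup>2))) \<le> b\<^sup>2 / \<delta> * (\<mu>\<^sup>2 * r2 N + 1)"
  proof -
    have "K / (2 * \<delta>) * (b\<^sup>2 * (\<mu>\<^sup>2 * (\<Sum>i<N. (\<Sum>j<N. W i j)\<^sup>2))) \<le> 1 / (2 * \<delta>) * (b\<^sup>2 * (\<mu>\<^sup>2 * (2 * r2 N + 2)))"
      using K \<delta> rows by (intro mult_mono divide_right_mono) (auto simp: sum_nonneg)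
    also have "\<dots> = b\<^sup>2 / \<delta> * (\<mu>\<^sup>2 * r2 N + \<mu>\<^sup>2)" using \<delta> by (simp add: field_simps)
    also have "\<dots> \<le> b\<^sup>2 / \<delta> * (\<mu>\<^sup>2 * r2 N + 1)" using \<mu>2 \<delta> by (intro mult_left_mono) auto
    finally show ?thesis .
  qed
  have t4: "b / 2 * 1 + (b\<^sup>2 / \<delta> * (F N + 1) + b\<^sup>2 / \<delta> * (\<mu>\<^sup>2 * r2 N + 1))
    \<le> (b / 2 + 2 * b\<^sup>2 / \<delta>) * (1 + F N + \<mu>\<^sup>2 * r2 N)"
  proof -
    define y where "y = F N + \<mu>\<^sup>2 * r2 N"
    have y: "y \<ge> 0" using nonneg by (simp add: y_def)
    have "b\<^sup>2 / \<delta> * (F N + 1) + b\<^sup>2 / \<delta> * (\<mu>\<^sup>2 * r2 N + 1) = b\<^sup>2 / \<delta> * (y + 2)"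
      unfolding distrib_left[symmetric] by (simp add: y_def add_ac)
    also have "\<dots> \<le> b\<^sup>2 / \<delta> * (2 * (1 + y))" using y \<delta> by (intro mult_left_mono) auto
    also have "\<dots> = 2 * b\<^sup>2 / \<delta> * (1 + y)" using \<delta> by (simp add: field_simps)
    finally have "b\<^sup>2 / \<delta> * (F N + 1) + b\<^sup>2 / \<delta> * (\<mu>\<^sup>2 * r2 N + 1) \<le> 2 * b\<^sup>2 / \<delta> * (1 + y)" .
    moreover have "b / 2 * 1 \<le> b / 2 * (1 + y)" using y b by (intro mult_left_mono) auto
    ultimately show ?thesis unfolding add.assoc[of 1] y_def[symmetric] by (simp only: distrib_right)
  qed
  have "real N * c + \<mu>\<^sup>2 / 2 * (b * (\<rho> N + 1)) + 0 * \<mu> * real N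
      + K\<^sup>2 / (2 * \<delta>) * (b\<^sup>2 * (\<Sum>i<N. \<Sum>j<N. (W i j)\<^sup>2))
      + K / (2 * \<delta>) * (b\<^sup>2 * (\<mu>\<^sup>2 * (\<Sum>i<N. (\<Sum>j<N. W i j)\<^sup>2)))
    \<le> real N * c + b / 2 * (\<mu>\<^sup>2 * \<rho> N) + (b / 2 + 2 * b\<^sup>2 / \<delta>) * (1 + F N + \<mu>\<^sup>2 * r2 N)"
    using t1 t2 t3 t4 by linarith
  then show ?thesis unfolding W_def[symmetric] by (intro order_trans[OF 1]) simp
qed

text \<open>Hubbard--Stratonovich: the Curie--Weiss interaction is linearized by a Gaussian field.\<close>
lemma curie_weiss_linearization:
  assumes \<beta>: "\<beta> > 0" and N: "N > 0"
    and le: "\<And>g. std_normal_density g *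
      (\<Sum>\<sigma>\<in>spin_configs N. exp (\<beta> * (g / sqrt (\<beta> * real N)) * spin_sum \<sigma> + Q \<sigma>)) \<le> G g"
    and G: "has_bochner_integral lborel G I"
  shows "(\<Sum>\<sigma>\<in>spin_configs N. exp (\<beta> / (2 * real N) * (spin_sum \<sigma>)\<^sup>2 + Q \<sigma>)) \<le> I"
proof -
  \<comment> \<open>With y = g / sqrt (\<beta> * N) one has k * g = \<beta> * y, and averaging exp
    (k * spin_sum * g) over g returns the Curie--Weiss weight because k^2 = \<beta> / N.\<close>
  define k where "k = \<beta> / sqrt (\<beta> * real N)"
  have k2: "k\<^sup>2 = \<beta> / real N" using \<beta> N by (simp add: k_def power_divide power2_eq_square)
  have "has_bochner_integral lborel
      (\<lambda>g. \<Sum>\<sigma>\<in>spin_configs N. exp (Q \<sigma>) * (std_normal_density g * exp (k * spin_sum \<sigma> * g)))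
      (\<Sum>\<sigma>\<in>spin_configs N. exp (Q \<sigma>) * exp ((k * spin_sum \<sigma>)\<^sup>2 / 2))"
    by (intro has_bochner_integral_sum has_bochner_integral_mult_right gaussian_mgf)
  then have "(\<Sum>\<sigma>\<in>spin_configs N. exp (Q \<sigma>) * exp ((k * spin_sum \<sigma>)\<^sup>2 / 2)) \<le> I"
  proof (rule has_bochner_integral_real_mono[OF _ G])
    fix g
    have "(\<Sum>\<sigma>\<in>spin_configs N. exp (Q \<sigma>) * (std_normal_density g * exp (k * spin_sum \<sigma> * g)))
      = std_normal_density g * (\<Sum>\<sigma>\<in>spin_configs N. exp (\<beta> * (g / sqrt (\<beta> * real N)) * spin_sum \<sigma> + Q \<sigma>))"
      unfolding sum_distrib_left by (intro sum.cong refl) (simp add: exp_add k_def mult_ac)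
    then show "(\<Sum>\<sigma>\<in>spin_configs N. exp (Q \<sigma>) * (std_normal_density g * exp (k * spin_sum \<sigma> * g))) \<le> G g"
      using le[of g] by simp
  qed
  moreover have "exp (Q \<sigma>) * exp ((k * spin_sum \<sigma>)\<^sup>2 / 2) = exp (\<beta> / (2 * real N) * (spin_sum \<sigma>)\<^sup>2 + Q \<sigma>)" for \<sigma>
    by (simp add: power_mult_distrib k2 exp_add mult_ac)
  ultimately show ?thesis by simp
qed

section \<open>Upper bounds for the partition functions after linearization\<close>

lemma mult_le_weighted_squares: "a * b \<le> \<kappa> / 2 * a\<^sup>2 + b\<^sup>2 / (2 * \<kappa>)" if "\<kappa> > 0" for a b \<kappa> :: real
proof -
  have "0 \<le> (\<kappa> * a - b)\<^sup>2 / (2 * \<kappa>)" using that by simp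
  also have "\<dots> = \<kappa> / 2 * a\<^sup>2 + b\<^sup>2 / (2 * \<kappa>) - a * b"
    using that by (simp add: power2_eq_square field_simps)
  finally show ?thesis by simp
qed

lemma std_normal_times_exp:
  assumes "\<beta> > 0" "N > 0" "y = g / sqrt (\<beta> * real N)"
  shows "std_normal_density g = 1 / sqrt (2 * pi) * exp (- (real N * (\<beta> * y\<^sup>2 / 2)))"
proof -
  have "real N * (\<beta> * y\<^sup>2 / 2) = g\<^sup>2 / 2"
    using assms by (simp add: power_divide)
  then show ?thesis by (simp add: std_normal_density_def)
qed

lemma scaled_normal_density:
  assumes "s > 0"
  shows "s * normal_density m s g = 1 / sqrt (2 * pi) * exp (- ((g - m)\<^sup>2 / (2 * s\<^sup>2)))"
proof -
  have "s * normal_density m s g = s * (1 / sqrt (2 * pi * s\<^sup>2)) * exp (- ((g - m)\<^sup>2 / (2 * s\<^sup>2)))"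
    by (simp add: normal_density_def)
  also have "s * (1 / sqrt (2 * pi * s\<^sup>2)) = 1 / sqrt (2 * pi)"
    using assms by (simp add: real_sqrt_mult)
  finally show ?thesis .
qed

text \<open>Both dominating functions of the field integral are of this shape: at low temperature
  there are wells at t and -t, and at criticality exp (- y^2 / 2) * cosh y is a sum of two shifted
  Gaussians.\<close>

lemma normal_density_pair_integral:
  assumes "s > 0"
  shows "has_bochner_integral lborel (\<lambda>g. k * (normal_density m s g + normal_density m' s g)) (k * (1 + 1))"
  using assms integrable_normal_density integral_normal_density
  by (intro has_bochner_integral_mult_right has_bochner_integral_add)
     (auto simp: has_bochner_integral_iff)

text \<open>The well supplies N * \<kappa> * (\<bar>y\<bar> - t)^2. One half pays for replacing
  \<mu>^2 by t^2 in front of \<rho>, the other half makes the field integral a Gaussian one. The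
  parameter b is free so that the moment and the plain Curie--Weiss partition function are both
  covered.\<close>

lemma partition_upper_low_temperature:
  fixes a :: "nat \<Rightarrow> nat \<Rightarrow> real" and \<beta> b \<delta> t \<kappa> L \<Phi> :: real
  defines "F \<equiv> \<lambda>N. \<Sum>i<N. \<Sum>j<N. (a i j)\<^sup>2"
    and "\<rho> \<equiv> \<lambda>N. \<Sum>i<N. (\<Sum>j<N. a i j) - 1"
    and "r2 \<equiv> \<lambda>N. \<Sum>i<N. ((\<Sum>j<N. a i j) - 1)\<^sup>2"
    and "C \<equiv> b / 2 + 2 * b\<^sup>2 / \<delta> + (b / 2 * L)\<^sup>2 / (2 * \<kappa>) + \<bar>ln (2 * sqrt (\<beta> / \<kappa>))\<bar>"
  assumes N: "N > 0" and sym: "\<And>i j. i < N \<Longrightarrow> j < N \<Longrightarrow> a i j = a j i"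
    and diag: "\<And>i. i < N \<Longrightarrow> a i i = 0"
    and \<beta>: "\<beta> > 0" and b: "b \<ge> 0" and \<delta>: "\<delta> > 0" and \<kappa>: "\<kappa> > 0" and L: "L \<ge> 0"
    and choice: "\<And>y. \<exists>c \<mu> K. spin_bound (\<beta> * y) c \<mu> K \<and> 0 < K \<and> K \<le> 1 \<and> \<bar>\<mu>\<bar> \<le> 1 \<and>
      (\<forall>x. K * b * quad_form N (centered N a) x \<le> (1 - \<delta>) * sq_norm N x) \<and>
      c - \<beta> * y\<^sup>2 / 2 \<le> \<Phi> - \<kappa> * (\<bar>y\<bar> - t)\<^sup>2 \<and> \<bar>\<mu>\<^sup>2 - t\<^sup>2\<bar> \<le> L * \<bar>\<bar>y\<bar> - t\<bar>"
  shows "(\<Sum>\<sigma>\<in>spin_configs N. exp (\<beta> / (2 * real N) * (spin_sum \<sigma>)\<^sup>2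
      + b / 2 * quad_form N (centered N a) (($) \<sigma>)))
    \<le> exp (real N * \<Phi> + b / 2 * (t\<^sup>2 * \<rho> N) + C * (1 + F N + r2 N))"
proof -
  define C0 where "C0 = b / 2 + 2 * b\<^sup>2 / \<delta>"
  \<comment> \<open>The width in the variable g of the Gaussian exp (- N * \<kappa> / 2 * (y -
    t)^2). It does not depend on N, so the integral costs only a constant.\<close>
  define s where "s = sqrt (\<beta> / \<kappa>)"
  define m where "m = t * sqrt (\<beta> * real N)"
  define D where "D = real N * \<Phi> + b / 2 * (t\<^sup>2 * \<rho> N) + C0 * (1 + F N + r2 N) + (b / 2 * L)\<^sup>2 / (2 * \<kappa>) * r2 N"
  have s: "s > 0" "s\<^sup>2 = \<beta> / \<kappa>" using \<beta> \<kappa> by (auto simp: s_def)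
  have nonneg: "F N \<ge> 0" "r2 N \<ge> 0" "C0 \<ge> 0" using b \<delta> by (auto simp: F_def r2_def C0_def sum_nonneg)
  have \<rho>: "\<bar>\<rho> N\<bar> \<le> sqrt (real N) * sqrt (r2 N)"
  proof -
    have "(\<rho> N)\<^sup>2 \<le> real N * r2 N"
      using Cauchy_Schwarz_ineq_sum[of "\<lambda>_. 1" "\<lambda>i. (\<Sum>j<N. a i j) - 1" "{..<N}"]
      by (simp add: \<rho>_def r2_def)
    then have "\<bar>\<rho> N\<bar>\<^sup>2 \<le> real N * r2 N" by simp
    then have "\<bar>\<rho> N\<bar> \<le> sqrt (real N * r2 N)" by (rule real_le_rsqrt)
    then show ?thesis by (simp add: real_sqrt_mult)
  qed
  have "(\<Sum>\<sigma>\<in>spin_configs N. exp (\<beta> / (2 * real N) * (spin_sum \<sigma>)\<^sup>2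
      + b / 2 * quad_form N (centered N a) (($) \<sigma>)))
    \<le> exp D * (s * (1 + 1))"
  proof (rule curie_weiss_linearization[OF \<beta> N])
    show "has_bochner_integral lborel (\<lambda>g. exp D * (s * (normal_density m s g + normal_density (- m) s g)))
      (exp D * (s * (1 + 1)))"
      using normal_density_pair_integral[OF s(1), of "exp D * s"] by (simp only: mult.assoc)
    fix g :: real
    define y where "y = g / sqrt (\<beta> * real N)"
    obtain c \<mu> K where c: "spin_bound (\<beta> * y) c \<mu> K" "0 < K" "K \<le> 1" "\<bar>\<mu>\<bar> \<le> 1"
      "\<And>x. K * b * quad_form N (centered N a) x \<le> (1 - \<delta>) * sq_norm N x"
      "c - \<beta> * y\<^sup>2 / 2 \<le> \<Phi> - \<kappa> * (\<bar>y\<bar> - t)\<^sup>2" "\<bar>\<mu>\<^sup>2 - t\<^sup>2\<bar> \<le> L * \<bar>\<bar>y\<bar> - t\<bar>"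
      using choice[of y] by blast
    define z where "z = \<bar>\<bar>y\<bar> - t\<bar>"
    have z2: "(\<bar>y\<bar> - t)\<^sup>2 = z\<^sup>2" by (simp add: z_def)
    have \<mu>2: "\<mu>\<^sup>2 \<le> 1" using c(4) by (simp add: abs_square_le_1)
    \<comment> \<open>The mismatch is at most L * z * sqrt N * sqrt (r2 N), and the weighted product
      inequality splits it into half of the well and a multiple of \<open>r2\<close>.\<close>
    have 1: "b / 2 * (\<mu>\<^sup>2 * \<rho> N) \<le> b / 2 * (t\<^sup>2 * \<rho> N) + (real N * (\<kappa> / 2 * z\<^sup>2) + (b / 2 * L)\<^sup>2 / (2 * \<kappa>) * r2 N)"
    proof -
      have "b / 2 * ((\<mu>\<^sup>2 - t\<^sup>2) * \<rho> N) \<le> b / 2 * (L * z * (sqrt (real N) * sqrt (r2 N)))"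
      proof (intro mult_left_mono)
        have "(\<mu>\<^sup>2 - t\<^sup>2) * \<rho> N \<le> \<bar>\<mu>\<^sup>2 - t\<^sup>2\<bar> * \<bar>\<rho> N\<bar>" by (metis abs_ge_self abs_mult)
        also have "\<dots> \<le> L * z * (sqrt (real N) * sqrt (r2 N))"
          using c(7) \<rho> L by (intro mult_mono) (auto simp: z_def)
        finally show "(\<mu>\<^sup>2 - t\<^sup>2) * \<rho> N \<le> L * z * (sqrt (real N) * sqrt (r2 N))" .
      qed (use b in simp)
      also have "\<dots> = (z * sqrt (real N)) * (b / 2 * L * sqrt (r2 N))" by (simp add: mult_ac)
      also have "\<dots> \<le> \<kappa> / 2 * (z * sqrt (real N))\<^sup>2 + (b / 2 * L * sqrt (r2 N))\<^sup>2 / (2 * \<kappa>)"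
        by (rule mult_le_weighted_squares[OF \<kappa>])
      also have "\<dots> = real N * (\<kappa> / 2 * z\<^sup>2) + (b / 2 * L)\<^sup>2 / (2 * \<kappa>) * r2 N"
        using nonneg by (simp add: power_mult_distrib power_divide)
      finally show ?thesis by (simp add: algebra_simps)
    qed
    have 2: "real N * c + - (real N * (\<beta> * y\<^sup>2 / 2)) \<le> real N * \<Phi> - real N * (\<kappa> * z\<^sup>2)"
      using mult_left_mono[OF c(6), of "real N"] unfolding z2 by (simp add: algebra_simps)
    have 3: "C0 * (1 + F N + \<mu>\<^sup>2 * r2 N) \<le> C0 * (1 + F N + r2 N)"
      using nonneg \<mu>2 by (intro mult_left_mono add_left_mono) (auto simp: mult_left_le_one_le)
    let ?Z = "\<Sum>\<sigma>\<in>spin_configs N. exp (\<beta> * (g / sqrt (\<beta> * real N)) * spin_sum \<sigma>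
        + b / 2 * quad_form N (centered N a) (($) \<sigma>))"
    have "std_normal_density g * ?Z \<le> std_normal_density g * exp (real N * c + b / 2 * (\<mu>\<^sup>2 * \<rho> N) + C0 * (1 + F N + \<mu>\<^sup>2 * r2 N))"
      unfolding y_def[symmetric] C0_def F_def \<rho>_def r2_def
      by (intro mult_left_mono field_bound[OF N sym diag c(1-4) \<delta> b c(5)]) simp_all
    also have "\<dots> = 1 / sqrt (2 * pi) * exp (real N * c + - (real N * (\<beta> * y\<^sup>2 / 2))
        + b / 2 * (\<mu>\<^sup>2 * \<rho> N) + C0 * (1 + F N + \<mu>\<^sup>2 * r2 N))"
      unfolding std_normal_times_exp[OF \<beta> N y_def] mult.assoc exp_add[symmetric] by (simp add: add_ac)
    also have "\<dots> \<le> 1 / sqrt (2 * pi) * exp (D - real N * (\<kappa> / 2 * z\<^sup>2))"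
    proof (intro mult_left_mono)
      have "real N * (\<kappa> * z\<^sup>2) = real N * (\<kappa> / 2 * z\<^sup>2) + real N * (\<kappa> / 2 * z\<^sup>2)" by simp
      then show "exp (real N * c + - (real N * (\<beta> * y\<^sup>2 / 2)) + b / 2 * (\<mu>\<^sup>2 * \<rho> N) + C0 * (1 + F N + \<mu>\<^sup>2 * r2 N))
        \<le> exp (D - real N * (\<kappa> / 2 * z\<^sup>2))"
        unfolding exp_le_cancel_iff D_def using 1 2 3 by linarith
    qed simp
    also have "\<dots> = exp D * (1 / sqrt (2 * pi) * exp (- (real N * (\<kappa> / 2 * z\<^sup>2))))"
      unfolding diff_conv_add_uminus exp_add by (simp only: mult.left_commute)
    also have "\<dots> \<le> exp D * (s * (normal_density m s g + normal_density (- m) s g))"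
    proof (intro mult_left_mono)
      have nd: "s * normal_density m' s g = 1 / sqrt (2 * pi) * exp (- (real N * (\<kappa> / 2 * (y - t')\<^sup>2)))"
        if "m' = t' * sqrt (\<beta> * real N)" for m' t'
      proof -
        have "g = y * sqrt (\<beta> * real N)" using \<beta> N by (simp add: y_def)
        then have "g - m' = (y - t') * sqrt (\<beta> * real N)"
          unfolding that left_diff_distrib by (rule arg_cong[where f = "\<lambda>x. x - t' * sqrt (\<beta> * real N)"])
        then have "(g - m')\<^sup>2 = (y - t')\<^sup>2 * (\<beta> * real N)"
          using \<beta> by (simp add: power_mult_distrib)
        then have "(g - m')\<^sup>2 / (2 * s\<^sup>2) = real N * (\<kappa> / 2 * (y - t')\<^sup>2)"
          using \<beta> \<kappa> by (simp add: s(2))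
        then show ?thesis unfolding scaled_normal_density[OF s(1)] by (simp only:)
      qed
      show "1 / sqrt (2 * pi) * exp (- (real N * (\<kappa> / 2 * z\<^sup>2)))
        \<le> s * (normal_density m s g + normal_density (- m) s g)"
      proof (cases "y \<ge> 0")
        case True
        then have "z\<^sup>2 = (y - t)\<^sup>2" by (simp add: z_def)
        then show ?thesis using nd[of m t] s(1) by (simp add: m_def distrib_left)
      next
        case False
        then have "z\<^sup>2 = (y - (- t))\<^sup>2" by (simp add: z_def power2_eq_square algebra_simps)
        then show ?thesis using nd[of "- m" "- t"] s(1) by (simp add: m_def distrib_left)
      qed
    qed simp
    finally show "std_normal_density g * ?Z \<le> exp D * (s * (normal_density m s g + normal_density (- m) s g))" .
  qed
  also have "s * (1 + 1) = exp (ln (2 * s))" using s(1) by simp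
  also have "exp D * exp (ln (2 * s)) \<le> exp (real N * \<Phi> + b / 2 * (t\<^sup>2 * \<rho> N) + C * (1 + F N + r2 N))"
  proof -
    define x where "x = 1 + F N + r2 N"
    have x: "1 \<le> x" "r2 N \<le> x" using nonneg by (auto simp: x_def)
    have "(b / 2 * L)\<^sup>2 / (2 * \<kappa>) * r2 N \<le> (b / 2 * L)\<^sup>2 / (2 * \<kappa>) * x"
      using x \<kappa> by (intro mult_left_mono) auto
    moreover have "ln (2 * s) \<le> \<bar>ln (2 * s)\<bar> * x"
      using mult_left_mono[OF x(1), of "\<bar>ln (2 * s)\<bar>"] by simp
    ultimately have "D + ln (2 * s) \<le> real N * \<Phi> + b / 2 * (t\<^sup>2 * \<rho> N)
      + (C0 * x + (b / 2 * L)\<^sup>2 / (2 * \<kappa>) * x + \<bar>ln (2 * s)\<bar> * x)"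
      unfolding D_def x_def[symmetric] by linarith
    also have "C0 * x + (b / 2 * L)\<^sup>2 / (2 * \<kappa>) * x + \<bar>ln (2 * s)\<bar> * x = C * x"
      unfolding C_def C0_def s_def by (simp only: distrib_right)
    finally show ?thesis by (simp add: x_def flip: exp_add)
  qed
  finally show ?thesis .
qed

text \<open>Here the reference mean is 0, so everything proportional to \<mu>^2, collected in
  \<open>A\<close>, is an error. It is absorbed by the quartic N * \<mu>^4 / 24 and leaves 6 * A^2 /
  N, the source of the squared sums divided by N.\<close>

lemma partition_upper_critical:
  fixes a :: "nat \<Rightarrow> nat \<Rightarrow> real" and b \<delta> :: real
  defines "F \<equiv> \<lambda>N. \<Sum>i<N. \<Sum>j<N. (a i j)\<^sup>2"
    and "\<rho> \<equiv> \<lambda>N. \<Sum>i<N. (\<Sum>j<N. a i j) - 1"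
    and "r2 \<equiv> \<lambda>N. \<Sum>i<N. ((\<Sum>j<N. a i j) - 1)\<^sup>2"
    and "C0 \<equiv> b / 2 + 2 * b\<^sup>2 / \<delta>"
  defines "C \<equiv> C0 + 3 * b\<^sup>2 + 12 * C0\<^sup>2 + 1"
  assumes N: "N \<ge> 2" and sym: "\<And>i j. i < N \<Longrightarrow> j < N \<Longrightarrow> a i j = a j i"
    and diag: "\<And>i. i < N \<Longrightarrow> a i i = 0"
    and b: "b \<ge> 0" and \<delta>: "\<delta> > 0"
    and upper: "\<And>K x. 0 < K \<Longrightarrow> K \<le> 1 \<Longrightarrow> K * b * quad_form N (centered N a) x \<le> (1 - \<delta>) * sq_norm N x"
  shows "(\<Sum>\<sigma>\<in>spin_configs N. exp (1 / (2 * real N) * (spin_sum \<sigma>)\<^sup>2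
      + b / 2 * quad_form N (centered N a) (($) \<sigma>)))
    \<le> exp (real N * ln 2 + C * (1 + F N + 1 / real N * (r2 N)\<^sup>2 + 1 / real N * (\<rho> N)\<^sup>2 + ln (real N)))"
proof -
  define s where "s = sqrt (real N)"
  define A where "A = b / 2 * \<bar>\<rho> N\<bar> + C0 * r2 N"
  define E where "E = real N * ln 2 + C0 * (1 + F N) + 6 * A\<^sup>2 / real N"
  have N0: "N > 0" and one: "(0 :: real) < 1" using N by simp_all
  have s: "s > 0" "s\<^sup>2 = real N" using N by (auto simp: s_def)
  have nonneg: "F N \<ge> 0" "r2 N \<ge> 0" "C0 \<ge> 0" using b \<delta> by (auto simp: F_def r2_def C0_def sum_nonneg)
  have "(\<Sum>\<sigma>\<in>spin_configs N. exp (1 / (2 * real N) * (spin_sum \<sigma>)\<^sup>2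
      + b / 2 * quad_form N (centered N a) (($) \<sigma>)))
    \<le> exp E * (exp (1 / 2) / 2 * s * (1 + 1))"
  proof (rule curie_weiss_linearization[OF one N0])
    show "has_bochner_integral lborel
        (\<lambda>g. exp E * (exp (1 / 2) / 2 * s * (normal_density s s g + normal_density (- s) s g)))
        (exp E * (exp (1 / 2) / 2 * s * (1 + 1)))"
      using normal_density_pair_integral[OF s(1), of "exp E * (exp (1 / 2) / 2 * s)"] by (simp only: mult.assoc)
    fix g :: real
    define y where "y = g / sqrt (1 * real N)"
    define \<mu> where "\<mu> = tanh y"
    define \<psi> where "\<psi> = y\<^sup>2 / 2 - ln (cosh y)"
    have \<psi>: "\<mu> ^ 4 / 12 \<le> \<psi>"
      using ln_cosh_upper_quartic[of y] by (simp add: \<psi>_def \<mu>_def)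
    have \<mu>: "\<bar>\<mu>\<bar> \<le> 1" using abs_tanh_less_1[of y] by (simp add: \<mu>_def)
    have sb: "spin_bound (1 * y) (ln (2 * cosh y)) \<mu> (spin_variance y)"
      using spin_bound_exact[of y] by (simp add: \<mu>_def)
    have 1: "b / 2 * (\<mu>\<^sup>2 * \<rho> N) + C0 * (1 + F N + \<mu>\<^sup>2 * r2 N)
        \<le> C0 * (1 + F N) + (real N / 24 * \<mu> ^ 4 + 6 * A\<^sup>2 / real N)"
    proof -
      have "b / 2 * (\<mu>\<^sup>2 * \<rho> N) \<le> b / 2 * (\<mu>\<^sup>2 * \<bar>\<rho> N\<bar>)" using b by (intro mult_left_mono) auto
      then have "b / 2 * (\<mu>\<^sup>2 * \<rho> N) + C0 * (1 + F N + \<mu>\<^sup>2 * r2 N) \<le> C0 * (1 + F N) + \<mu>\<^sup>2 * A"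
        by (simp add: A_def algebra_simps)
      moreover have "\<mu>\<^sup>2 * A \<le> real N / 12 / 2 * (\<mu>\<^sup>2)\<^sup>2 + A\<^sup>2 / (2 * (real N / 12))"
        using N by (intro mult_le_weighted_squares) simp
      moreover have "(\<mu>\<^sup>2)\<^sup>2 = \<mu> ^ 4" by (simp flip: power_mult)
      moreover have "A\<^sup>2 / (2 * (real N / 12)) = 6 * A\<^sup>2 / real N" by simp
      ultimately show ?thesis by (simp only:)
    qed
    \<comment> \<open>Half of N * \<psi> gives the quartic. Because N is at least 2, the other half
      contains a full copy of \<psi>, kept to make the field integral converge.\<close>
    have 2: "\<psi> + real N / 24 * \<mu> ^ 4 \<le> real N * \<psi>"
    proof -
      have "2 * (\<psi> / 2) \<le> real N * (\<psi> / 2)"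
        using N \<psi> by (intro mult_right_mono) (auto intro: order_trans[of 0 "\<mu> ^ 4 / 12"])
      moreover have "real N / 2 * (\<mu> ^ 4 / 12) \<le> real N / 2 * \<psi>"
        using \<psi> by (intro mult_left_mono) auto
      ultimately show ?thesis by simp
    qed
    have 3: "real N * ln (2 * cosh y) + - (real N * (1 * y\<^sup>2 / 2)) = real N * ln 2 - real N * \<psi>"
      by (simp add: ln_mult cosh_real_pos \<psi>_def algebra_simps)
    let ?Z = "\<Sum>\<sigma>\<in>spin_configs N. exp (1 * (g / sqrt (1 * real N)) * spin_sum \<sigma>
        + b / 2 * quad_form N (centered N a) (($) \<sigma>))"
    have "std_normal_density g * ?Z \<le> std_normal_density g * exp (real N * ln (2 * cosh y) + b / 2 * (\<mu>\<^sup>2 * \<rho> N) + C0 * (1 + F N + \<mu>\<^sup>2 * r2 N))"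
      unfolding y_def[symmetric] C0_def F_def \<rho>_def r2_def
      by (intro mult_left_mono field_bound[OF N0 sym diag sb spin_variance_pos
            spin_variance_le_1 \<mu> \<delta> b upper[OF spin_variance_pos spin_variance_le_1]]) simp_all
    also have "\<dots> = 1 / sqrt (2 * pi) * exp (real N * ln (2 * cosh y) + - (real N * (1 * y\<^sup>2 / 2))
        + b / 2 * (\<mu>\<^sup>2 * \<rho> N) + C0 * (1 + F N + \<mu>\<^sup>2 * r2 N))"
      unfolding std_normal_times_exp[OF one N0 y_def] mult.assoc exp_add[symmetric] by (simp add: add_ac)
    also have "\<dots> \<le> 1 / sqrt (2 * pi) * exp (E - \<psi>)"
    proof (intro mult_left_mono)
      show "exp (real N * ln (2 * cosh y) + - (real N * (1 * y\<^sup>2 / 2)) + b / 2 * (\<mu>\<^sup>2 * \<rho> N) + C0 * (1 + F N + \<mu>\<^sup>2 * r2 N))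
        \<le> exp (E - \<psi>)"
        unfolding exp_le_cancel_iff E_def 3 using 1 2 by linarith
    qed simp
    also have "\<dots> = exp E * (1 / sqrt (2 * pi) * exp (- \<psi>))"
      unfolding diff_conv_add_uminus exp_add by (simp only: mult.left_commute)
    \<comment> \<open>exp (- \<psi>) = exp (- y^2 / 2) * cosh y splits into Gaussians centred at y =
      1 and y = -1, with factor exp (1 / 2) / 2 from completing the square. In the variable g their
      width is s = sqrt N, which costs ln N / 2.\<close>
    also have "1 / sqrt (2 * pi) * exp (- \<psi>) = exp (1 / 2) / 2 * s * (normal_density s s g + normal_density (- s) s g)"
    proof -
      have nd: "s * normal_density (k * s) s g = 1 / sqrt (2 * pi) * exp (- ((y - k)\<^sup>2 / 2))" for k
      proof -
        have g: "g = y * s" using s(1) by (simp add: y_def s_def)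
        have "(g - k * s)\<^sup>2 = (y - k)\<^sup>2 * s\<^sup>2"
          unfolding g left_diff_distrib[symmetric] by (rule power_mult_distrib)
        then have "(g - k * s)\<^sup>2 / (2 * s\<^sup>2) = (y - k)\<^sup>2 / 2" using s(1) by simp
        then show ?thesis unfolding scaled_normal_density[OF s(1)] by (simp only:)
      qed
      have e: "exp (1 / 2) * exp (- ((y - k)\<^sup>2 / 2)) = exp (- (y\<^sup>2 / 2)) * exp (k * y)" if "k\<^sup>2 = 1" for k
      proof -
        have "1 / 2 + - ((y - k)\<^sup>2 / 2) = - (y\<^sup>2 / 2) + k * y"
          using that by (simp add: power2_diff field_simps)
        then show ?thesis by (simp flip: exp_add)
      qed
      have "- \<psi> = - (y\<^sup>2 / 2) + ln (cosh y)" by (simp add: \<psi>_def)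
      then have "exp (- \<psi>) = exp (- (y\<^sup>2 / 2)) * cosh y"
        by (simp only: exp_add exp_ln[OF cosh_real_pos])
      also have "cosh y = (exp (1 * y) + exp (- 1 * y)) / 2" by (simp add: cosh_field_def)
      finally have "exp (- \<psi>) = (exp (1 / 2) * exp (- ((y - 1)\<^sup>2 / 2)) + exp (1 / 2) * exp (- ((y - (- 1))\<^sup>2 / 2))) / 2"
        by (simp only: e power2_minus one_power2) (simp only: distrib_left times_divide_eq_right)
      then have "1 / sqrt (2 * pi) * exp (- \<psi>) = exp (1 / 2) / 2 *
          (1 / sqrt (2 * pi) * exp (- ((y - 1)\<^sup>2 / 2)) + 1 / sqrt (2 * pi) * exp (- ((y - (- 1))\<^sup>2 / 2)))"
        by (simp add: distrib_left add_divide_distrib)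
      also have "\<dots> = exp (1 / 2) / 2 * (s * normal_density (1 * s) s g + s * normal_density ((- 1) * s) s g)"
        by (simp only: nd)
      finally show ?thesis by (simp only: mult_1 mult_minus1 distrib_left mult.assoc)
    qed
    finally show "std_normal_density g * ?Z \<le> exp E * (exp (1 / 2) / 2 * s * (normal_density s s g + normal_density (- s) s g))" .
  qed
  also have "exp (1 / 2) / 2 * s * (1 + 1) = exp (1 / 2 + ln (real N) / 2)"
  proof -
    have "ln s = ln (real N) / 2" using N by (simp add: s_def ln_sqrt)
    then have "s = exp (ln (real N) / 2)" using s(1) by (metis exp_ln)
    then show ?thesis by (simp add: exp_add)
  qed
  also have "exp E * exp (1 / 2 + ln (real N) / 2)
    \<le> exp (real N * ln 2 + C * (1 + F N + 1 / real N * (r2 N)\<^sup>2 + 1 / real N * (\<rho> N)\<^sup>2 + ln (real N)))"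
  proof -
    define x1 x2 where "x1 = 1 / real N * (r2 N)\<^sup>2" and "x2 = 1 / real N * (\<rho> N)\<^sup>2"
    have x: "x1 \<ge> 0" "x2 \<ge> 0" "ln (real N) \<ge> 0" using N by (auto simp: x1_def x2_def)
    have "A\<^sup>2 \<le> 2 * (b / 2 * \<bar>\<rho> N\<bar>)\<^sup>2 + 2 * (C0 * r2 N)\<^sup>2" unfolding A_def by (rule square_sum_le)
    then have "6 * A\<^sup>2 / real N \<le> 6 * (2 * (b / 2 * \<bar>\<rho> N\<bar>)\<^sup>2 + 2 * (C0 * r2 N)\<^sup>2) / real N"
      by (intro divide_right_mono mult_left_mono) auto
    also have "\<dots> = 3 * b\<^sup>2 * x2 + 12 * C0\<^sup>2 * x1"
      using N by (simp add: x1_def x2_def power_mult_distrib power_divide field_simps)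
    finally have "E + (1 / 2 + ln (real N) / 2)
      \<le> real N * ln 2 + (C0 * (1 + F N) + 3 * b\<^sup>2 * x2 + 12 * C0\<^sup>2 * x1 + 1 + ln (real N))"
      unfolding E_def using x by linarith
    also have "\<dots> \<le> real N * ln 2 + C * (1 + F N + x1 + x2 + ln (real N))"
    proof (intro add_left_mono)
      define T where "T = 1 + F N + x1 + x2 + ln (real N)"
      have "C0 * (1 + F N) \<le> C0 * T" "3 * b\<^sup>2 * x2 \<le> 3 * b\<^sup>2 * T" "12 * C0\<^sup>2 * x1 \<le> 12 * C0\<^sup>2 * T"
        using nonneg x unfolding T_def by (intro mult_left_mono; simp)+
      moreover have "1 + ln (real N) \<le> 1 * T" using nonneg x by (simp add: T_def)
      ultimately have "C0 * (1 + F N) + 3 * b\<^sup>2 * x2 + 12 * C0\<^sup>2 * x1 + 1 + ln (real N)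
          \<le> C0 * T + 3 * b\<^sup>2 * T + 12 * C0\<^sup>2 * T + 1 * T" by linarith
      also have "\<dots> = C * T" unfolding C_def by (simp only: distrib_right)
      finally show "C0 * (1 + F N) + 3 * b\<^sup>2 * x2 + 12 * C0\<^sup>2 * x1 + 1 + ln (real N)
          \<le> C * (1 + F N + x1 + x2 + ln (real N))" by (simp only: T_def)
    qed
    finally show ?thesis by (simp add: x1_def x2_def flip: exp_add)
  qed
  finally show ?thesis .
qed

section \<open>Subcriticality of the residual coupling\<close>

lemma square_margin_le:
  fixes \<theta> :: real
  assumes "0 \<le> \<theta>" "\<theta> < 1"
  shows "(1 + (1 - \<theta>) / 4)\<^sup>2 * \<theta> \<le> 1 - (1 - \<theta>) / 4"
proof -
  define \<eta> where "\<eta> = (1 - \<theta>) / 4"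
  have \<theta>: "\<theta> = 1 - 4 * \<eta>" by (simp add: \<eta>_def diff_divide_distrib)
  have \<eta>: "0 \<le> \<eta>" "\<eta> \<le> 1" using assms by (auto simp: \<eta>_def)
  have "(1 + \<eta>)\<^sup>2 * \<theta> = 1 - 2 * \<eta> - 7 * \<eta>\<^sup>2 - 4 * (\<eta>\<^sup>2 * \<eta>)"
    unfolding \<theta> by (simp add: power2_eq_square algebra_simps)
  also have "\<dots> \<le> 1 - \<eta>" using \<eta> mult_nonneg_nonneg[of "\<eta>\<^sup>2" \<eta>] zero_le_power2[of \<eta>] by linarith
  finally show ?thesis by (simp add: \<eta>_def)
qed

text \<open>Of the two factors 1 + \<eta> allowed in k, one is the moment p and the other covers the
  excess of \<beta> * K over 1; a quarter of the gap absorbs both.\<close>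

lemma subcritical_form:
  fixes q \<eta> k Q S :: real
  assumes q: "0 \<le> q" "q < 1" and \<eta>: "\<eta> = (1 - q) / 4"
    and k: "0 \<le> k" "k \<le> (1 + \<eta>)\<^sup>2" and Q: "Q \<le> q * S" and S: "0 \<le> S"
  shows "k * Q \<le> (1 - \<eta>) * S"
proof -
  have "k * Q \<le> k * (q * S)" using k Q by (intro mult_left_mono) auto
  also have "\<dots> \<le> (1 + \<eta>)\<^sup>2 * (q * S)" using k q S by (intro mult_right_mono) auto
  also have "\<dots> = ((1 + \<eta>)\<^sup>2 * q) * S" by simp
  also have "\<dots> \<le> (1 - \<eta>) * S" using square_margin_le[OF q] S unfolding \<eta> by (intro mult_right_mono)
  finally show ?thesis .
qed

lemma eventually_spectral_gap:
  fixes A :: "nat \<Rightarrow> real mat"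
  assumes coupling: "\<And>N. N \<ge> 2 \<Longrightarrow> coupling_matrix N (A N)"
    and top: "(\<lambda>N. nth_eigenvalue (A N) 1) \<longlonglongrightarrow> 1"
    and gap: "limsup (\<lambda>N. ereal (nth_eigenvalue (A N) 2 / nth_eigenvalue (A N) 1)) < 1"
  obtains q \<epsilon> :: real and N0 :: nat where "0 \<le> q" "q < 1" "\<epsilon> > 0"
    "\<And>N x. N \<ge> 2 \<Longrightarrow> N \<ge> N0 \<Longrightarrow> (\<Sum>i<N. (row_total (A N) i - 1)\<^sup>2) \<le> \<epsilon> * real N \<Longrightarrow>
      quad_form N (centered N (entries (A N))) x \<le> q * sq_norm N x"
proof -
  define l1 l2 where "l1 = (\<lambda>N. nth_eigenvalue (A N) 1)" and "l2 = (\<lambda>N. nth_eigenvalue (A N) 2)"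
  obtain r where r: "limsup (\<lambda>N. ereal (l2 N / l1 N)) < ereal r" "ereal r < 1"
    using ereal_dense2[OF gap] by (auto simp: l1_def l2_def)
  have "r < 1" using r(2) by (simp add: one_ereal_def)
  have e1: "\<forall>\<^sub>F N in sequentially. l2 N / l1 N < r"
    using Limsup_lessD[OF r(1)] by simp
  \<comment> \<open>The lower limit 3 / 4, with l1 below 5 / 4, keeps l1 - q0 at most 1 / 2. The
    other choice puts q0 above r, so that l2 < r * l1 < q0 eventually.\<close>
  define q0 where "q0 = max (3 / 4) ((1 + r) / 2)"
  have q0: "3 / 4 \<le> q0" "q0 < 1" "r < q0" using \<open>r < 1\<close> by (auto simp: q0_def less_max_iff_disj)
  have top': "l1 \<longlonglongrightarrow> 1" using top by (simp add: l1_def)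
  have e2: "\<forall>\<^sub>F N in sequentially. q0 < l1 N" by (rule order_tendstoD(1)[OF top' q0(2)])
  have e3: "\<forall>\<^sub>F N in sequentially. l1 N < 5 / 4" by (rule order_tendstoD(2)[OF top']) simp
  have "(\<lambda>N. r * l1 N) \<longlonglongrightarrow> r * 1" by (intro tendsto_mult tendsto_const top')
  then have e4: "\<forall>\<^sub>F N in sequentially. r * l1 N < q0" by (rule order_tendstoD(2)) (use q0 in simp)
  have e5: "\<forall>\<^sub>F N in sequentially. 4 / (1 - q0) \<le> real N"
    by (rule eventually_sequentiallyI[of "nat \<lceil>4 / (1 - q0)\<rceil>"]) linarith
  from eventually_conj[OF e1 eventually_conj[OF e2 eventually_conj[OF e3 eventually_conj[OF e4 e5]]]]
  obtain N0 where N0: "\<And>N. N \<ge> N0 \<Longrightarrow> l2 N / l1 N < r \<and> q0 < l1 N \<and> l1 N < 5 / 4 \<and> r * l1 N < q0 \<and> 4 / (1 - q0) \<le> real N"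
    by (auto simp: eventually_sequentially)
  \<comment> \<open>Chosen so that 3 / 2 * \<epsilon> / (1 - q0)^2 = (1 - q0) / 4. The diagonal
    correction 1 / N costs another quarter of the gap, which gives the final bound (1 + q0) /
    2.\<close>
  define \<epsilon> where "\<epsilon> = (1 - q0) ^ 3 / 6"
  show ?thesis
  proof (rule that[of "(1 + q0) / 2" \<epsilon> N0])
    show "0 \<le> (1 + q0) / 2" "(1 + q0) / 2 < 1" "\<epsilon> > 0" using q0 by (auto simp: \<epsilon>_def)
    fix N x assume N: "N \<ge> 2" "N \<ge> N0" and close: "(\<Sum>i<N. (row_total (A N) i - 1)\<^sup>2) \<le> \<epsilon> * real N"
    define a where "a = entries (A N)"
    note coup = coupling_matrixD[OF coupling[OF N(1)], folded a_def]
    note n0 = N0[OF N(2)]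
    have l1: "l1 N > 0" using n0 q0 by linarith
    have l2: "l2 N \<le> q0" using n0 l1 by (simp add: divide_less_eq)
    obtain v where v: "sq_norm N v = 1" "\<And>i. i < N \<Longrightarrow> mat_app N a v i = l1 N * v i"
      "\<And>x. quad_form N a x \<le> l2 N * sq_norm N x + (l1 N - l2 N) * (\<Sum>i<N. x i * v i)\<^sup>2"
      using quad_form_le_second_eigenvalue[OF coup(1,2) N(1)]
      unfolding l1_def l2_def a_def entries_def[abs_def] by blast
    \<comment> \<open>l2 may be replaced by the larger q0 because the component of x along the unit
      vector v is no longer than x.\<close>
    have v': "quad_form N a x \<le> q0 * sq_norm N x + (l1 N - q0) * (\<Sum>i<N. x i * v i)\<^sup>2" for x
    proof -
      have "(\<Sum>i<N. x i * v i)\<^sup>2 \<le> sq_norm N x * sq_norm N v"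
        unfolding sq_norm_def by (rule Cauchy_Schwarz_ineq_sum)
      then have "(q0 - l2 N) * (\<Sum>i<N. x i * v i)\<^sup>2 \<le> (q0 - l2 N) * sq_norm N x"
        using l2 v(1) by (intro mult_left_mono) auto
      then show ?thesis using v(3)[of x] by (simp add: algebra_simps)
    qed
    have close': "(\<Sum>i<N. ((\<Sum>j<N. a i j) - 1)\<^sup>2) \<le> \<epsilon> * real N" using close by (simp add: coup(5))
    have "quad_form N a x - (\<Sum>i<N. x i)\<^sup>2 / real N \<le> (q0 + 3 / 2 * (\<epsilon> / (1 - q0)\<^sup>2)) * sq_norm N x"
      by (rule quad_form_minus_mean_field[OF _ coup(3) v(1,2) v' _ _ _ close']) (use N n0 q0 in auto)
    also have "3 / 2 * (\<epsilon> / (1 - q0)\<^sup>2) = (1 - q0) / 4"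
      using q0 by (simp add: \<epsilon>_def power2_eq_square power3_eq_cube)
    finally have "quad_form N (centered N a) x \<le> (q0 + (1 - q0) / 4) * sq_norm N x + sq_norm N x / real N"
      unfolding quad_form_centered by simp
    also have "sq_norm N x / real N \<le> (1 - q0) / 4 * sq_norm N x"
    proof -
      have "1 / real N \<le> (1 - q0) / 4" using n0 q0 N by (simp add: field_simps)
      from mult_right_mono[OF this sq_norm_nonneg[of N x]] show ?thesis by simp
    qed
    also have "(q0 + (1 - q0) / 4) * sq_norm N x + (1 - q0) / 4 * sq_norm N x = (1 + q0) / 2 * sq_norm N x"
      by (simp add: field_simps)
    finally show "quad_form N (centered N (entries (A N))) x \<le> (1 + q0) / 2 * sq_norm N x"
      by (simp add: a_def)
  qed
qed

text \<open>A small Frobenius norm makes the row sums small in mean square, while a small second sum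
  keeps them near 1. The resulting lower bound lets the error term absorb additive constants and the
  finitely many small N.\<close>

lemma frobenius_plus_rows_ge:
  fixes a :: "nat \<Rightarrow> nat \<Rightarrow> real"
  assumes "N > 0"
  shows "1 / 4 \<le> (\<Sum>i<N. \<Sum>j<N. (a i j)\<^sup>2) + (\<Sum>i<N. ((\<Sum>j<N. a i j) - 1)\<^sup>2)"
proof -
  define F where "F = (\<Sum>i<N. \<Sum>j<N. (a i j)\<^sup>2)"
  define r2 where "r2 = (\<Sum>i<N. ((\<Sum>j<N. a i j) - 1)\<^sup>2)"
  have r2: "r2 \<ge> 0" by (simp add: r2_def sum_nonneg)
  have "real N = (\<Sum>i<N. 1\<^sup>2)" by simp
  also have "\<dots> = (\<Sum>i<N. ((\<Sum>j<N. a i j) - ((\<Sum>j<N. a i j) - 1))\<^sup>2)" by simp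
  also have "\<dots> \<le> (\<Sum>i<N. 2 * (\<Sum>j<N. a i j)\<^sup>2 + 2 * ((\<Sum>j<N. a i j) - 1)\<^sup>2)"
    by (intro sum_mono square_diff_le)
  also have "\<dots> = 2 * (\<Sum>i<N. (mat_app N a (\<lambda>_. 1) i)\<^sup>2) + 2 * r2"
    by (simp only: sum.distrib sum_distrib_left r2_def mat_app_def mult_1_right)
  also have "(\<Sum>i<N. (mat_app N a (\<lambda>_. 1) i)\<^sup>2) \<le> F * sq_norm N (\<lambda>_. 1)"
    unfolding F_def by (rule mat_app_sq_le)
  also have "F * sq_norm N (\<lambda>_. 1) = F * real N" by (simp add: sq_norm_def)
  also have "2 * (F * real N) + 2 * r2 \<le> 2 * (F * real N) + 2 * (r2 * real N)"
    using assms r2 mult_left_mono[of 1 "real N" r2] by simp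
  finally have "1 * real N \<le> (2 * (F + r2)) * real N" by (simp add: algebra_simps)
  then have "1 \<le> 2 * (F + r2)" using assms by (simp only: mult_le_cancel_right_pos of_nat_0_less_iff)
  then show ?thesis by (simp add: F_def r2_def)
qed

lemma curie_weiss_pmf_eq_gibbs:
  assumes "N > 0"
  shows "curie_weiss_pmf N \<beta> 0 = gibbs_pmf N (\<lambda>\<sigma>. \<beta> / (2 * real N) * (spin_sum \<sigma>)\<^sup>2)"
  unfolding curie_weiss_pmf_def
proof (rule gibbs_pmf_cong)
  fix \<sigma> assume "\<sigma> \<in> spin_configs N"
  then have "dim_vec \<sigma> = N" by (auto simp: spin_configs_def)
  then show "real N * \<beta> / 2 * (spin_mean \<sigma>)\<^sup>2 + 0 * spin_sum \<sigma> = \<beta> / (2 * real N) * (spin_sum \<sigma>)\<^sup>2"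
    using assms by (simp add: spin_mean_def power_divide power2_eq_square)
qed

lemma card_spin_configs: "real (card (spin_configs N)) = 2 ^ N"
  using sum_exp_spin_sum[of 0 N] by simp

lemma partition_function_curie_weiss_le:
  assumes "N > 0" "\<beta> \<ge> 0"
  shows "partition_function N (\<lambda>\<sigma>. \<beta> / (2 * real N) * (spin_sum \<sigma>)\<^sup>2) \<le> exp (real N * (ln 2 + \<beta> / 2))"
proof -
  have "partition_function N (\<lambda>\<sigma>. \<beta> / (2 * real N) * (spin_sum \<sigma>)\<^sup>2) \<le> (\<Sum>\<sigma>\<in>spin_configs N. exp (real N * (\<beta> / 2)))"
    unfolding partition_function_def
  proof (intro sum_mono)
    fix \<sigma> assume "\<sigma> \<in> spin_configs N"
    then have "(spin_sum \<sigma>)\<^sup>2 \<le> (real N)\<^sup>2"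
      using abs_spin_sum_le by (intro power2_le_iff_abs_le[THEN iffD2]) auto
    then have "\<beta> / (2 * real N) * (spin_sum \<sigma>)\<^sup>2 \<le> \<beta> / (2 * real N) * (real N)\<^sup>2"
      using assms by (intro mult_left_mono) auto
    also have "\<dots> = real N * (\<beta> / 2)" using assms by (simp add: power2_eq_square)
    finally show "exp (\<beta> / (2 * real N) * (spin_sum \<sigma>)\<^sup>2) \<le> exp (real N * (\<beta> / 2))" by simp
  qed
  also have "\<dots> = 2 ^ N * exp (real N * (\<beta> / 2))" by (simp add: card_spin_configs)
  also have "(2 :: real) ^ N = exp (real N * ln 2)" by (simp add: exp_of_nat_mult)
  finally show ?thesis by (simp add: distrib_left exp_add)
qed

text \<open>In p * H1 + (1 - p) * H0 the Curie--Weiss part retains coefficient exactly 1 when the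
  rest is written with the centered matrix. The moment, the lower bound and the reference partition
  function therefore share the same leading term N * \<Phi>, and the \<rho>-terms of the first two
  cancel after division by p.\<close>

lemma ising_le_curie_weiss_step:
  fixes A :: "real mat"
  defines "a \<equiv> entries A"
  defines "\<rho> \<equiv> \<lambda>N. \<Sum>i<N. (\<Sum>j<N. a i j) - 1"
  assumes N: "N > 0" and coupling: "coupling_matrix N A" and E: "E \<subseteq> spin_configs N"
    and p: "p > 1" and t: "tanh (\<beta> * t) = t"
    and \<Phi>: "\<Phi> = ln (2 * cosh (\<beta> * t)) - \<beta> * t\<^sup>2 / 2"
    and \<beta>: "\<beta> > 0"
    and U: "(\<Sum>\<sigma>\<in>spin_configs N. exp (\<beta> / (2 * real N) * (spin_sum \<sigma>)\<^sup>2
      + p * \<beta> / 2 * quad_form N (centered N a) (($) \<sigma>))) \<le> exp (real N * \<Phi> + p * \<beta> / 2 * (t\<^sup>2 * \<rho> N) + U')"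
    and V: "(\<Sum>\<sigma>\<in>spin_configs N. exp (\<beta> / (2 * real N) * (spin_sum \<sigma>)\<^sup>2)) \<le> exp (real N * \<Phi> + V')"
    and D: "U' / p + (1 - 1 / p) * V' \<le> D"
  shows "log_ext (measure_pmf.prob (ising_pmf A \<beta> 0) E)
    \<le> ereal (1 - 1 / p) * log_ext (measure_pmf.prob (curie_weiss_pmf N \<beta> 0) E) + ereal D"
proof -
  note coup = coupling_matrixD[OF coupling, folded a_def]
  define H1 where "H1 = (\<lambda>\<sigma>. 1 / 2 * quad_form N (\<lambda>i j. \<beta> * a i j) (($) \<sigma>) + 0 * spin_sum \<sigma>)"
  define H0 where "H0 = (\<lambda>\<sigma>. \<beta> / (2 * real N) * (spin_sum \<sigma>)\<^sup>2)"
  have "(\<Sum>\<sigma>\<in>spin_configs N. exp (p * H1 \<sigma> + (1 - p) * H0 \<sigma>))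
    \<le> (\<Sum>\<sigma>\<in>spin_configs N. exp (\<beta> / (2 * real N) * (spin_sum \<sigma>)\<^sup>2
      + p * \<beta> / 2 * quad_form N (centered N a) (($) \<sigma>)))"
  proof (intro sum_mono)
    fix \<sigma> assume \<sigma>: "\<sigma> \<in> spin_configs N"
    have s: "(\<Sum>i<N. \<sigma> $ i) = spin_sum \<sigma>" using \<sigma> by (auto simp: spin_configs_def spin_sum_def)
    have "sq_norm N (($) \<sigma>) = (\<Sum>i<N. 1)"
      unfolding sq_norm_def using \<sigma> by (intro sum.cong) (auto simp: spin_configs_def)
    then have "quad_form N (centered N a) (($) \<sigma>) = quad_form N a (($) \<sigma>) - (spin_sum \<sigma>)\<^sup>2 / real N + 1"
      unfolding quad_form_centered s using N by simp
    moreover have "\<beta> / (2 * real N) * (spin_sum \<sigma>)\<^sup>2 = \<beta> / 2 * ((spin_sum \<sigma>)\<^sup>2 / real N)" by simp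
    \<comment> \<open>Here x stands for the squared spin sum over N and Q for the form of the
      uncentered matrix. The surplus p * \<beta> / 2, caused by the empty diagonal, is positive and
      is dropped.\<close>
    moreover have "\<beta> / 2 * x + p * \<beta> / 2 * (Q - x + 1) = (p * (1 / 2 * (\<beta> * Q) + 0 * z) + (1 - p) * (\<beta> / 2 * x)) + p * \<beta> / 2"
      for x z Q by (simp add: field_simps)
    ultimately have "\<beta> / (2 * real N) * (spin_sum \<sigma>)\<^sup>2 + p * \<beta> / 2 * quad_form N (centered N a) (($) \<sigma>)
      = (p * H1 \<sigma> + (1 - p) * H0 \<sigma>) + p * \<beta> / 2"
      by (simp only: H1_def H0_def quad_form_scale)
    then show "exp (p * H1 \<sigma> + (1 - p) * H0 \<sigma>) \<le> exp (\<beta> / (2 * real N) * (spin_sum \<sigma>)\<^sup>2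
      + p * \<beta> / 2 * quad_form N (centered N a) (($) \<sigma>))"
      using p \<beta> by simp
  qed
  from order_trans[OF this U]
  have U1: "(\<Sum>\<sigma>\<in>spin_configs N. exp (p * H1 \<sigma> + (1 - p) * H0 \<sigma>)) \<le> exp (real N * \<Phi> + p * \<beta> / 2 * (t\<^sup>2 * \<rho> N) + U')" .
  have L: "exp (real N * \<Phi> + \<beta> / 2 * (t\<^sup>2 * \<rho> N)) \<le> partition_function N H1"
  proof -
    have "(\<Sum>i<N. \<Sum>j<N. \<beta> * a i j) = \<beta> * (\<rho> N + real N)"
      by (simp add: \<rho>_def sum_subtractf flip: sum_distrib_left)
    moreover have "real N * \<Phi> + \<beta> / 2 * (t\<^sup>2 * \<rho> N)
        = real N * ln (2 * cosh (\<beta> * t)) + t\<^sup>2 / 2 * (\<beta> * (\<rho> N + real N)) + (0 - \<beta> * t) * t * real N"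
      unfolding \<Phi> by (simp add: power2_eq_square algebra_simps)
    ultimately show ?thesis
      using partition_function_ge_mean_field[of N "\<lambda>i j. \<beta> * a i j" "\<beta> * t" 0] coup(4)
      unfolding H1_def t by simp
  qed
  have V1: "partition_function N H0 \<le> exp (real N * \<Phi> + V')"
    using V by (simp add: partition_function_def H0_def)
  have "(real N * \<Phi> + p * \<beta> / 2 * (t\<^sup>2 * \<rho> N) + U') / p - (real N * \<Phi> + \<beta> / 2 * (t\<^sup>2 * \<rho> N))
      + (1 - 1 / p) * (real N * \<Phi> + V') = U' / p + (1 - 1 / p) * V'"
  proof -
    have "p * \<beta> / 2 * (t\<^sup>2 * \<rho> N) / p = \<beta> / 2 * (t\<^sup>2 * \<rho> N)" using p by simp
    then show ?thesis unfolding add_divide_distrib by (simp add: algebra_simps)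
  qed
  then have D1: "(real N * \<Phi> + p * \<beta> / 2 * (t\<^sup>2 * \<rho> N) + U') / p - (real N * \<Phi> + \<beta> / 2 * (t\<^sup>2 * \<rho> N))
      + (1 - 1 / p) * (real N * \<Phi> + V') \<le> D" using D by simp
  show ?thesis
    unfolding ising_pmf_eq_gibbs[OF coupling] curie_weiss_pmf_eq_gibbs[OF N]
    by (rule gibbs_change_of_measure[OF E p U1 L V1 D1, unfolded H1_def H0_def a_def])
qed

lemma ising_le_curie_weiss_trivial:
  assumes N: "N > 0" and coupling: "coupling_matrix N A" and E: "E \<subseteq> spin_configs N"
    and p: "p > 1" and \<beta>: "\<beta> > 0" and D: "(ln 2 + \<beta> / 2) * real N \<le> D"
  shows "log_ext (measure_pmf.prob (ising_pmf A \<beta> 0) E)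
    \<le> ereal (1 - 1 / p) * log_ext (measure_pmf.prob (curie_weiss_pmf N \<beta> 0) E) + ereal D"
  unfolding ising_pmf_eq_gibbs[OF coupling] curie_weiss_pmf_eq_gibbs[OF N]
proof (rule gibbs_trivial_bound[OF E _ _ partition_function_curie_weiss_le[OF N]])
  show "(1 - 1 / p) * (real N * (ln 2 + \<beta> / 2) - 0) \<le> D"
  proof -
    have "(1 - 1 / p) * (real N * (ln 2 + \<beta> / 2) - 0) \<le> 1 * (real N * (ln 2 + \<beta> / 2) - 0)"
      using p \<beta> by (intro mult_right_mono) auto
    then show ?thesis using D by (simp add: mult.commute)
  qed
qed (use p \<beta> in auto)

theorem ising_le_curie_weiss_low_temperature:
  fixes A :: "nat \<Rightarrow> real mat"
  assumes coupling: "\<And>N. N \<ge> 2 \<Longrightarrow> coupling_matrix N (A N)"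
    and top: "(\<lambda>N. nth_eigenvalue (A N) 1) \<longlonglongrightarrow> 1"
    and events: "\<And>N. N \<ge> 2 \<Longrightarrow> E N \<subseteq> spin_configs N"
    and gap: "limsup (\<lambda>N. ereal (nth_eigenvalue (A N) 2 / nth_eigenvalue (A N) 1)) < 1"
    and \<beta>: "\<beta> > 1"
  shows "\<exists>c>0. \<exists>C. \<forall>N\<ge>2.
    log_ext (measure_pmf.prob (ising_pmf (A N) \<beta> 0) (E N))
      \<le> ereal c * log_ext (measure_pmf.prob (curie_weiss_pmf N \<beta> 0) (E N))
        + ereal (C * ((frobenius_norm (A N))\<^sup>2 + (\<Sum>i<N. (row_total (A N) i - 1)\<^sup>2)))"
    (is "\<exists>c>0. \<exists>C. \<forall>N\<ge>2. ?P c C N")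
proof -
  obtain q \<epsilon> N0 where q: "0 \<le> q" "q < 1" "\<epsilon> > 0"
    "\<And>N x. N \<ge> 2 \<Longrightarrow> N \<ge> N0 \<Longrightarrow> (\<Sum>i<N. (row_total (A N) i - 1)\<^sup>2) \<le> \<epsilon> * real N \<Longrightarrow>
      quad_form N (centered N (entries (A N))) x \<le> q * sq_norm N x"
    using eventually_spectral_gap[OF coupling top gap] by blast
  have \<beta>0: "\<beta> > 0" using \<beta> by simp
  define \<eta> where "\<eta> = (1 - q) / 4"
  have \<eta>: "\<eta> > 0" using q by (simp add: \<eta>_def)
  define p where "p = 1 + \<eta>"
  have p: "p > 1" using \<eta> by (simp add: p_def)
  obtain t \<kappa> L where t: "0 < t" "tanh (\<beta> * t) = t" "\<kappa> > 0" "L \<ge> 0"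
    "\<And>y. \<exists>c \<mu> K. spin_bound (\<beta> * y) c \<mu> K \<and> 0 < K \<and> K \<le> 1 \<and> \<bar>\<mu>\<bar> \<le> 1 \<and> \<beta> * K \<le> 1 + \<eta> \<and>
      c - \<beta> * y\<^sup>2 / 2 \<le> ln (2 * cosh (\<beta> * t)) - \<beta> * t\<^sup>2 / 2 - \<kappa> * (\<bar>y\<bar> - t)\<^sup>2 \<and>
      \<bar>\<mu>\<^sup>2 - t\<^sup>2\<bar> \<le> L * \<bar>\<bar>y\<bar> - t\<bar>"
    using low_temperature_spin_bounds[OF \<beta> \<eta>] by blast
  define \<Phi> where "\<Phi> = ln (2 * cosh (\<beta> * t)) - \<beta> * t\<^sup>2 / 2"
  define Cb where "Cb = (\<lambda>b. b / 2 + 2 * b\<^sup>2 / \<eta> + (b / 2 * L)\<^sup>2 / (2 * \<kappa>) + \<bar>ln (2 * sqrt (\<beta> / \<kappa>))\<bar>)"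
  have Cb: "Cb b \<ge> 0" if "b \<ge> 0" for b using that \<eta> t by (simp add: Cb_def)
  \<comment> \<open>The factor 5 turns 1 + F + r2 into a multiple of F + r2, using F + r2 at least 1
    / 4. In \<open>C2\<close>, 4 * N0 serves the small N and 1 / \<epsilon> the matrices with r2
    above \<epsilon> * N.\<close>
  define C1 where "C1 = 5 * (Cb (p * \<beta>) + Cb 0)"
  define C2 where "C2 = (ln 2 + \<beta> / 2) * (4 * real N0 + 1 / \<epsilon>)"
  have C: "C1 \<ge> 0" "C2 \<ge> 0" using Cb[of "p * \<beta>"] Cb[of 0] p \<beta> q by (auto simp: C1_def C2_def)
  have pp: "1 - 1 / p > 0" using p by simp
  have main: "?P (1 - 1 / p) (C1 + C2) N" if N: "N \<ge> 2" for N
  proof -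
    define a where "a = entries (A N)"
    note coup = coupling_matrixD[OF coupling[OF N], folded a_def]
    define F where "F = (\<Sum>i<N. \<Sum>j<N. (a i j)\<^sup>2)"
    define r2 where "r2 = (\<Sum>i<N. ((\<Sum>j<N. a i j) - 1)\<^sup>2)"
    have N': "N > 0" using N by simp
    have F4: "1 / 4 \<le> F + r2" unfolding F_def r2_def by (rule frobenius_plus_rows_ge[OF N'])
    have nonneg: "F \<ge> 0" "r2 \<ge> 0" by (auto simp: F_def r2_def sum_nonneg)
    have eq: "(frobenius_norm (A N))\<^sup>2 + (\<Sum>i<N. (row_total (A N) i - 1)\<^sup>2) = F + r2"
      by (simp add: F_def r2_def coup(5,6))
    show ?thesis
    proof (cases "N \<ge> N0 \<and> r2 \<le> \<epsilon> * real N")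
      case True
      have sub: "quad_form N (centered N a) x \<le> q * sq_norm N x" for x
        using q(4)[OF N, of x] True by (simp add: a_def r2_def coup(5)[unfolded a_def])
      have upper: "(\<Sum>\<sigma>\<in>spin_configs N. exp (\<beta> / (2 * real N) * (spin_sum \<sigma>)\<^sup>2
          + b / 2 * quad_form N (centered N a) (($) \<sigma>)))
        \<le> exp (real N * \<Phi> + b / 2 * (t\<^sup>2 * (\<Sum>i<N. (\<Sum>j<N. a i j) - 1)) + Cb b * (1 + F + r2))"
        if b: "0 \<le> b" "b \<le> p * \<beta>" for b
        unfolding Cb_def F_def r2_def
      proof (rule partition_upper_low_temperature[OF N' coup(3,4) \<beta>0 b(1) \<eta> t(3,4)])
        fix y
        obtain c \<mu> K where c: "spin_bound (\<beta> * y) c \<mu> K" "0 < K" "K \<le> 1" "\<bar>\<mu>\<bar> \<le> 1" "\<beta> * K \<le> 1 + \<eta>"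
          "c - \<beta> * y\<^sup>2 / 2 \<le> \<Phi> - \<kappa> * (\<bar>y\<bar> - t)\<^sup>2" "\<bar>\<mu>\<^sup>2 - t\<^sup>2\<bar> \<le> L * \<bar>\<bar>y\<bar> - t\<bar>"
          using t(5)[of y] unfolding \<Phi>_def by blast
        have "K * b * quad_form N (centered N a) x \<le> (1 - \<eta>) * sq_norm N x" for x
        proof -
          have "K * b \<le> K * (p * \<beta>)" using c b by (intro mult_left_mono) auto
          also have "\<dots> = p * (\<beta> * K)" by simp
          also have "\<dots> \<le> p * (1 + \<eta>)" using c p by (intro mult_left_mono) auto
          also have "\<dots> = (1 + \<eta>)\<^sup>2" by (simp add: p_def power2_eq_square)
          finally have Kb: "K * b \<le> (1 + \<eta>)\<^sup>2" .
          show ?thesis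
            using c b by (intro subcritical_form[OF q(1,2) \<eta>_def _ Kb sub sq_norm_nonneg]) simp
        qed
        then show "\<exists>c \<mu> K. spin_bound (\<beta> * y) c \<mu> K \<and> 0 < K \<and> K \<le> 1 \<and> \<bar>\<mu>\<bar> \<le> 1 \<and>
          (\<forall>x. K * b * quad_form N (centered N a) x \<le> (1 - \<eta>) * sq_norm N x) \<and>
          c - \<beta> * y\<^sup>2 / 2 \<le> \<Phi> - \<kappa> * (\<bar>y\<bar> - t)\<^sup>2 \<and> \<bar>\<mu>\<^sup>2 - t\<^sup>2\<bar> \<le> L * \<bar>\<bar>y\<bar> - t\<bar>"
          using c by (intro exI[of _ c] exI[of _ \<mu>] exI[of _ K]) simp
      qed
      have pb: "0 \<le> p * \<beta>" using p \<beta> by simp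
      note U = upper[OF pb order_refl]
      \<comment> \<open>With b = 0 the same estimate bounds the Curie--Weiss partition function
        itself.\<close>
      have V: "(\<Sum>\<sigma>\<in>spin_configs N. exp (\<beta> / (2 * real N) * (spin_sum \<sigma>)\<^sup>2)) \<le> exp (real N * \<Phi> + Cb 0 * (1 + F + r2))"
        using upper[OF order_refl pb] by simp
      show ?thesis
        unfolding eq
      proof (rule ising_le_curie_weiss_step[OF N' coupling[OF N] events[OF N] p t(2) \<Phi>_def \<beta>0 U[unfolded a_def] V])
        define X where "X = 1 + F + r2"
        have X: "0 \<le> X" "X \<le> 5 * (F + r2)" using nonneg F4 by (auto simp: X_def)
        have "Cb (p * \<beta>) * X / p \<le> Cb (p * \<beta>) * X / 1"
          using p X Cb[OF pb] by (intro divide_left_mono mult_nonneg_nonneg) auto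
        moreover have "(1 - 1 / p) * (Cb 0 * X) \<le> 1 * (Cb 0 * X)"
          using p X Cb[of 0] by (intro mult_right_mono) auto
        ultimately have "Cb (p * \<beta>) * X / p + (1 - 1 / p) * (Cb 0 * X) \<le> (Cb (p * \<beta>) + Cb 0) * X"
          by (simp add: distrib_right)
        also have "\<dots> \<le> (Cb (p * \<beta>) + Cb 0) * (5 * (F + r2))"
          using X Cb[OF pb] Cb[of 0] by (intro mult_left_mono) auto
        also have "\<dots> = C1 * (F + r2)" by (simp add: C1_def algebra_simps)
        also have "\<dots> \<le> (C1 + C2) * (F + r2)" using C nonneg by (intro mult_right_mono) auto
        finally show "Cb (p * \<beta>) * (1 + F + r2) / p + (1 - 1 / p) * (Cb 0 * (1 + F + r2)) \<le> (C1 + C2) * (F + r2)"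
          by (simp only: X_def)
      qed
    next
      case False
      have "real N \<le> (4 * real N0 + 1 / \<epsilon>) * (F + r2)"
      proof (cases "N < N0")
        case True
        have "real N \<le> 4 * real N0 * (1 / 4)" using True by simp
        also have "\<dots> \<le> (4 * real N0 + 1 / \<epsilon>) * (F + r2)"
          using q F4 by (intro mult_mono) auto
        finally show ?thesis .
      next
        case F': False
        with False have "\<epsilon> * real N < r2" by simp
        then have "real N \<le> 1 / \<epsilon> * r2" using q by (simp add: field_simps)
        also have "\<dots> \<le> (4 * real N0 + 1 / \<epsilon>) * (F + r2)"
          using q nonneg by (intro mult_mono) auto
        finally show ?thesis .
      qed
      then have "(ln 2 + \<beta> / 2) * real N \<le> C2 * (F + r2)"
        using \<beta> mult_left_mono[of _ _ "ln 2 + \<beta> / 2"] by (simp add: C2_def mult.assoc)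
      also have "\<dots> \<le> (C1 + C2) * (F + r2)" using C nonneg by (intro mult_right_mono) auto
      finally show ?thesis
        unfolding eq using \<beta> by (intro ising_le_curie_weiss_trivial[OF N' coupling[OF N] events[OF N] p]) auto
    qed
  qed
  show ?thesis using pp main by blast
qed

theorem ising_le_curie_weiss_critical:
  fixes A :: "nat \<Rightarrow> real mat"
  assumes coupling: "\<And>N. N \<ge> 2 \<Longrightarrow> coupling_matrix N (A N)"
    and top: "(\<lambda>N. nth_eigenvalue (A N) 1) \<longlonglongrightarrow> 1"
    and events: "\<And>N. N \<ge> 2 \<Longrightarrow> E N \<subseteq> spin_configs N"
    and gap: "limsup (\<lambda>N. ereal (nth_eigenvalue (A N) 2 / nth_eigenvalue (A N) 1)) < 1"
  shows "\<exists>c>0. \<exists>C. \<forall>N\<ge>2.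
    log_ext (measure_pmf.prob (ising_pmf (A N) 1 0) (E N))
      \<le> ereal c * log_ext (measure_pmf.prob (curie_weiss_pmf N 1 0) (E N))
        + ereal (C * ((frobenius_norm (A N))\<^sup>2
            + 1 / real N * (\<Sum>i<N. (row_total (A N) i - 1)\<^sup>2)\<^sup>2
            + 1 / real N * (\<Sum>i<N. (row_total (A N) i - 1))\<^sup>2
            + ln (real N)))"
    (is "\<exists>c>0. \<exists>C. \<forall>N\<ge>2. ?P c C N")
proof -
  obtain q \<epsilon> N0 where q: "0 \<le> q" "q < 1" "\<epsilon> > 0"
    "\<And>N x. N \<ge> 2 \<Longrightarrow> N \<ge> N0 \<Longrightarrow> (\<Sum>i<N. (row_total (A N) i - 1)\<^sup>2) \<le> \<epsilon> * real N \<Longrightarrow>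
      quad_form N (centered N (entries (A N))) x \<le> q * sq_norm N x"
    using eventually_spectral_gap[OF coupling top gap] by blast
  define \<eta> where "\<eta> = (1 - q) / 4"
  have \<eta>: "\<eta> > 0" using q by (simp add: \<eta>_def)
  define p where "p = 1 + \<eta>"
  have p: "p > 1" using \<eta> by (simp add: p_def)
  define Cb where "Cb = (\<lambda>b. (b / 2 + 2 * b\<^sup>2 / \<eta>) + 3 * b\<^sup>2 + 12 * (b / 2 + 2 * b\<^sup>2 / \<eta>)\<^sup>2 + 1)"
  have Cb: "Cb b \<ge> 0" if "b \<ge> 0" for b using that \<eta> by (simp add: Cb_def)
  \<comment> \<open>ln N is at least ln 2, which absorbs the additive 1. In \<open>C2\<close>, 1 /
    \<epsilon>^2 arises because r2 above \<epsilon> * N makes r2^2 / N exceed \<epsilon>^2 *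
    N.\<close>
  define C1 where "C1 = (1 + 1 / ln 2) * (Cb p + Cb 0)"
  define C2 where "C2 = (ln 2 + 1 / 2) * (real N0 / ln 2 + 1 / \<epsilon>\<^sup>2)"
  have C: "C1 \<ge> 0" "C2 \<ge> 0" using Cb[of p] Cb[of 0] p q by (auto simp: C1_def C2_def)
  have pp: "1 - 1 / p > 0" using p by simp
  have main: "?P (1 - 1 / p) (C1 + C2) N" if N: "N \<ge> 2" for N
  proof -
    define a where "a = entries (A N)"
    note coup = coupling_matrixD[OF coupling[OF N], folded a_def]
    define F where "F = (\<Sum>i<N. \<Sum>j<N. (a i j)\<^sup>2)"
    define r2 where "r2 = (\<Sum>i<N. ((\<Sum>j<N. a i j) - 1)\<^sup>2)"
    define \<rho> where "\<rho> = (\<Sum>i<N. (\<Sum>j<N. a i j) - 1)"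
    define Y where "Y = F + 1 / real N * r2\<^sup>2 + 1 / real N * \<rho>\<^sup>2 + ln (real N)"
    have N': "N > 0" using N by simp
    have ln2: "0 < ln (2 :: real)" by simp
    have lnN: "ln 2 \<le> ln (real N)" using N by simp
    have nonneg: "F \<ge> 0" "1 / real N * r2\<^sup>2 \<ge> 0" "1 / real N * \<rho>\<^sup>2 \<ge> 0" by (auto simp: F_def sum_nonneg)
    have Y: "ln (real N) \<le> Y" "1 / real N * r2\<^sup>2 \<le> Y" "0 \<le> Y"
      using nonneg lnN ln2 unfolding Y_def by linarith+
    have eq: "(frobenius_norm (A N))\<^sup>2 + 1 / real N * (\<Sum>i<N. (row_total (A N) i - 1)\<^sup>2)\<^sup>2
            + 1 / real N * (\<Sum>i<N. (row_total (A N) i - 1))\<^sup>2 + ln (real N) = Y"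
      by (simp only: Y_def F_def r2_def \<rho>_def coup(5,6))
    show ?thesis
    proof (cases "N \<ge> N0 \<and> r2 \<le> \<epsilon> * real N")
      case True
      have sub: "quad_form N (centered N a) x \<le> q * sq_norm N x" for x
        using q(4)[OF N, of x] True by (simp add: a_def r2_def coup(5)[unfolded a_def])
      have upper: "(\<Sum>\<sigma>\<in>spin_configs N. exp (1 / (2 * real N) * (spin_sum \<sigma>)\<^sup>2
          + b / 2 * quad_form N (centered N a) (($) \<sigma>)))
        \<le> exp (real N * ln 2 + Cb b * (1 + F + 1 / real N * r2\<^sup>2 + 1 / real N * \<rho>\<^sup>2 + ln (real N)))"
        if b: "0 \<le> b" "b \<le> p" for b
        unfolding Cb_def F_def r2_def \<rho>_def
      proof (rule partition_upper_critical[OF N coup(3,4) b(1) \<eta>])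
        fix K x :: "_" assume K: "0 < K" "K \<le> (1 :: real)"
        have "K * b \<le> 1 * p" using K b by (intro mult_mono) auto
        also have "\<dots> \<le> (1 + \<eta>)\<^sup>2" using \<eta> by (simp add: p_def power2_eq_square)
        finally have Kb: "K * b \<le> (1 + \<eta>)\<^sup>2" .
        show "K * b * quad_form N (centered N a) x \<le> (1 - \<eta>) * sq_norm N x"
          using K b by (intro subcritical_form[OF q(1,2) \<eta>_def _ Kb sub sq_norm_nonneg]) simp
      qed
      define X where "X = 1 + F + 1 / real N * r2\<^sup>2 + 1 / real N * \<rho>\<^sup>2 + ln (real N)"
      have p0: "0 \<le> p" using p by simp
      \<comment> \<open>At \<beta> = 1 the reference mean is t = 0 and \<Phi> = ln 2; the
        \<rho>-term has coefficient 0^2 and is written out only to match the general comparison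
        step.\<close>
      have U: "(\<Sum>\<sigma>\<in>spin_configs N. exp (1 / (2 * real N) * (spin_sum \<sigma>)\<^sup>2
          + p * 1 / 2 * quad_form N (centered N (entries (A N))) (($) \<sigma>)))
        \<le> exp (real N * ln 2 + p * 1 / 2 * (0\<^sup>2 * (\<Sum>i<N. (\<Sum>j<N. entries (A N) i j) - 1)) + Cb p * X)"
        using upper[OF p0 order_refl] by (simp add: X_def a_def)
      have V: "(\<Sum>\<sigma>\<in>spin_configs N. exp (1 / (2 * real N) * (spin_sum \<sigma>)\<^sup>2)) \<le> exp (real N * ln 2 + Cb 0 * X)"
        using upper[OF order_refl p0] by (simp add: X_def)
      show ?thesis
        unfolding eq
      proof (rule ising_le_curie_weiss_step[OF N' coupling[OF N] events[OF N] p _ _ _ U V])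
        have X: "0 \<le> X" "X \<le> (1 + 1 / ln 2) * Y"
        proof -
          have "1 \<le> ln (real N) / ln 2" using lnN ln2 by simp
          also have "\<dots> \<le> Y / ln 2" using Y ln2 by (intro divide_right_mono) auto
          finally show "X \<le> (1 + 1 / ln 2) * Y" by (simp add: X_def Y_def distrib_right)
          show "0 \<le> X" using nonneg lnN ln2 unfolding X_def by linarith
        qed
        have "Cb p * X / p \<le> Cb p * X / 1"
          using p X Cb[OF p0] by (intro divide_left_mono mult_nonneg_nonneg) auto
        moreover have "(1 - 1 / p) * (Cb 0 * X) \<le> 1 * (Cb 0 * X)"
          using p X Cb[of 0] by (intro mult_right_mono) auto
        ultimately have "Cb p * X / p + (1 - 1 / p) * (Cb 0 * X) \<le> (Cb p + Cb 0) * X"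
          by (simp add: distrib_right)
        also have "\<dots> \<le> (Cb p + Cb 0) * ((1 + 1 / ln 2) * Y)"
          using X Cb[OF p0] Cb[of 0] by (intro mult_left_mono) auto
        also have "\<dots> = C1 * Y" by (simp add: C1_def)
        also have "\<dots> \<le> (C1 + C2) * Y" using C Y by (intro mult_right_mono) auto
        finally show "Cb p * X / p + (1 - 1 / p) * (Cb 0 * X) \<le> (C1 + C2) * Y" .
      qed auto
    next
      case False
      have "real N \<le> (real N0 / ln 2 + 1 / \<epsilon>\<^sup>2) * Y"
      proof (cases "N < N0")
        case True
        have "real N \<le> real N0 / ln 2 * ln 2" using True by simp
        also have "\<dots> \<le> (real N0 / ln 2 + 1 / \<epsilon>\<^sup>2) * Y"
          using lnN Y ln2 by (intro mult_mono) auto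
        finally show ?thesis .
      next
        case F': False
        with False have "\<epsilon> * real N < r2" by simp
        then have "(\<epsilon> * real N)\<^sup>2 \<le> r2\<^sup>2" using q by (intro power_mono) auto
        then have "real N \<le> 1 / \<epsilon>\<^sup>2 * (1 / real N * r2\<^sup>2)"
          using q N' by (simp add: power_mult_distrib field_simps power2_eq_square)
        also have "\<dots> \<le> (real N0 / ln 2 + 1 / \<epsilon>\<^sup>2) * Y"
          using Y nonneg ln2 by (intro mult_mono) auto
        finally show ?thesis .
      qed
      then have "(ln 2 + 1 / 2) * real N \<le> (ln 2 + 1 / 2) * ((real N0 / ln 2 + 1 / \<epsilon>\<^sup>2) * Y)"
        using ln2 by (intro mult_left_mono) auto
      also have "\<dots> = C2 * Y" by (simp only: C2_def mult.assoc)
      also have "\<dots> \<le> (C1 + C2) * Y" using C Y by (intro mult_right_mono) auto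
      finally show ?thesis
        unfolding eq by (intro ising_le_curie_weiss_trivial[OF N' coupling[OF N] events[OF N] p]) auto
    qed
  qed
  show ?thesis using pp main by blast
qed

theorem theorem1p6:
  fixes A :: "nat \<Rightarrow> real mat" and E :: "nat \<Rightarrow> real vec set" and \<beta> B :: real
  assumes coupling: "\<And>N. N \<ge> 2 \<Longrightarrow> coupling_matrix N (A N)"
    and row_bound: "bdd_above ((\<lambda>N. Max (row_total (A N) ` {..<N})) ` {2..})"
    and top_eigenvalue: "(\<lambda>N. nth_eigenvalue (A N) 1) \<longlonglongrightarrow> 1"
    and events: "\<And>N. N \<ge> 2 \<Longrightarrow> E N \<subseteq> spin_configs N"
  shows
    "((\<beta>, B) \<in> Theta1 \<longrightarrow>
       (\<exists>c>0. \<exists>C. \<forall>N\<ge>2.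
          log_ext (measure_pmf.prob (ising_pmf (A N) \<beta> B) (E N))
            \<le> ereal c * log_ext (measure_pmf.prob (iid_pmf N \<beta> B) (E N))
              + ereal (C * ((frobenius_norm (A N))\<^sup>2
                  + (mf_root \<beta> B)\<^sup>2 * (\<Sum>i<N. (row_total (A N) i - 1)\<^sup>2)))))
     \<and>
     ((\<beta>, B) \<in> Theta2 \<and>
        limsup (\<lambda>N. ereal (nth_eigenvalue (A N) 2 / nth_eigenvalue (A N) 1)) < 1 \<longrightarrow>
       (\<exists>c>0. \<exists>C. \<forall>N\<ge>2.
          log_ext (measure_pmf.prob (ising_pmf (A N) \<beta> B) (E N))
            \<le> ereal c * log_ext (measure_pmf.prob (curie_weiss_pmf N \<beta> B) (E N))
              + ereal (C * ((frobenius_norm (A N))\<^sup>2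
                  + (\<Sum>i<N. (row_total (A N) i - 1)\<^sup>2)))))
     \<and>
     ((\<beta>, B) \<in> Theta3 \<and>
        limsup (\<lambda>N. ereal (nth_eigenvalue (A N) 2 / nth_eigenvalue (A N) 1)) < 1 \<longrightarrow>
       (\<exists>c>0. \<exists>C. \<forall>N\<ge>2.
          log_ext (measure_pmf.prob (ising_pmf (A N) \<beta> B) (E N))
            \<le> ereal c * log_ext (measure_pmf.prob (curie_weiss_pmf N \<beta> B) (E N))
              + ereal (C * ((frobenius_norm (A N))\<^sup>2
                  + 1 / real N * (\<Sum>i<N. (row_total (A N) i - 1)\<^sup>2)\<^sup>2
                  + 1 / real N * (\<Sum>i<N. (row_total (A N) i - 1))\<^sup>2
                  + ln (real N)))))"
proof (intro conjI impI, goal_cases)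
  case 1
  show ?case by (rule ising_le_iid[OF coupling top_eigenvalue events 1])
next
  case 2
  then have "\<beta> > 1" "B = 0" by (auto simp: Theta2_def)
  with 2 show ?case
    using ising_le_curie_weiss_low_temperature[OF coupling top_eigenvalue events] by simp
next
  case 3
  then have "\<beta> = 1" "B = 0" by (auto simp: Theta3_def)
  with 3 show ?case
    using ising_le_curie_weiss_critical[OF coupling top_eigenvalue events] by simp
qed

end
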